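(* Let $G$ be a finitely generated group that (equipped with a word metric) is a hierarchically hyperbolic space. Then $G$ is finitely presented and has quadratic Dehn function. In particular, this conclusion holds when $G$ is a hierarchically hyperbolic group.
   Context: Hierarchically hyperbolic spaces (HHS). A $q$-quasigeodesic space is a metric space in which any two points are joined by a $(q,q)$-quasigeodesic. A $q$-quasigeodesic space $(\mathcal X,d_{\mathcal X})$ is an HHS (with structure $\mathfrak S$; one writes $(\mathcal X,\mathfrak S)$) if there are $\delta\ge0$, an index set $\mathfrak S$ and $\delta$-hyperbolic geodesic spaces $(\mathcal CW,d_W)$, $W\in\mathfrak S$, such that (1)–(9) below hold. Conventions: the distance between two sets is the infimum of distances between their points; for $x,y\in\mathcal X$ and $p\subseteq\mathcal CW$, $d_W(x,y)=d_W(\pi_W(x),\pi_W(y))$ and $d_W(x,p)=d_W(\pi_W(x),p)$; $V\sqsubset W$ means $V\sqsubseteq W$ and $V\ne W$. (1) Projections: there are $\xi,K\ge 0$ and maps $\pi_W:\mathcal X\to2^{\mathcal CW}$ ($W\in\mathfrak S$) sending points to nonempty sets of diameter $\le\xi$; each $\pi_W$ is $(K,K)$-coarsely Lipschitz and $\pi_W(\mathcal X)$ is $K$-quasiconvex in $\mathcal CW$. (2) Nesting: $\mathfrak S$ has a partial order $\sqsubseteq$, and either $\mathfrak S=\emptyset$ or there is a unique $\sqsubseteq$-maximal element. Put $\mathfrak S_W=\{V:V\sqsubseteq W\}$. If $V\sqsubset W$ there is a specified subset $\rho^V_W\subset\mathcal CW$ of diameter $\le\xi$ and a map $\rho^W_V:\mathcal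 CW\to2^{\mathcal CV}$. (3) Orthogonality: $\mathfrak S$ has a symmetric anti-reflexive relation $\perp$. If $V\sqsubseteq W$ and $W\perp U$ then $V\perp U$. For each $T\in\mathfrak S$ and $U\in\mathfrak S_T$ with $\{V\in\mathfrak S_T:V\perp U\}\ne\emptyset$ there is $W\in\mathfrak S_T-\{T\}$ such that $V\sqsubseteq W$ whenever $V\perp U$ and $V\sqsubseteq T$. If $V\perp W$ then $V,W$ are not $\sqsubseteq$-comparable. (4) Transversality and consistency: if $V,W$ are not orthogonal and neither is nested in the other they are transverse, $V\pitchfork W$. There is $\kappa_0\ge0$ such that: if $V\pitchfork W$ there are sets $\rho^V_W\subseteq\mathcal CW$, $\rho^W_V\subseteq\mathcal CV$ of diameter $\le\xi$ with $\min\{d_W(\pi_W(x),\rho^V_W),d_V(\pi_V(x),\rho^W_V)\}\le\kappa_0$ for all $x\in\mathcal X$; if $V\sqsubset W$ then $\min\{d_W(\pi_W(x),\rho^V_W),\mathrm{diam}_{\mathcal CV}(\pi_V(x)\cup\rho^W_V(\pi_W(x)))\}\le\kappa_0$ for all $x\in\mathcal X$; and if $U\sqsubseteq V$ then $d_W(\rho^U_W,\rho^V_W)\le\kappa_0$ whenever either $V\sqsubset W$, or $V\pitchfork W$ and $W\not\perp U$. (5) Finite complexity: there is $n\ge0$ (the complexity) such that any set of pairwise $\sqsubseteq$-comparable elements has at most $n$ elements. (6) Large links: there are $\lambda\ge1$, $E\ge\max\{\xi,\kappa_0\}$ such that for $W\in\mathfrak S$, $x,x'\in\mathcal X$ and $N=\lambda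 d_W(x,x')+\lambda$ there is a collection $\{T_i\}\subseteq\mathfrak S_W-\{W\}$ of at most $\lfloor N\rfloor$ elements such that every $T\in\mathfrak S_W-\{W\}$ either lies in some $\mathfrak S_{T_i}$ or satisfies $d_T(x,x')<E$; moreover $d_W(x,\rho^{T_i}_W)\le N$ for all $i$. (7) Bounded geodesic image: there is $E>0$ such that for all $V\sqsubset W$ and all geodesics $\gamma$ of $\mathcal CW$, either $\mathrm{diam}_{\mathcal CV}(\rho^W_V(\gamma))\le E$ or $\gamma$ meets the $E$-neighborhood of $\rho^V_W$. (8) Partial realization: there is $\alpha$ such that for every family $\{V_j\}$ of pairwise orthogonal elements and $p_j\in\pi_{V_j}(\mathcal X)$ there is $x\in\mathcal X$ with $d_{V_j}(x,p_j)\le\alpha$ for all $j$, and $d_V(x,\rho^{V_j}_V)\le\alpha$ for every $j$ and every $V\in\mathfrak S$ with $V_j\sqsubset V$ or $V\pitchfork V_j$. (9) Uniqueness: for each $\kappa\ge0$ there is $\theta_u(\kappa)$ such that $d_{\mathcal X}(x,y)\ge\theta_u(\kappa)$ implies $d_V(x,y)\ge\kappa$ for some $V\in\mathfrak S$. Hieromorphisms. A hieromorphism $(\mathcal X,\mathfrak S)\to(\mathcal X',\mathfrak S')$ consists of a map $f:\mathcal X\to\mathcal X'$, an injective map $f^{\diamondsuit}:\mathfrak S\to\mathfrak S'$ preserving nesting, transversality and orthogonality, and maps $f^*(U):\mathcal CU\to\mathcal C(f^{\diamondsuit}(U))$ that are quasi-isometric embeddings with constants uniform in $U\in\mathfrak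 S$, such that, up to uniformly bounded error, $\pi_{f^\diamondsuit(U)}\circ f=f^*(U)\circ\pi_U$ for all $U$, and $f^*(V)\circ\rho^U_V=\rho^{f^\diamondsuit(U)}_{f^\diamondsuit(V)}\circ f^*(U)$ for all distinct non-orthogonal $U,V$ (where $\rho^U_V$ is viewed as a constant coarse map if $U\pitchfork V$ or $U\sqsubset V$). Hierarchically hyperbolic groups (HHG). An automorphism of $(\mathcal X,\mathfrak S)$ is a hieromorphism to itself with $f^\diamondsuit$ bijective and every $f^*(U)$ an isometry. Two automorphisms are equivalent if they have the same $f^\diamondsuit$ and the same $f^*(U)$ for all $U$; equivalence classes form a group $\mathrm{Aut}(\mathfrak S)$. A finitely generated group $G$ is hierarchically hyperbolic if there are an HHS $(\mathcal X,\mathfrak S)$ and a homomorphism $G\to\mathrm{Aut}(\mathfrak S)$ such that the induced uniform quasi-action of $G$ on $\mathcal X$ is metrically proper and cobounded and $\mathfrak S$ contains finitely many $G$-orbits. *)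

theory Defs
  imports
    "HOL-Analysis.Abstract_Metric_Spaces"
    "HOL-Library.Extended_Real"
    "HOL-Algebra.Coset"
    "HOL-Algebra.Generated_Groups"
    "HOL-Library.Landau_Symbols"
begin

section \<open>Coarse geometry in metric spaces with explicit carrier\<close>

text \<open>Infimum of the distances between points of the two sets.  All sets to which this is
  applied below are required to be nonempty, so the real-valued infimum is never degenerate.\<close>

definition set_distance :: "('a \<Rightarrow> 'a \<Rightarrow> real) \<Rightarrow> 'a set \<Rightarrow> 'a set \<Rightarrow> real" where
  "set_distance d A B = Inf {d a b | a b. a \<in> A \<and> b \<in> B}"

text \<open>Extended-real valued, since the set may be unbounded.\<close>

definition set_diameter :: "('a \<Rightarrow> 'a \<Rightarrow> real) \<Rightarrow> 'a set \<Rightarrow> ereal" where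
  "set_diameter d A = (SUP a\<in>A. SUP b\<in>A. ereal (d a b))"

definition nbhd :: "'a set \<Rightarrow> ('a \<Rightarrow> 'a \<Rightarrow> real) \<Rightarrow> real \<Rightarrow> 'a set \<Rightarrow> 'a set" where
  "nbhd M d r A = {x \<in> M. \<exists>a\<in>A. d x a \<le> r}"

text \<open>Hausdorff distance at most \<open>r\<close>.\<close>

definition hausdorff_close :: "('a \<Rightarrow> 'a \<Rightarrow> real) \<Rightarrow> real \<Rightarrow> 'a set \<Rightarrow> 'a set \<Rightarrow> bool" where
  "hausdorff_close d r A B \<longleftrightarrow>
     (\<forall>a\<in>A. \<exists>b\<in>B. d a b \<le> r) \<and> (\<forall>b\<in>B. \<exists>a\<in>A. d a b \<le> r)"

text \<open>\<open>P\<close> is the image of a geodesic from \<open>x\<close> to \<open>y\<close>.\<close>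

definition geodesic_between ::
    "'a set \<Rightarrow> ('a \<Rightarrow> 'a \<Rightarrow> real) \<Rightarrow> 'a \<Rightarrow> 'a \<Rightarrow> 'a set \<Rightarrow> bool" where
  "geodesic_between M d x y P \<longleftrightarrow>
     (\<exists>(\<gamma> :: real \<Rightarrow> 'a) L. 0 \<le> L \<and> \<gamma> 0 = x \<and> \<gamma> L = y \<and> \<gamma> ` {0..L} = P \<and> P \<subseteq> M \<and>
        (\<forall>s\<in>{0..L}. \<forall>t\<in>{0..L}. d (\<gamma> s) (\<gamma> t) = \<bar>s - t\<bar>))"

definition geodesic_space :: "'a set \<Rightarrow> ('a \<Rightarrow> 'a \<Rightarrow> real) \<Rightarrow> bool" where
  "geodesic_space M d \<longleftrightarrow>
     Metric_space M d \<and> (\<forall>x\<in>M. \<forall>y\<in>M. \<exists>P. geodesic_between M d x y P)"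

text \<open>Slim geodesic triangles; by cyclic symmetry every side is covered.\<close>

definition hyperbolic_geodesic_space :: "real \<Rightarrow> 'a set \<Rightarrow> ('a \<Rightarrow> 'a \<Rightarrow> real) \<Rightarrow> bool" where
  "hyperbolic_geodesic_space \<delta> M d \<longleftrightarrow>
     geodesic_space M d \<and>
     (\<forall>x y z P Q R.
        geodesic_between M d x y P \<and> geodesic_between M d y z Q \<and> geodesic_between M d z x R \<longrightarrow>
        P \<subseteq> nbhd M d \<delta> (Q \<union> R))"

definition quasiconvex :: "real \<Rightarrow> 'a set \<Rightarrow> ('a \<Rightarrow> 'a \<Rightarrow> real) \<Rightarrow> 'a set \<Rightarrow> bool" where
  "quasiconvex K M d A \<longleftrightarrow>
     (\<forall>x\<in>A. \<forall>y\<in>A. \<forall>P. geodesic_between M d x y P \<longrightarrow> P \<subseteq> nbhd M d K A)"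

definition qi_embedding :: "real \<Rightarrow> real \<Rightarrow> 'a set \<Rightarrow> ('a \<Rightarrow> 'a \<Rightarrow> real) \<Rightarrow>
    'b set \<Rightarrow> ('b \<Rightarrow> 'b \<Rightarrow> real) \<Rightarrow> ('a \<Rightarrow> 'b) \<Rightarrow> bool" where
  "qi_embedding k c M d M' d' f \<longleftrightarrow>
     f \<in> M \<rightarrow> M' \<and>
     (\<forall>x\<in>M. \<forall>y\<in>M. d x y / k - c \<le> d' (f x) (f y) \<and> d' (f x) (f y) \<le> k * d x y + c)"

definition quasi_isometry :: "real \<Rightarrow> real \<Rightarrow> 'a set \<Rightarrow> ('a \<Rightarrow> 'a \<Rightarrow> real) \<Rightarrow>
    'b set \<Rightarrow> ('b \<Rightarrow> 'b \<Rightarrow> real) \<Rightarrow> ('a \<Rightarrow> 'b) \<Rightarrow> bool" where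
  "quasi_isometry k c M d M' d' f \<longleftrightarrow>
     qi_embedding k c M d M' d' f \<and> M' \<subseteq> nbhd M' d' c (f ` M)"

definition isometry_between :: "'a set \<Rightarrow> ('a \<Rightarrow> 'a \<Rightarrow> real) \<Rightarrow>
    'b set \<Rightarrow> ('b \<Rightarrow> 'b \<Rightarrow> real) \<Rightarrow> ('a \<Rightarrow> 'b) \<Rightarrow> bool" where
  "isometry_between M d M' d' f \<longleftrightarrow>
     bij_betw f M M' \<and> (\<forall>x\<in>M. \<forall>y\<in>M. d' (f x) (f y) = d x y)"

definition quasigeodesic_space :: "real \<Rightarrow> 'a set \<Rightarrow> ('a \<Rightarrow> 'a \<Rightarrow> real) \<Rightarrow> bool" where
  "quasigeodesic_space q M d \<longleftrightarrow>
     Metric_space M d \<and>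
     (\<forall>x\<in>M. \<forall>y\<in>M. \<exists>(\<gamma> :: real \<Rightarrow> 'a) L. 0 \<le> L \<and> \<gamma> 0 = x \<and> \<gamma> L = y \<and>
        qi_embedding q q {0..L} (\<lambda>s t. \<bar>s - t\<bar>) M d \<gamma>)"


section \<open>Hierarchically hyperbolic spaces\<close>

text \<open>The spaces \<open>\<C>W\<close> are metric spaces with carriers in one ambient type; only indices in
  \<open>index H\<close> are meaningful.  \<open>rho H V W\<close> is the set \<open>\<rho>\<^sup>V\<^sub>W \<subseteq> \<C>W\<close>, used when \<open>V \<sqsubset> W\<close> or
  \<open>V \<pitchfork> W\<close>; \<open>rho_map H W V\<close> is the map \<open>\<rho>\<^sup>W\<^sub>V\<close> from \<open>\<C>W\<close> to subsets of \<open>\<C>V\<close>, used when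
  \<open>V \<sqsubset> W\<close>.\<close>

record ('x, 'i, 'c) hh_structure =
  index :: "'i set"
  cspace :: "'i \<Rightarrow> 'c set"
  cdist :: "'i \<Rightarrow> 'c \<Rightarrow> 'c \<Rightarrow> real"
  proj :: "'i \<Rightarrow> 'x \<Rightarrow> 'c set"
  nested :: "'i \<Rightarrow> 'i \<Rightarrow> bool"
  orth :: "'i \<Rightarrow> 'i \<Rightarrow> bool"
  rho :: "'i \<Rightarrow> 'i \<Rightarrow> 'c set"
  rho_map :: "'i \<Rightarrow> 'i \<Rightarrow> 'c \<Rightarrow> 'c set"

definition strictly_nested :: "('x, 'i, 'c) hh_structure \<Rightarrow> 'i \<Rightarrow> 'i \<Rightarrow> bool" where
  "strictly_nested H V W \<longleftrightarrow> nested H V W \<and> V \<noteq> W"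

definition transverse :: "('x, 'i, 'c) hh_structure \<Rightarrow> 'i \<Rightarrow> 'i \<Rightarrow> bool" where
  "transverse H V W \<longleftrightarrow> \<not> orth H V W \<and> \<not> nested H V W \<and> \<not> nested H W V"

definition below :: "('x, 'i, 'c) hh_structure \<Rightarrow> 'i \<Rightarrow> 'i set" where
  "below H W = {V \<in> index H. nested H V W}"

text \<open>\<open>d\<^sub>W(x, p)\<close> for a point \<open>x\<close> and a subset \<open>p\<close> of \<open>\<C>W\<close>, and \<open>d\<^sub>W(x, y)\<close> for points.\<close>

definition pdist_set :: "('x, 'i, 'c) hh_structure \<Rightarrow> 'i \<Rightarrow> 'x \<Rightarrow> 'c set \<Rightarrow> real" where
  "pdist_set H W x p = set_distance (cdist H W) (proj H W x) p"

definition pdist :: "('x, 'i, 'c) hh_structure \<Rightarrow> 'i \<Rightarrow> 'x \<Rightarrow> 'x \<Rightarrow> real" where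
  "pdist H W x y = pdist_set H W x (proj H W y)"

definition proj_image :: "('x, 'i, 'c) hh_structure \<Rightarrow> 'i \<Rightarrow> 'x set \<Rightarrow> 'c set" where
  "proj_image H W X = (\<Union>x\<in>X. proj H W x)"

text \<open>A nonempty subset of \<open>\<C>W\<close> of diameter at most \<open>\<xi>\<close>.\<close>

definition coarse_point :: "('x, 'i, 'c) hh_structure \<Rightarrow> real \<Rightarrow> 'i \<Rightarrow> 'c set \<Rightarrow> bool" where
  "coarse_point H \<xi> W A \<longleftrightarrow>
     A \<noteq> {} \<and> A \<subseteq> cspace H W \<and> set_diameter (cdist H W) A \<le> ereal \<xi>"

definition hhs_projections ::
    "'x set \<Rightarrow> ('x \<Rightarrow> 'x \<Rightarrow> real) \<Rightarrow> ('x, 'i, 'c) hh_structure \<Rightarrow> real \<Rightarrow> real \<Rightarrow> bool" where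
  "hhs_projections X d H \<xi> K \<longleftrightarrow>
     (\<forall>W\<in>index H.
        (\<forall>x\<in>X. coarse_point H \<xi> W (proj H W x)) \<and>
        (\<forall>x\<in>X. \<forall>y\<in>X. pdist H W x y \<le> K * d x y + K) \<and>
        quasiconvex K (cspace H W) (cdist H W) (proj_image H W X))"

definition hhs_nesting :: "('x, 'i, 'c) hh_structure \<Rightarrow> real \<Rightarrow> bool" where
  "hhs_nesting H \<xi> \<longleftrightarrow>
     reflp_on (index H) (nested H) \<and> antisymp_on (index H) (nested H) \<and>
     transp_on (index H) (nested H) \<and>
     (index H = {} \<or> (\<exists>!M. M \<in> index H \<and> (\<forall>V\<in>index H. nested H M V \<longrightarrow> V = M))) \<and>
     (\<forall>V\<in>index H. \<forall>W\<in>index H. strictly_nested H V W \<longrightarrow>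
        coarse_point H \<xi> W (rho H V W) \<and>
        (\<forall>p\<in>cspace H W. rho_map H W V p \<noteq> {} \<and> rho_map H W V p \<subseteq> cspace H V))"

definition hhs_orthogonality :: "('x, 'i, 'c) hh_structure \<Rightarrow> bool" where
  "hhs_orthogonality H \<longleftrightarrow>
     symp_on (index H) (orth H) \<and> irreflp_on (index H) (orth H) \<and>
     (\<forall>V\<in>index H. \<forall>W\<in>index H. \<forall>U\<in>index H. nested H V W \<and> orth H W U \<longrightarrow> orth H V U) \<and>
     (\<forall>T\<in>index H. \<forall>U\<in>below H T. {V \<in> below H T. orth H V U} \<noteq> {} \<longrightarrow>
        (\<exists>W\<in>below H T - {T}. \<forall>V\<in>below H T. orth H V U \<longrightarrow> nested H V W)) \<and>
     (\<forall>V\<in>index H. \<forall>W\<in>index H. orth H V W \<longrightarrow> \<not> nested H V W \<and> \<not> nested H W V)"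

definition hhs_consistency ::
    "'x set \<Rightarrow> ('x, 'i, 'c) hh_structure \<Rightarrow> real \<Rightarrow> real \<Rightarrow> bool" where
  "hhs_consistency X H \<xi> \<kappa>\<^sub>0 \<longleftrightarrow>
     (\<forall>V\<in>index H. \<forall>W\<in>index H. transverse H V W \<longrightarrow>
        coarse_point H \<xi> W (rho H V W) \<and> coarse_point H \<xi> V (rho H W V) \<and>
        (\<forall>x\<in>X. min (pdist_set H W x (rho H V W)) (pdist_set H V x (rho H W V)) \<le> \<kappa>\<^sub>0)) \<and>
     (\<forall>V\<in>index H. \<forall>W\<in>index H. strictly_nested H V W \<longrightarrow>
        (\<forall>x\<in>X. min (ereal (pdist_set H W x (rho H V W)))
                   (set_diameter (cdist H V)
                      (proj H V x \<union> (\<Union>p\<in>proj H W x. rho_map H W V p))) \<le> ereal \<kappa>\<^sub>0)) \<and>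
     (\<forall>U\<in>index H. \<forall>V\<in>index H. \<forall>W\<in>index H.
        nested H U V \<and>
        (strictly_nested H V W \<or> (transverse H V W \<and> \<not> orth H W U)) \<longrightarrow>
        set_distance (cdist H W) (rho H U W) (rho H V W) \<le> \<kappa>\<^sub>0)"

definition hhs_finite_complexity :: "('x, 'i, 'c) hh_structure \<Rightarrow> nat \<Rightarrow> bool" where
  "hhs_finite_complexity H n \<longleftrightarrow>
     (\<forall>\<A>\<subseteq>index H. (\<forall>V\<in>\<A>. \<forall>W\<in>\<A>. nested H V W \<or> nested H W V) \<longrightarrow> finite \<A> \<and> card \<A> \<le> n)"

definition hhs_large_links ::
    "'x set \<Rightarrow> ('x, 'i, 'c) hh_structure \<Rightarrow> real \<Rightarrow> real \<Rightarrow> bool" where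
  "hhs_large_links X H L E \<longleftrightarrow>
     (\<forall>W\<in>index H. \<forall>x\<in>X. \<forall>x'\<in>X. let N = L * pdist H W x x' + L in
        \<exists>\<T>\<subseteq>below H W - {W}. finite \<T> \<and> int (card \<T>) \<le> \<lfloor>N\<rfloor> \<and>
          (\<forall>T\<in>below H W - {W}. (\<exists>T'\<in>\<T>. T \<in> below H T') \<or> pdist H T x x' < E) \<and>
          (\<forall>T\<in>\<T>. pdist_set H W x (rho H T W) \<le> N))"

definition hhs_bounded_geodesic_image :: "('x, 'i, 'c) hh_structure \<Rightarrow> real \<Rightarrow> bool" where
  "hhs_bounded_geodesic_image H E \<longleftrightarrow>
     (\<forall>V\<in>index H. \<forall>W\<in>index H. strictly_nested H V W \<longrightarrow>
        (\<forall>p q P. geodesic_between (cspace H W) (cdist H W) p q P \<longrightarrow>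
           set_diameter (cdist H V) (\<Union>z\<in>P. rho_map H W V z) \<le> ereal E \<or>
           P \<inter> nbhd (cspace H W) (cdist H W) E (rho H V W) \<noteq> {}))"

text \<open>Orthogonality being irreflexive, a pairwise orthogonal family has no repetitions and is
  given by a set of indices.\<close>

definition hhs_partial_realization ::
    "'x set \<Rightarrow> ('x, 'i, 'c) hh_structure \<Rightarrow> real \<Rightarrow> bool" where
  "hhs_partial_realization X H \<alpha> \<longleftrightarrow>
     (\<forall>\<F>\<subseteq>index H. \<forall>p. pairwise (orth H) \<F> \<and> (\<forall>V\<in>\<F>. p V \<in> proj_image H V X) \<longrightarrow>
        (\<exists>x\<in>X. \<forall>U\<in>\<F>. pdist_set H U x {p U} \<le> \<alpha> \<and>
           (\<forall>V\<in>index H. strictly_nested H U V \<or> transverse H V U \<longrightarrow>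
              pdist_set H V x (rho H U V) \<le> \<alpha>)))"

definition hhs_uniqueness ::
    "'x set \<Rightarrow> ('x \<Rightarrow> 'x \<Rightarrow> real) \<Rightarrow> ('x, 'i, 'c) hh_structure \<Rightarrow> (real \<Rightarrow> real) \<Rightarrow> bool" where
  "hhs_uniqueness X d H \<theta> \<longleftrightarrow>
     (\<forall>\<kappa>\<ge>0. \<forall>x\<in>X. \<forall>y\<in>X. \<theta> \<kappa> \<le> d x y \<longrightarrow> (\<exists>V\<in>index H. \<kappa> \<le> pdist H V x y))"

definition hierarchically_hyperbolic_space ::
    "'x set \<Rightarrow> ('x \<Rightarrow> 'x \<Rightarrow> real) \<Rightarrow> ('x, 'i, 'c) hh_structure \<Rightarrow> bool" where
  "hierarchically_hyperbolic_space X d H \<longleftrightarrow>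
     (\<exists>q\<ge>1. quasigeodesic_space q X d) \<and>
     (\<exists>\<delta>\<ge>0. \<forall>W\<in>index H. hyperbolic_geodesic_space \<delta> (cspace H W) (cdist H W)) \<and>
     (\<exists>\<xi>\<ge>0. \<exists>K\<ge>0. \<exists>\<kappa>\<^sub>0\<ge>0.
        hhs_projections X d H \<xi> K \<and>
        hhs_nesting H \<xi> \<and>
        hhs_orthogonality H \<and>
        hhs_consistency X H \<xi> \<kappa>\<^sub>0 \<and>
        (\<exists>L\<ge>1. \<exists>E\<ge>max \<xi> \<kappa>\<^sub>0. hhs_large_links X H L E)) \<and>
     (\<exists>n. hhs_finite_complexity H n) \<and>
     (\<exists>E>0. hhs_bounded_geodesic_image H E) \<and>
     (\<exists>\<alpha>. hhs_partial_realization X H \<alpha>) \<and>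
     (\<exists>\<theta>. hhs_uniqueness X d H \<theta>)"


section \<open>Hieromorphisms and hierarchically hyperbolic groups\<close>

text \<open>\<open>a\<close> is the map \<open>f\<^sup>\<diamondsuit>\<close> on indices and \<open>b U\<close> is \<open>f\<^sup>*(U)\<close>.  ``Up to uniformly bounded error''
  means at bounded Hausdorff distance.\<close>

definition hieromorphism ::
    "'x set \<Rightarrow> ('x, 'i, 'c) hh_structure \<Rightarrow> 'y set \<Rightarrow> ('y, 'j, 'e) hh_structure \<Rightarrow>
     ('x \<Rightarrow> 'y) \<Rightarrow> ('i \<Rightarrow> 'j) \<Rightarrow> ('i \<Rightarrow> 'c \<Rightarrow> 'e) \<Rightarrow> bool" where
  "hieromorphism X H X' H' f a b \<longleftrightarrow>
     f \<in> X \<rightarrow> X' \<and> a \<in> index H \<rightarrow> index H' \<and> inj_on a (index H) \<and>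
     (\<forall>U\<in>index H. \<forall>V\<in>index H.
        (nested H U V \<longrightarrow> nested H' (a U) (a V)) \<and>
        (transverse H U V \<longrightarrow> transverse H' (a U) (a V)) \<and>
        (orth H U V \<longrightarrow> orth H' (a U) (a V))) \<and>
     (\<exists>k\<ge>1. \<exists>c\<ge>0. \<forall>U\<in>index H.
        qi_embedding k c (cspace H U) (cdist H U) (cspace H' (a U)) (cdist H' (a U)) (b U)) \<and>
     (\<exists>B\<ge>0.
        (\<forall>U\<in>index H. \<forall>x\<in>X.
           hausdorff_close (cdist H' (a U)) B (proj H' (a U) (f x)) (b U ` proj H U x)) \<and>
        (\<forall>U\<in>index H. \<forall>V\<in>index H. transverse H U V \<or> strictly_nested H U V \<longrightarrow>
           hausdorff_close (cdist H' (a V)) B (b V ` rho H U V) (rho H' (a U) (a V))) \<and>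
        (\<forall>U\<in>index H. \<forall>V\<in>index H. strictly_nested H V U \<longrightarrow>
           (\<forall>p\<in>cspace H U.
              hausdorff_close (cdist H' (a V)) B
                (b V ` rho_map H U V p) (rho_map H' (a U) (a V) (b U p)))))"

definition hh_automorphism ::
    "'x set \<Rightarrow> ('x, 'i, 'c) hh_structure \<Rightarrow>
     ('x \<Rightarrow> 'x) \<Rightarrow> ('i \<Rightarrow> 'i) \<Rightarrow> ('i \<Rightarrow> 'c \<Rightarrow> 'c) \<Rightarrow> bool" where
  "hh_automorphism X H f a b \<longleftrightarrow>
     hieromorphism X H X H f a b \<and> bij_betw a (index H) (index H) \<and>
     (\<forall>U\<in>index H.
        isometry_between (cspace H U) (cdist H U) (cspace H (a U)) (cdist H (a U)) (b U))"

text \<open>An equivalence class of automorphisms is determined by \<open>f\<^sup>\<diamondsuit>\<close> and the maps \<open>f\<^sup>*(U)\<close>, so it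
  is represented by the pair of these, normalised to be undefined outside the relevant carriers.\<close>

definition aut_group ::
    "'x set \<Rightarrow> ('x, 'i, 'c) hh_structure \<Rightarrow> (('i \<Rightarrow> 'i) \<times> ('i \<Rightarrow> 'c \<Rightarrow> 'c)) monoid" where
  "aut_group X H =
     \<lparr>carrier = {(a, b). a \<in> extensional (index H) \<and> b \<in> extensional (index H) \<and>
                   (\<forall>U\<in>index H. b U \<in> extensional (cspace H U)) \<and>
                   (\<exists>f. hh_automorphism X H f a b)},
      mult = (\<lambda>(a, b) (a', b').
                (\<lambda>U\<in>index H. a (a' U), \<lambda>U\<in>index H. \<lambda>p\<in>cspace H U. b (a' U) (b' U p))),
      one = (\<lambda>U\<in>index H. U, \<lambda>U\<in>index H. \<lambda>p\<in>cspace H U. p)\<rparr>"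

definition uniform_quasi_action ::
    "('g, 'm) monoid_scheme \<Rightarrow> 'x set \<Rightarrow> ('x \<Rightarrow> 'x \<Rightarrow> real) \<Rightarrow> ('g \<Rightarrow> 'x \<Rightarrow> 'x) \<Rightarrow> bool" where
  "uniform_quasi_action G X d F \<longleftrightarrow>
     (\<exists>k\<ge>1. \<exists>c\<ge>0.
        (\<forall>g\<in>carrier G. quasi_isometry k c X d X d (F g)) \<and>
        (\<forall>x\<in>X. d (F \<one>\<^bsub>G\<^esub> x) x \<le> c) \<and>
        (\<forall>g\<in>carrier G. \<forall>h\<in>carrier G. \<forall>x\<in>X. d (F g (F h x)) (F (g \<otimes>\<^bsub>G\<^esub> h) x) \<le> c))"

definition metrically_proper ::
    "('g, 'm) monoid_scheme \<Rightarrow> 'x set \<Rightarrow> ('x \<Rightarrow> 'x \<Rightarrow> real) \<Rightarrow> ('g \<Rightarrow> 'x \<Rightarrow> 'x) \<Rightarrow> bool" where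
  "metrically_proper G X d F \<longleftrightarrow>
     (\<forall>x\<in>X. \<forall>r. finite {g \<in> carrier G. F g ` nbhd X d r {x} \<inter> nbhd X d r {x} \<noteq> {}})"

definition cobounded ::
    "('g, 'm) monoid_scheme \<Rightarrow> 'x set \<Rightarrow> ('x \<Rightarrow> 'x \<Rightarrow> real) \<Rightarrow> ('g \<Rightarrow> 'x \<Rightarrow> 'x) \<Rightarrow> bool" where
  "cobounded G X d F \<longleftrightarrow> (\<exists>x\<in>X. \<exists>r. \<forall>y\<in>X. \<exists>g\<in>carrier G. d (F g x) y \<le> r)"

definition finitely_generated_group :: "('g, 'm) monoid_scheme \<Rightarrow> bool" where
  "finitely_generated_group G \<longleftrightarrow>
     group G \<and> (\<exists>A. finite A \<and> A \<subseteq> carrier G \<and> generate G A = carrier G)"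

text \<open>\<open>F\<close> chooses, for every \<open>g\<close>, a representative of the class \<open>\<psi> g\<close>; these representatives form
  the induced quasi-action on \<open>X\<close>.\<close>

definition hierarchically_hyperbolic_group ::
    "('g, 'm) monoid_scheme \<Rightarrow> 'x set \<Rightarrow> ('x \<Rightarrow> 'x \<Rightarrow> real) \<Rightarrow> ('x, 'i, 'c) hh_structure \<Rightarrow> bool"
  where
  "hierarchically_hyperbolic_group G X d H \<longleftrightarrow>
     finitely_generated_group G \<and> hierarchically_hyperbolic_space X d H \<and>
     (\<exists>\<psi> \<in> hom G (aut_group X H).
        (\<exists>F. (\<forall>g\<in>carrier G. hh_automorphism X H (F g) (fst (\<psi> g)) (snd (\<psi> g))) \<and>
             uniform_quasi_action G X d F \<and> metrically_proper G X d F \<and> cobounded G X d F) \<and>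
        finite ((\<lambda>U. (\<lambda>g. fst (\<psi> g) U) ` carrier G) ` index H))"


section \<open>Word metrics, finite presentations and Dehn functions\<close>

definition word_length :: "('g, 'm) monoid_scheme \<Rightarrow> 'g set \<Rightarrow> 'g \<Rightarrow> nat" where
  "word_length G A g =
     (LEAST n. \<exists>ws. length ws = n \<and> set ws \<subseteq> A \<union> m_inv G ` A \<and> foldr (mult G) ws \<one>\<^bsub>G\<^esub> = g)"

text \<open>The value off the carrier only serves the convention of \<open>Metric_space\<close> that
  nonnegativity and symmetry hold on the whole type.\<close>

definition word_metric :: "('g, 'm) monoid_scheme \<Rightarrow> 'g set \<Rightarrow> 'g \<Rightarrow> 'g \<Rightarrow> real" where
  "word_metric G A x y =
     (if x \<in> carrier G \<and> y \<in> carrier G then real (word_length G A (inv\<^bsub>G\<^esub> x \<otimes>\<^bsub>G\<^esub> y)) else 0)"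

text \<open>Words in the letters \<open>s\<^sup>\<plusminus>\<^sup>1\<close>; the boolean is \<open>True\<close> for \<open>s\<close> and \<open>False\<close> for its formal inverse.\<close>

type_synonym 's word = "('s \<times> bool) list"

definition words :: "'s set \<Rightarrow> 's word set" where
  "words S = {w. set w \<subseteq> S \<times> UNIV}"

fun cancel_cons :: "'s \<times> bool \<Rightarrow> 's word \<Rightarrow> 's word" where
  "cancel_cons x [] = [x]"
| "cancel_cons x (y # w) = (if fst y = fst x \<and> snd y \<noteq> snd x then w else x # y # w)"

definition free_reduce :: "'s word \<Rightarrow> 's word" where
  "free_reduce w = foldr cancel_cons w []"

text \<open>Freely reduced words under concatenation followed by reduction.\<close>

definition free_group :: "'s set \<Rightarrow> 's word monoid" where
  "free_group S =
     \<lparr>carrier = {w \<in> words S. free_reduce w = w},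
      mult = (\<lambda>u v. free_reduce (u @ v)),
      one = []\<rparr>"

definition normal_closure :: "('g, 'm) monoid_scheme \<Rightarrow> 'g set \<Rightarrow> 'g set" where
  "normal_closure G R = \<Inter> {N. N \<lhd> G \<and> R \<subseteq> N}"

text \<open>\<open>\<langle>S | R\<rangle>\<close> is a finite presentation of \<open>G\<close>.\<close>

definition finite_presentation :: "('g, 'm) monoid_scheme \<Rightarrow> 's set \<Rightarrow> 's word set \<Rightarrow> bool" where
  "finite_presentation G S R \<longleftrightarrow>
     finite S \<and> finite R \<and> R \<subseteq> carrier (free_group S) \<and>
     (free_group S Mod normal_closure (free_group S) R) \<cong> G"

text \<open>Every finite alphabet can be renamed to a finite set of natural numbers.\<close>

definition finitely_presented :: "('g, 'm) monoid_scheme \<Rightarrow> bool" where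
  "finitely_presented G \<longleftrightarrow> (\<exists>(S :: nat set) R. finite_presentation G S R)"

definition null_words :: "'s set \<Rightarrow> 's word set \<Rightarrow> 's word set" where
  "null_words S R = {w \<in> words S. free_reduce w \<in> normal_closure (free_group S) R}"

text \<open>The least number of factors in an expression of \<open>w\<close>, in the free group, as a product of
  conjugates of relators and their inverses.\<close>

definition area :: "'s set \<Rightarrow> 's word set \<Rightarrow> 's word \<Rightarrow> nat" where
  "area S R w = (let F = free_group S in
     LEAST n. \<exists>cs. length cs = n \<and> set cs \<subseteq> carrier F \<times> (R \<union> m_inv F ` R) \<and>
       free_reduce w = foldr (\<lambda>(u, r) v. (u \<otimes>\<^bsub>F\<^esub> r \<otimes>\<^bsub>F\<^esub> inv\<^bsub>F\<^esub> u) \<otimes>\<^bsub>F\<^esub> v) cs \<one>\<^bsub>F\<^esub>)"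

definition dehn_function :: "'s set \<Rightarrow> 's word set \<Rightarrow> nat \<Rightarrow> nat" where
  "dehn_function S R n = Max {area S R w | w. w \<in> null_words S R \<and> length w \<le> n}"

text \<open>``Quadratic'' is an upper bound: hyperbolic groups, whose Dehn functions are linear, are
  hierarchically hyperbolic.  The growth rate does not depend on the finite presentation, and the
  bound is asserted for all of them.\<close>

definition quadratic_dehn_function :: "('g, 'm) monoid_scheme \<Rightarrow> bool" where
  "quadratic_dehn_function G \<longleftrightarrow>
     (\<forall>(S :: nat set) R. finite_presentation G S R \<longrightarrow>
        (\<lambda>n. real (dehn_function S R n)) \<in> O(\<lambda>n. (real n)\<^sup>2))"

end

theory Submission
  imports Defs
begin

text \<open>
  Fix a base point \<open>e\<close> of a hierarchically hyperbolic space \<open>X\<close>.  The coarse median of \<open>e\<close>, \<open>x\<close>, \<open>y\<close>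
  is obtained by realizing the tuple of centers of the triangles \<open>\<pi>\<^sub>W(e), \<pi>\<^sub>W(x), \<pi>\<^sub>W(y)\<close>, and it
  defines a coarsely Lipschitz operation \<open>\<beta>\<close> on \<open>X\<close> with \<open>\<beta> x x = x\<close> and \<open>\<beta> x e = \<beta> e x = e\<close> up to
  bounded error.  A discrete loop \<open>e = x\<^sub>0, \<dots>, x\<^sub>n = e\<close> therefore bounds the triangular grid of points
  \<open>\<beta> x\<^sub>i x\<^sub>j\<close>, \<open>0 \<le> i \<le> j \<le> n\<close>, which consists of at most \<open>n\<^sup>2\<close> cells of bounded size.  Only a coarse
  equivalence between \<open>G\<close> and \<open>X\<close> is needed to transport \<open>\<beta>\<close> to \<open>G\<close>.

  For the realization one starts with the empty family of indices.  Given a family of pairwise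
  orthogonal indices, partial realization yields a point \<open>x\<close>.  The indices at which \<open>x\<close> is far from the
  tuple are finitely many by the large links axiom.  Among the nesting-maximal ones choose the last one
  in the order in which transverse indices are passed on the way from \<open>x\<close> to the tuple, and refine the
  family by it.  Finite complexity bounds the number of refinements.
\<close>

section \<open>Products of conjugates and coarse meet operations on groups\<close>

text \<open>At an index \<open>V\<close> transverse to or properly containing a member
  \<open>U\<close> of the family, partial realization places the point near
  \<open>\<rho> U V\<close>, whatever the tuple is there. So only indices \<open>U\<close> with
  \<open>\<rho> U V\<close> close to the tuple at all those \<open>V\<close> may enter the family;
  maximality and the choice of the last index secure this. An index that is still far is then
  orthogonal to each member or properly nested in it, so a refinement adds an orthogonal index or
  descends. What increases is the sum, over the members, of the length of the longest chain above
  each. It is at most n^2, because containers trade a pairwise orthogonal family for a chain of the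
  same size. Each refinement costs a fixed error, so the final constant depends on n but not on the
  number of far indices.

  The grid is filled for a surjection from a free group onto G: the boundaries of its cells are
  finitely many words in the kernel. Taken as relators they present G, and over any finite
  presentation each of them has bounded area, so one filling yields both claims.\<close>

definition conjugate_product :: "('g, 'm) monoid_scheme \<Rightarrow> 'g set \<Rightarrow> nat \<Rightarrow> 'g \<Rightarrow> bool" where
  "conjugate_product F Q n g \<longleftrightarrow>
     (\<exists>cs. length cs = n \<and> set cs \<subseteq> carrier F \<times> (Q \<union> m_inv F ` Q) \<and>
       g = foldr (\<lambda>(u, r) v. (u \<otimes>\<^bsub>F\<^esub> r \<otimes>\<^bsub>F\<^esub> inv\<^bsub>F\<^esub> u) \<otimes>\<^bsub>F\<^esub> v) cs \<one>\<^bsub>F\<^esub>)"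

lemma conjugate_product_0 [simp]: "conjugate_product F Q 0 g \<longleftrightarrow> g = \<one>\<^bsub>F\<^esub>"
  by (simp add: conjugate_product_def)

lemma conjugate_product_Suc:
  "conjugate_product F Q (Suc n) g \<longleftrightarrow>
     (\<exists>u r h. u \<in> carrier F \<and> r \<in> Q \<union> m_inv F ` Q \<and> conjugate_product F Q n h \<and>
       g = (u \<otimes>\<^bsub>F\<^esub> r \<otimes>\<^bsub>F\<^esub> inv\<^bsub>F\<^esub> u) \<otimes>\<^bsub>F\<^esub> h)" (is "?L \<longleftrightarrow> ?R")
proof
  assume ?L
  then obtain cs where cs: "length cs = Suc n" "set cs \<subseteq> carrier F \<times> (Q \<union> m_inv F ` Q)"
    "g = foldr (\<lambda>(u, r) v. (u \<otimes>\<^bsub>F\<^esub> r \<otimes>\<^bsub>F\<^esub> inv\<^bsub>F\<^esub> u) \<otimes>\<^bsub>F\<^esub> v) cs \<one>\<^bsub>F\<^esub>"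
    unfolding conjugate_product_def by blast
  then obtain u r ds where ds: "cs = (u, r) # ds" by (cases cs) auto
  have "conjugate_product F Q n (foldr (\<lambda>(u, r) v. (u \<otimes>\<^bsub>F\<^esub> r \<otimes>\<^bsub>F\<^esub> inv\<^bsub>F\<^esub> u) \<otimes>\<^bsub>F\<^esub> v) ds \<one>\<^bsub>F\<^esub>)"
    unfolding conjugate_product_def using cs ds by auto
  then show ?R
    using cs ds
    by (intro exI[of _ u] exI[of _ r]
        exI[of _ "foldr (\<lambda>(u, r) v. (u \<otimes>\<^bsub>F\<^esub> r \<otimes>\<^bsub>F\<^esub> inv\<^bsub>F\<^esub> u) \<otimes>\<^bsub>F\<^esub> v) ds \<one>\<^bsub>F\<^esub>"]) auto
next
  assume ?R
  then obtain u r h cs where "u \<in> carrier F" "r \<in> Q \<union> m_inv F ` Q"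
    "g = (u \<otimes>\<^bsub>F\<^esub> r \<otimes>\<^bsub>F\<^esub> inv\<^bsub>F\<^esub> u) \<otimes>\<^bsub>F\<^esub> h"
    "length cs = n" "set cs \<subseteq> carrier F \<times> (Q \<union> m_inv F ` Q)"
    "h = foldr (\<lambda>(u, r) v. (u \<otimes>\<^bsub>F\<^esub> r \<otimes>\<^bsub>F\<^esub> inv\<^bsub>F\<^esub> u) \<otimes>\<^bsub>F\<^esub> v) cs \<one>\<^bsub>F\<^esub>"
    unfolding conjugate_product_def by blast
  then show ?L
    unfolding conjugate_product_def by (intro exI[of _ "(u, r) # cs"]) auto
qed

section \<open>Counting conjugates of relators, and homotopies with bounded area\<close>

context group
begin

lemma conjugate_product_closed:
  assumes "Q \<subseteq> carrier G" "conjugate_product G Q n g"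
  shows "g \<in> carrier G"
  using assms(2)
proof (induction n arbitrary: g)
  case (Suc n)
  then show ?case using assms(1) unfolding conjugate_product_Suc by (auto intro!: m_closed)
qed simp

lemma conjugate_product_mult:
  assumes "Q \<subseteq> carrier G" "conjugate_product G Q m g" "conjugate_product G Q n h"
  shows "conjugate_product G Q (m + n) (g \<otimes> h)"
  using assms(2)
proof (induction m arbitrary: g)
  case 0
  then show ?case using conjugate_product_closed[OF assms(1,3)] assms(3) by simp
next
  case (Suc m)
  then obtain u r k where *: "u \<in> carrier G" "r \<in> Q \<union> m_inv G ` Q" "conjugate_product G Q m k"
    "g = (u \<otimes> r \<otimes> inv u) \<otimes> k"
    unfolding conjugate_product_Suc by blast
  have "r \<in> carrier G" using * assms(1) by auto
  then have "g \<otimes> h = (u \<otimes> r \<otimes> inv u) \<otimes> (k \<otimes> h)"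
    using * conjugate_product_closed[OF assms(1)] assms(3) by (simp add: m_assoc)
  then show ?case
    using * Suc.IH[OF *(3)] unfolding add_Suc conjugate_product_Suc by blast
qed

lemma conjugate_product_single:
  assumes "Q \<subseteq> carrier G" "u \<in> carrier G" "r \<in> Q \<union> m_inv G ` Q"
  shows "conjugate_product G Q 1 (u \<otimes> r \<otimes> inv u)"
proof -
  have "r \<in> carrier G" using assms by auto
  then have "u \<otimes> r \<otimes> inv u = (u \<otimes> r \<otimes> inv u) \<otimes> \<one>"
    using assms by simp
  then show ?thesis
    using assms unfolding One_nat_def conjugate_product_Suc by auto
qed

lemma conjugate_product_generator:
  assumes "Q \<subseteq> carrier G" "r \<in> Q"
  shows "conjugate_product G Q 1 r"
  using conjugate_product_single[OF assms(1) one_closed, of r] assms by auto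

lemma conjugate_product_conj:
  assumes "Q \<subseteq> carrier G" "conjugate_product G Q n g" "a \<in> carrier G"
  shows "conjugate_product G Q n (a \<otimes> g \<otimes> inv a)"
  using assms(2)
proof (induction n arbitrary: g)
  case 0
  then show ?case using assms(3) by simp
next
  case (Suc n)
  then obtain u r k where *: "u \<in> carrier G" "r \<in> Q \<union> m_inv G ` Q" "conjugate_product G Q n k"
    "g = (u \<otimes> r \<otimes> inv u) \<otimes> k"
    unfolding conjugate_product_Suc by blast
  have r: "r \<in> carrier G" using * assms(1) by auto
  have k: "k \<in> carrier G" using * conjugate_product_closed[OF assms(1)] by blast
  have "inv a \<otimes> (a \<otimes> z) = z" if "z \<in> carrier G" for z
    using that assms(3) by (simp add: m_assoc[symmetric])
  then have "a \<otimes> g \<otimes> inv a = ((a \<otimes> u) \<otimes> r \<otimes> inv (a \<otimes> u)) \<otimes> (a \<otimes> k \<otimes> inv a)"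
    using * r k assms(3) by (simp add: m_assoc inv_mult_group)
  then show ?case
    using * Suc.IH[OF *(3)] assms(3) unfolding conjugate_product_Suc by (meson m_closed)
qed

lemma conjugate_product_inv:
  assumes "Q \<subseteq> carrier G" "conjugate_product G Q n g"
  shows "conjugate_product G Q n (inv g)"
  using assms(2)
proof (induction n arbitrary: g)
  case 0
  then show ?case by simp
next
  case (Suc n)
  then obtain u r k where *: "u \<in> carrier G" "r \<in> Q \<union> m_inv G ` Q" "conjugate_product G Q n k"
    "g = (u \<otimes> r \<otimes> inv u) \<otimes> k"
    unfolding conjugate_product_Suc by blast
  have r: "r \<in> carrier G" using * assms(1) by auto
  have k: "k \<in> carrier G" using * conjugate_product_closed[OF assms(1)] by blast
  have "inv g = inv k \<otimes> (u \<otimes> inv r \<otimes> inv u)"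
    using * r k by (simp add: m_assoc inv_mult_group)
  moreover have "inv r \<in> Q \<union> m_inv G ` Q"
    using * assms(1) by auto
  ultimately show ?case
    using conjugate_product_mult[OF assms(1) Suc.IH[OF *(3)] conjugate_product_single[OF assms(1) *(1)]]
    by simp
qed

text \<open>Conjugation and inversion preserve the number of factors, so replacing every element of
  \<open>Q\<close> by a product over \<open>R\<close> multiplies the count by at most
  \<open>M\<close>. This compares areas with respect to two sets of relators.\<close>

lemma conjugate_product_subst:
  assumes "R \<subseteq> carrier G" "Q \<subseteq> carrier G"
    and Q: "\<And>q. q \<in> Q \<Longrightarrow> \<exists>l\<le>M. conjugate_product G R l q"
    and "conjugate_product G Q n g"
  shows "\<exists>l\<le>M * n. conjugate_product G R l g"
  using assms(4)
proof (induction n arbitrary: g)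
  case 0
  then show ?case by auto
next
  case (Suc n)
  then obtain u r k where *: "u \<in> carrier G" "r \<in> Q \<union> m_inv G ` Q" "conjugate_product G Q n k"
    "g = (u \<otimes> r \<otimes> inv u) \<otimes> k"
    unfolding conjugate_product_Suc by blast
  obtain l where l: "l \<le> M * n" "conjugate_product G R l k" using Suc.IH[OF *(3)] by blast
  obtain l' where l': "l' \<le> M" "conjugate_product G R l' r"
  proof (cases "r \<in> Q")
    case True
    then show ?thesis using Q that by blast
  next
    case False
    then obtain q where q: "q \<in> Q" "r = inv q" using *(2) by blast
    obtain l' where "l' \<le> M" "conjugate_product G R l' q" using Q[OF q(1)] by blast
    then show ?thesis using that conjugate_product_inv[OF assms(1)] q(2) by metis
  qed
  have "conjugate_product G R (l' + l) g"
    using * conjugate_product_mult[OF assms(1) conjugate_product_conj[OF assms(1) l'(2) *(1)] l(2)]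
    by simp
  then show ?case using l l' by (intro exI[of _ "l' + l"]) auto
qed

lemma conjugate_products_normal:
  assumes "Q \<subseteq> carrier G"
  shows "{g. \<exists>n. conjugate_product G Q n g} \<lhd> G"
proof -
  have "subgroup {g. \<exists>n. conjugate_product G Q n g} G"
  proof (rule subgroup.intro)
    show "\<one> \<in> {g. \<exists>n. conjugate_product G Q n g}" by (auto intro: exI[of _ 0])
  qed (use conjugate_product_closed[OF assms] conjugate_product_mult[OF assms]
      conjugate_product_inv[OF assms] in blast)+
  then show ?thesis
    unfolding normal_inv_iff using conjugate_product_conj[OF assms] by auto
qed

lemma conjugate_product_in_normal:
  assumes "N \<lhd> G" "Q \<subseteq> N" "conjugate_product G Q n g"
  shows "g \<in> N"
  using assms(3)
proof (induction n arbitrary: g)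
  case 0
  then show ?case using assms(1) normal_imp_subgroup subgroup.one_closed by auto
next
  case (Suc n)
  then obtain u r k where *: "u \<in> carrier G" "r \<in> Q \<union> m_inv G ` Q" "conjugate_product G Q n k"
    "g = (u \<otimes> r \<otimes> inv u) \<otimes> k"
    unfolding conjugate_product_Suc by blast
  interpret N: subgroup N G using assms(1) normal_imp_subgroup by auto
  have "r \<in> N" using * assms(2) by auto
  then show ?case
    using * Suc.IH[OF *(3)] assms(1) unfolding normal_inv_iff by auto
qed

lemma normal_closure_eq:
  assumes "Q \<subseteq> carrier G"
  shows "normal_closure G Q = {g. \<exists>n. conjugate_product G Q n g}"
proof
  show "normal_closure G Q \<subseteq> {g. \<exists>n. conjugate_product G Q n g}"
    unfolding normal_closure_def
    using conjugate_products_normal[OF assms] conjugate_product_generator[OF assms] by blast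
  show "{g. \<exists>n. conjugate_product G Q n g} \<subseteq> normal_closure G Q"
    unfolding normal_closure_def using conjugate_product_in_normal by blast
qed

text \<open>In van Kampen terms, the edge paths \<open>u\<close> and \<open>v\<close> bound a
  diagram with at most \<open>k\<close> cells from \<open>Q\<close>. A bound replaces the exact
  count so that estimates can be weakened.\<close>

definition homotopic :: "'a set \<Rightarrow> nat \<Rightarrow> 'a \<Rightarrow> 'a \<Rightarrow> bool" where
  "homotopic Q k u v \<longleftrightarrow> (\<exists>l\<le>k. conjugate_product G Q l (u \<otimes> inv v))"

lemma homotopic_refl: "u \<in> carrier G \<Longrightarrow> homotopic Q k u u"
  unfolding homotopic_def by (intro exI[of _ 0]) simp

lemma homotopic_trans:
  assumes "Q \<subseteq> carrier G" "u \<in> carrier G" "v \<in> carrier G" "w \<in> carrier G"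
    and "homotopic Q k u v" "homotopic Q l v w"
  shows "homotopic Q (k + l) u w"
proof -
  obtain k' l' where *: "k' \<le> k" "l' \<le> l" "conjugate_product G Q k' (u \<otimes> inv v)"
    "conjugate_product G Q l' (v \<otimes> inv w)"
    using assms unfolding homotopic_def by blast
  have "(u \<otimes> inv v) \<otimes> (v \<otimes> inv w) = u \<otimes> ((inv v \<otimes> v) \<otimes> inv w)"
    using assms by (simp only: m_assoc m_closed inv_closed)
  then have "(u \<otimes> inv v) \<otimes> (v \<otimes> inv w) = u \<otimes> inv w"
    using assms by simp
  then have "conjugate_product G Q (k' + l') (u \<otimes> inv w)"
    using conjugate_product_mult[OF assms(1) *(3,4)] by simp
  then show ?thesis
    unfolding homotopic_def using * by (intro exI[of _ "k' + l'"]) auto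
qed

lemma homotopic_cong:
  assumes "Q \<subseteq> carrier G" "u \<in> carrier G" "v \<in> carrier G" "a \<in> carrier G" "b \<in> carrier G"
    and "homotopic Q k u v"
  shows "homotopic Q k (a \<otimes> u \<otimes> b) (a \<otimes> v \<otimes> b)"
proof -
  have "b \<otimes> (inv b \<otimes> z) = z" if "z \<in> carrier G" for z
    using that assms by (simp add: m_assoc[symmetric])
  then have "(a \<otimes> u \<otimes> b) \<otimes> inv (a \<otimes> v \<otimes> b) = a \<otimes> (u \<otimes> inv v) \<otimes> inv a"
    using assms by (simp add: m_assoc inv_mult_group)
  then show ?thesis
    using assms(6) conjugate_product_conj[OF assms(1) _ assms(4)] unfolding homotopic_def by metis
qed

lemma homotopic_left:
  assumes "Q \<subseteq> carrier G" "u \<in> carrier G" "v \<in> carrier G" "a \<in> carrier G" "homotopic Q k u v"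
  shows "homotopic Q k (a \<otimes> u) (a \<otimes> v)"
proof -
  have "a \<otimes> u \<otimes> \<one> = a \<otimes> u" "a \<otimes> v \<otimes> \<one> = a \<otimes> v" using assms by auto
  then show ?thesis using homotopic_cong[OF assms(1-4) one_closed assms(5)] by metis
qed

lemma homotopic_right:
  assumes "Q \<subseteq> carrier G" "u \<in> carrier G" "v \<in> carrier G" "a \<in> carrier G" "homotopic Q k u v"
  shows "homotopic Q k (u \<otimes> a) (v \<otimes> a)"
proof -
  have "\<one> \<otimes> u \<otimes> a = u \<otimes> a" "\<one> \<otimes> v \<otimes> a = v \<otimes> a" using assms by auto
  then show ?thesis using homotopic_cong[OF assms(1-3) one_closed assms(4,5)] by metis
qed

lemma homotopic_mono: "homotopic Q k u v \<Longrightarrow> k \<le> l \<Longrightarrow> homotopic Q l u v"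
  unfolding homotopic_def by (meson order_trans)

end

section \<open>Edge paths in a group and the triangular filling\<close>

primrec partial_product :: "('g, 'm) monoid_scheme \<Rightarrow> (nat \<Rightarrow> 'g) \<Rightarrow> nat \<Rightarrow> 'g" where
  "partial_product G f 0 = \<one>\<^bsub>G\<^esub>"
| "partial_product G f (Suc n) = partial_product G f n \<otimes>\<^bsub>G\<^esub> f n"

lemma (in group) partial_product_closed:
  "(\<And>i. i < n \<Longrightarrow> f i \<in> carrier G) \<Longrightarrow> partial_product G f n \<in> carrier G"
  by (induction n) auto

lemma (in group) partial_product_one:
  "(\<And>i. i < n \<Longrightarrow> f i = \<one>) \<Longrightarrow> partial_product G f n = \<one>"
  by (induction n) auto

text \<open>A coarse median with one argument fixed at the identity. The jump condition is the
  coarse Lipschitz property, with a finite set of differences in place of a metric. The identities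
  on the diagonal and the axes are exact because they have to close up the boundary of the
  grid.\<close>

definition coarse_meet :: "('g, 'm) monoid_scheme \<Rightarrow> ('g \<Rightarrow> 'g \<Rightarrow> 'g) \<Rightarrow> bool" where
  "coarse_meet G \<beta> \<longleftrightarrow>
     (\<forall>g\<in>carrier G. \<forall>h\<in>carrier G. \<beta> g h \<in> carrier G) \<and>
     (\<forall>g\<in>carrier G. \<beta> g g = g \<and> \<beta> \<one>\<^bsub>G\<^esub> g = \<one>\<^bsub>G\<^esub> \<and> \<beta> g \<one>\<^bsub>G\<^esub> = \<one>\<^bsub>G\<^esub>) \<and>
     (\<forall>A. finite A \<and> A \<subseteq> carrier G \<longrightarrow>
        (\<exists>J. finite J \<and> J \<subseteq> carrier G \<and>
          (\<forall>g\<in>carrier G. \<forall>h\<in>carrier G. \<forall>a\<in>A.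
             inv\<^bsub>G\<^esub> \<beta> g h \<otimes>\<^bsub>G\<^esub> \<beta> (g \<otimes>\<^bsub>G\<^esub> a) h \<in> J \<and> inv\<^bsub>G\<^esub> \<beta> g h \<otimes>\<^bsub>G\<^esub> \<beta> g (h \<otimes>\<^bsub>G\<^esub> a) \<in> J)))"

lemma coarse_meet_jumps:
  assumes "coarse_meet G \<beta>" "finite A" "A \<subseteq> carrier G"
  shows "\<exists>J. finite J \<and> J \<subseteq> carrier G \<and>
          (\<forall>g\<in>carrier G. \<forall>h\<in>carrier G. \<forall>a\<in>A.
             inv\<^bsub>G\<^esub> \<beta> g h \<otimes>\<^bsub>G\<^esub> \<beta> (g \<otimes>\<^bsub>G\<^esub> a) h \<in> J \<and> inv\<^bsub>G\<^esub> \<beta> g h \<otimes>\<^bsub>G\<^esub> \<beta> g (h \<otimes>\<^bsub>G\<^esub> a) \<in> J)"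
  using assms(1)[unfolded coarse_meet_def, THEN conjunct2, THEN conjunct2, rule_format, of A]
      assms(2,3) by simp

text \<open>The loop with vertices \<open>x\<^sub>0, \<dots>, x\<^sub>n\<close> bounds the disc with vertices \<open>\<beta> x\<^sub>i x\<^sub>j\<close>, \<open>i \<le> j\<close>:
  on the diagonal this is the loop, and the two other sides of the triangle are constant.\<close>

lemma coarse_meet_filling:
  assumes G: "group G" and F: "group F" and \<phi>: "\<phi> \<in> hom F G" and \<beta>: "coarse_meet G \<beta>"
    and surj: "\<phi> ` carrier F = carrier G" and L: "finite L" "L \<subseteq> carrier F"
  shows "\<exists>Q. finite Q \<and> Q \<subseteq> kernel F G \<phi> \<and>
     (\<forall>w n. (\<forall>i<n. w i \<in> L) \<and> \<phi> (partial_product F w n) = \<one>\<^bsub>G\<^esub> \<longrightarrow>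
        (\<exists>l\<le>n\<^sup>2. conjugate_product F Q l (partial_product F w n)))"
proof -
  interpret G: group G by fact
  interpret F: group F by fact
  interpret \<phi>: group_hom F G \<phi> using G F \<phi> by (simp add: group_hom_def group_hom_axioms_def)
  have \<beta>c: "\<beta> g h \<in> carrier G" if "g \<in> carrier G" "h \<in> carrier G" for g h
    using \<beta>[unfolded coarse_meet_def, THEN conjunct1] that by blast
  have \<beta>e: "\<beta> g g = g" "\<beta> \<one>\<^bsub>G\<^esub> g = \<one>\<^bsub>G\<^esub>" "\<beta> g \<one>\<^bsub>G\<^esub> = \<one>\<^bsub>G\<^esub>" if "g \<in> carrier G" for g
    using \<beta>[unfolded coarse_meet_def, THEN conjunct2, THEN conjunct1] that by blast+
  have "finite (\<phi> ` L)" "\<phi> ` L \<subseteq> carrier G" using L by auto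
  from coarse_meet_jumps[OF \<beta> this] obtain J where J: "finite J" "J \<subseteq> carrier G"
    and jumps: "\<forall>g\<in>carrier G. \<forall>h\<in>carrier G. \<forall>a\<in>\<phi> ` L.
        inv\<^bsub>G\<^esub> \<beta> g h \<otimes>\<^bsub>G\<^esub> \<beta> (g \<otimes>\<^bsub>G\<^esub> a) h \<in> J \<and> inv\<^bsub>G\<^esub> \<beta> g h \<otimes>\<^bsub>G\<^esub> \<beta> g (h \<otimes>\<^bsub>G\<^esub> a) \<in> J"
    by (elim exE conjE)
  \<comment> \<open>The identity is lifted to the identity, so that the constant sides of the
    triangle spell the trivial element of \<open>F\<close> itself and not just an element of the
    kernel.\<close>
  define u where "u = (\<lambda>g. if g = \<one>\<^bsub>G\<^esub> then \<one>\<^bsub>F\<^esub> else inv_into (carrier F) \<phi> g)"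
  have u: "u g \<in> carrier F" "\<phi> (u g) = g" if "g \<in> carrier G" for g
    using that inv_into_into[of g \<phi> "carrier F"] f_inv_into_f[of g \<phi> "carrier F"]
    by (simp_all add: u_def surj)
  have u1: "u \<one>\<^bsub>G\<^esub> = \<one>\<^bsub>F\<^esub>" by (simp add: u_def)
  \<comment> \<open>The identity is among the edges so that the triangular cells along the diagonal
    are squares with one degenerate edge.\<close>
  define U where "U = insert \<one>\<^bsub>F\<^esub> (L \<union> u ` J)"
  have U: "finite U" "U \<subseteq> carrier F" using L J u by (auto simp: U_def)
  \<comment> \<open>All squares with edges in \<open>U\<close> whose two boundary paths agree in
    \<open>G\<close>. Every cell of the grid is of this form, whatever the loop and its
    length.\<close>
  define Q where "Q = {q. \<exists>a\<in>U. \<exists>b\<in>U. \<exists>c\<in>U. \<exists>d\<in>U. q = (a \<otimes>\<^bsub>F\<^esub> b) \<otimes>\<^bsub>F\<^esub> inv\<^bsub>F\<^esub> (c \<otimes>\<^bsub>F\<^esub> d) \<and>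
      \<phi> (a \<otimes>\<^bsub>F\<^esub> b) = \<phi> (c \<otimes>\<^bsub>F\<^esub> d)}"
  have "Q \<subseteq> (\<lambda>(a, b, c, d). (a \<otimes>\<^bsub>F\<^esub> b) \<otimes>\<^bsub>F\<^esub> inv\<^bsub>F\<^esub> (c \<otimes>\<^bsub>F\<^esub> d)) ` (U \<times> U \<times> U \<times> U)"
  proof
    fix q assume "q \<in> Q"
    then obtain a b c d where "a \<in> U" "b \<in> U" "c \<in> U" "d \<in> U"
      "q = (a \<otimes>\<^bsub>F\<^esub> b) \<otimes>\<^bsub>F\<^esub> inv\<^bsub>F\<^esub> (c \<otimes>\<^bsub>F\<^esub> d)"
      unfolding Q_def by blast
    then show "q \<in> (\<lambda>(a, b, c, d). (a \<otimes>\<^bsub>F\<^esub> b) \<otimes>\<^bsub>F\<^esub> inv\<^bsub>F\<^esub> (c \<otimes>\<^bsub>F\<^esub> d)) ` (U \<times> U \<times> U \<times> U)"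
      by (intro image_eqI[of _ _ "(a, b, c, d)"]) simp_all
  qed
  then have Qfin: "finite Q" by (rule finite_subset) (use U(1) in simp)
  have Qker: "Q \<subseteq> kernel F G \<phi>"
  proof
    fix q assume "q \<in> Q"
    then obtain a b c d where abcd: "a \<in> U" "b \<in> U" "c \<in> U" "d \<in> U"
      and q: "q = (a \<otimes>\<^bsub>F\<^esub> b) \<otimes>\<^bsub>F\<^esub> inv\<^bsub>F\<^esub> (c \<otimes>\<^bsub>F\<^esub> d)" "\<phi> (a \<otimes>\<^bsub>F\<^esub> b) = \<phi> (c \<otimes>\<^bsub>F\<^esub> d)"
      unfolding Q_def by blast
    have c: "a \<otimes>\<^bsub>F\<^esub> b \<in> carrier F" "c \<otimes>\<^bsub>F\<^esub> d \<in> carrier F"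
      using abcd U(2) by (blast intro: F.m_closed)+
    then have "\<phi> q = \<phi> (a \<otimes>\<^bsub>F\<^esub> b) \<otimes>\<^bsub>G\<^esub> inv\<^bsub>G\<^esub> \<phi> (c \<otimes>\<^bsub>F\<^esub> d)"
      unfolding q(1) by (metis F.inv_closed \<phi>.hom_inv \<phi>.hom_mult)
    then have "\<phi> q = \<one>\<^bsub>G\<^esub>"
      unfolding q(2) using c(2) by (metis G.r_inv \<phi>.hom_closed)
    then show "q \<in> kernel F G \<phi>" using c q(1) by (simp add: kernel_def)
  qed
  then have Qc: "Q \<subseteq> carrier F" by (auto simp: kernel_def)
  have cell: "F.homotopic Q 1 (a \<otimes>\<^bsub>F\<^esub> b) (c \<otimes>\<^bsub>F\<^esub> d)"
    if "a \<in> U" "b \<in> U" "c \<in> U" "d \<in> U" "\<phi> (a \<otimes>\<^bsub>F\<^esub> b) = \<phi> (c \<otimes>\<^bsub>F\<^esub> d)" for a b c d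
  proof -
    have "(a \<otimes>\<^bsub>F\<^esub> b) \<otimes>\<^bsub>F\<^esub> inv\<^bsub>F\<^esub> (c \<otimes>\<^bsub>F\<^esub> d) \<in> Q"
      unfolding Q_def using that by blast
    then show ?thesis
      unfolding F.homotopic_def using F.conjugate_product_generator[OF Qc] order_refl by metis
  qed
  have "\<exists>l\<le>n\<^sup>2. conjugate_product F Q l (partial_product F w n)"
    if w: "\<forall>i<n. w i \<in> L" and null: "\<phi> (partial_product F w n) = \<one>\<^bsub>G\<^esub>" for w n
  proof -
    have wc: "w i \<in> carrier F" "w i \<in> U" if "i < n" for i using w that L by (auto simp: U_def)
    define X where "X = partial_product F w"
    have Xc: "X i \<in> carrier F" if "i \<le> n" for i
      unfolding X_def using that wc by (intro F.partial_product_closed) auto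
    define x where "x = (\<lambda>i. \<phi> (X i))"
    have xc: "x i \<in> carrier G" if "i \<le> n" for i using Xc that by (simp add: x_def)
    have xSuc: "x (Suc i) = x i \<otimes>\<^bsub>G\<^esub> \<phi> (w i)" if "i < n" for i
      unfolding x_def using Xc[of i] wc[of i] that by (simp add: X_def)
    have x0: "x 0 = \<one>\<^bsub>G\<^esub>" by (simp add: x_def X_def)
    have xn: "x n = \<one>\<^bsub>G\<^esub>" using null by (simp add: x_def X_def)
    define p where "p = (\<lambda>i j. \<beta> (x i) (x j))"
    have pc: "p i j \<in> carrier G" if "i \<le> n" "j \<le> n" for i j
      using \<beta>c xc that by (simp add: p_def)
    \<comment> \<open>Lifts of the edges of the grid: \<open>h i j\<close> leads from
      \<open>p i j\<close> to \<open>p (Suc i) j\<close>, and \<open>v i j\<close> from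
      \<open>p i j\<close> to \<open>p i (Suc j)\<close>.\<close>
    define h where "h = (\<lambda>i j. u (inv\<^bsub>G\<^esub> p i j \<otimes>\<^bsub>G\<^esub> p (Suc i) j))"
    define v where "v = (\<lambda>i j. u (inv\<^bsub>G\<^esub> p i j \<otimes>\<^bsub>G\<^esub> p i (Suc j)))"
    have h: "h i j \<in> carrier F" "h i j \<in> U" "\<phi> (h i j) = inv\<^bsub>G\<^esub> p i j \<otimes>\<^bsub>G\<^esub> p (Suc i) j"
      if "i < n" "j \<le> n" for i j
    proof -
      have "inv\<^bsub>G\<^esub> p i j \<otimes>\<^bsub>G\<^esub> p (Suc i) j \<in> J"
        unfolding p_def xSuc[OF that(1)] using that w by (intro jumps[rule_format, THEN conjunct1] xc) auto
      then show "h i j \<in> carrier F" "h i j \<in> U" "\<phi> (h i j) = inv\<^bsub>G\<^esub> p i j \<otimes>\<^bsub>G\<^esub> p (Suc i) j"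
        using u J by (auto simp: h_def U_def)
    qed
    have v: "v i j \<in> carrier F" "v i j \<in> U" "\<phi> (v i j) = inv\<^bsub>G\<^esub> p i j \<otimes>\<^bsub>G\<^esub> p i (Suc j)"
      if "i \<le> n" "j < n" for i j
    proof -
      have "inv\<^bsub>G\<^esub> p i j \<otimes>\<^bsub>G\<^esub> p i (Suc j) \<in> J"
        unfolding p_def xSuc[OF that(2)] using that w by (intro jumps[rule_format, THEN conjunct2] xc) auto
      then show "v i j \<in> carrier F" "v i j \<in> U" "\<phi> (v i j) = inv\<^bsub>G\<^esub> p i j \<otimes>\<^bsub>G\<^esub> p i (Suc j)"
        using u J by (auto simp: v_def U_def)
    qed
    have telescope: "(inv\<^bsub>G\<^esub> a \<otimes>\<^bsub>G\<^esub> b) \<otimes>\<^bsub>G\<^esub> (inv\<^bsub>G\<^esub> b \<otimes>\<^bsub>G\<^esub> c) = inv\<^bsub>G\<^esub> a \<otimes>\<^bsub>G\<^esub> c"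
      if "a \<in> carrier G" "b \<in> carrier G" "c \<in> carrier G" for a b c
      using that by (metis G.inv_closed G.inv_solve_left G.m_assoc G.m_closed)
    define Row where "Row = (\<lambda>m j. partial_product F (\<lambda>i. h i j) m)"
    have Rc: "Row m j \<in> carrier F" if "m \<le> n" "j \<le> n" for m j
      unfolding Row_def using that h by (intro F.partial_product_closed) auto
    \<comment> \<open>The strip between the rows \<open>j\<close> and \<open>Suc j\<close>, up to
      column \<open>m\<close>, consists of \<open>m\<close> squares. Crossing them one at a time
      moves the vertical edge from column \<open>m\<close> to column 0.\<close>
    have strip: "F.homotopic Q m (Row m j \<otimes>\<^bsub>F\<^esub> v m j) (v 0 j \<otimes>\<^bsub>F\<^esub> Row m (Suc j))"
      if "m \<le> n" "j < n" for m j
      using that(1)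
    proof (induction m)
      case 0
      then show ?case using v[of 0 j] that by (simp add: Row_def F.homotopic_refl)
    next
      case (Suc m)
      have m: "m < n" "m \<le> n" "Suc m \<le> n" "j \<le> n" "Suc j \<le> n" using Suc.prems that by auto
      have c: "h m j \<in> carrier F" "h m (Suc j) \<in> carrier F" "v m j \<in> carrier F"
        "v (Suc m) j \<in> carrier F" "v 0 j \<in> carrier F" "Row m j \<in> carrier F" "Row m (Suc j) \<in> carrier F"
        using h(1)[OF m(1,4)] h(1)[OF m(1,5)] v(1)[OF m(2) that(2)] v(1)[OF m(3) that(2)]
          v(1)[OF le0 that(2)] Rc[OF m(2,4)] Rc[OF m(2,5)] by simp_all
      have pj: "p m j \<in> carrier G" "p (Suc m) j \<in> carrier G" "p m (Suc j) \<in> carrier G"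
        "p (Suc m) (Suc j) \<in> carrier G"
        using pc m by simp_all
      have "\<phi> (h m j \<otimes>\<^bsub>F\<^esub> v (Suc m) j) = \<phi> (v m j \<otimes>\<^bsub>F\<^esub> h m (Suc j))"
        using c pj h(3)[OF m(1,4)] h(3)[OF m(1,5)] v(3)[OF m(2) that(2)] v(3)[OF m(3) that(2)]
        by (simp add: telescope)
      then have "F.homotopic Q 1 (h m j \<otimes>\<^bsub>F\<^esub> v (Suc m) j) (v m j \<otimes>\<^bsub>F\<^esub> h m (Suc j))"
        by (intro cell h(2)[OF m(1,4)] h(2)[OF m(1,5)] v(2)[OF m(2) that(2)] v(2)[OF m(3) that(2)])
      then have 1: "F.homotopic Q 1 (Row m j \<otimes>\<^bsub>F\<^esub> (h m j \<otimes>\<^bsub>F\<^esub> v (Suc m) j))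
          (Row m j \<otimes>\<^bsub>F\<^esub> (v m j \<otimes>\<^bsub>F\<^esub> h m (Suc j)))"
        by (intro F.homotopic_left Qc F.m_closed c)
      have 2: "F.homotopic Q m (Row m j \<otimes>\<^bsub>F\<^esub> v m j \<otimes>\<^bsub>F\<^esub> h m (Suc j))
          (v 0 j \<otimes>\<^bsub>F\<^esub> Row m (Suc j) \<otimes>\<^bsub>F\<^esub> h m (Suc j))"
        by (intro F.homotopic_right Qc F.m_closed c Suc.IH m)
      have "F.homotopic Q (1 + m) (Row m j \<otimes>\<^bsub>F\<^esub> (h m j \<otimes>\<^bsub>F\<^esub> v (Suc m) j))
          (v 0 j \<otimes>\<^bsub>F\<^esub> Row m (Suc j) \<otimes>\<^bsub>F\<^esub> h m (Suc j))"
        using 2 by (intro F.homotopic_trans[OF Qc _ _ _ 1] F.m_closed c) (simp add: F.m_assoc c)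
      then show ?case
        using c by (simp add: Row_def F.m_assoc)
    qed
    \<comment> \<open>The diagonal path up to \<open>j\<close> is pushed into row \<open>j\<close>.
      Passing to \<open>Suc j\<close> costs one triangle at the diagonal and a strip of
      \<open>j\<close> squares, and j^2 + 1 + j is at most (j + 1)^2.\<close>
    have diag: "F.homotopic Q (j\<^sup>2) (X j) (Row j j)" if "j \<le> n" for j
      using that
    proof (induction j)
      case 0
      then show ?case by (simp add: X_def Row_def F.homotopic_refl)
    next
      case (Suc j)
      then have j: "j < n" "j \<le> n" "Suc j \<le> n" by auto
      have p: "p j j = x j" "p (Suc j) (Suc j) = x (Suc j)"
        using \<beta>e xc j by (auto simp: p_def)
      have p0: "p 0 j = \<one>\<^bsub>G\<^esub>" "p 0 (Suc j) = \<one>\<^bsub>G\<^esub>"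
        using \<beta>e xc j x0 by (auto simp: p_def)
      have v0: "v 0 j = \<one>\<^bsub>F\<^esub>" using p0 u1 by (simp add: v_def)
      have c: "h j (Suc j) \<in> carrier F" "v j j \<in> carrier F" "v 0 j \<in> carrier F" "w j \<in> carrier F"
        "X j \<in> carrier F" "Row j j \<in> carrier F" "Row j (Suc j) \<in> carrier F"
        using h(1)[OF j(1,3)] v(1)[OF j(2,1)] v(1)[OF le0 j(1)] wc(1)[OF j(1)] Xc[OF j(2)]
          Rc[OF j(2,2)] Rc[OF j(2,3)] by simp_all
      have pj: "p j j \<in> carrier G" "p j (Suc j) \<in> carrier G" "p (Suc j) (Suc j) \<in> carrier G"
        using pc j by simp_all
      have "\<phi> (w j) = inv\<^bsub>G\<^esub> x j \<otimes>\<^bsub>G\<^esub> x (Suc j)"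
        using xc[OF j(2)] c by (simp add: xSuc[OF j(1)] G.m_assoc[symmetric])
      then have "\<phi> (w j \<otimes>\<^bsub>F\<^esub> \<one>\<^bsub>F\<^esub>) = \<phi> (v j j \<otimes>\<^bsub>F\<^esub> h j (Suc j))"
        using h(3)[OF j(1,3)] v(3)[OF j(2,1)] c telescope[OF pj] by (simp add: p)
      then have "F.homotopic Q 1 (w j \<otimes>\<^bsub>F\<^esub> \<one>\<^bsub>F\<^esub>) (v j j \<otimes>\<^bsub>F\<^esub> h j (Suc j))"
        by (intro cell h(2)[OF j(1,3)] v(2)[OF j(2,1)] wc(2)[OF j(1)]) (simp add: U_def)
      then have "F.homotopic Q 1 (w j) (v j j \<otimes>\<^bsub>F\<^esub> h j (Suc j))"
        using c by simp
      then have 1: "F.homotopic Q 1 (Row j j \<otimes>\<^bsub>F\<^esub> w j) (Row j j \<otimes>\<^bsub>F\<^esub> (v j j \<otimes>\<^bsub>F\<^esub> h j (Suc j)))"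
        by (intro F.homotopic_left Qc F.m_closed c)
      have 0: "F.homotopic Q (j\<^sup>2) (X j \<otimes>\<^bsub>F\<^esub> w j) (Row j j \<otimes>\<^bsub>F\<^esub> w j)"
        by (intro F.homotopic_right Qc F.m_closed c Suc.IH j)
      have 01: "F.homotopic Q (j\<^sup>2 + 1) (X j \<otimes>\<^bsub>F\<^esub> w j) (Row j j \<otimes>\<^bsub>F\<^esub> (v j j \<otimes>\<^bsub>F\<^esub> h j (Suc j)))"
        by (intro F.homotopic_trans[OF Qc _ _ _ 0 1] F.m_closed c)
      have 2: "F.homotopic Q j (Row j j \<otimes>\<^bsub>F\<^esub> v j j \<otimes>\<^bsub>F\<^esub> h j (Suc j))
          (v 0 j \<otimes>\<^bsub>F\<^esub> Row j (Suc j) \<otimes>\<^bsub>F\<^esub> h j (Suc j))"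
        by (intro F.homotopic_right strip[OF j(2,1)] Qc F.m_closed c)
      have 3: "F.homotopic Q (j\<^sup>2 + 1 + j) (X j \<otimes>\<^bsub>F\<^esub> w j)
          (v 0 j \<otimes>\<^bsub>F\<^esub> Row j (Suc j) \<otimes>\<^bsub>F\<^esub> h j (Suc j))"
        using 2 by (intro F.homotopic_trans[OF Qc _ _ _ 01] F.m_closed c) (simp add: F.m_assoc c)
      have 4: "v 0 j \<otimes>\<^bsub>F\<^esub> Row j (Suc j) \<otimes>\<^bsub>F\<^esub> h j (Suc j) = Row (Suc j) (Suc j)"
        using Rc[OF j(2,3)] h[OF j(1,3)] by (simp add: v0 Row_def)
      have 5: "j\<^sup>2 + 1 + j \<le> (Suc j)\<^sup>2" by (simp add: power2_eq_square)
      have 6: "X (Suc j) = X j \<otimes>\<^bsub>F\<^esub> w j" by (simp add: X_def)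
      show ?case
        unfolding 6 by (rule F.homotopic_mono[OF 3[unfolded 4] 5])
    qed
    \<comment> \<open>The last row is constant, as the loop closes up: \<open>x n\<close> is the
      identity and so is \<open>\<beta> (x i) \<one>\<close>.\<close>
    have "h i n = \<one>\<^bsub>F\<^esub>" if "i < n" for i
      using that \<beta>e xc xn u1 by (simp add: h_def p_def)
    then have "Row n n = \<one>\<^bsub>F\<^esub>" unfolding Row_def by (intro F.partial_product_one) auto
    then have "F.homotopic Q (n\<^sup>2) (X n) \<one>\<^bsub>F\<^esub>"
      using diag[OF order_refl] by metis
    moreover have "X n \<otimes>\<^bsub>F\<^esub> inv\<^bsub>F\<^esub> \<one>\<^bsub>F\<^esub> = partial_product F w n"
      using Xc[OF order_refl] unfolding X_def by (metis F.inv_one F.r_one)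
    ultimately show ?thesis
      unfolding F.homotopic_def by metis
  qed
  then show ?thesis using Qfin Qker by (intro exI[of _ Q] conjI allI impI) metis+
qed

section \<open>Free groups and Dehn functions\<close>

definition flip_letter :: "'s \<times> bool \<Rightarrow> 's \<times> bool" where
  "flip_letter x = (fst x, \<not> snd x)"

fun reduced :: "'s word \<Rightarrow> bool" where
  "reduced (x # y # w) \<longleftrightarrow> \<not> (fst y = fst x \<and> snd y \<noteq> snd x) \<and> reduced (y # w)"
| "reduced w \<longleftrightarrow> True"

lemma reduced_tl: "reduced (x # w) \<Longrightarrow> reduced w"
  by (cases w) auto

lemma reduced_cancel_cons: "reduced w \<Longrightarrow> reduced (cancel_cons x w)"
  by (cases w) (auto dest: reduced_tl)

lemma reduced_foldr: "reduced t \<Longrightarrow> reduced (foldr cancel_cons u t)"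
  by (induction u) (auto intro: reduced_cancel_cons)

lemma free_reduce_Cons: "free_reduce (x # w) = cancel_cons x (free_reduce w)"
  by (simp add: free_reduce_def)

lemma free_reduce_Nil [simp]: "free_reduce [] = []"
  by (simp add: free_reduce_def)

lemma free_reduce_append: "free_reduce (u @ v) = foldr cancel_cons u (free_reduce v)"
  by (simp add: free_reduce_def)

lemma reduced_free_reduce: "reduced (free_reduce w)"
  unfolding free_reduce_def by (rule reduced_foldr) simp

lemma free_reduce_reduced: "reduced w \<Longrightarrow> free_reduce w = w"
proof (induction w)
  case (Cons x w)
  then show ?case by (cases w) (auto simp: free_reduce_Cons)
qed simp

lemma free_reduce_idem [simp]: "free_reduce (free_reduce w) = free_reduce w"
  by (simp add: free_reduce_reduced reduced_free_reduce)

text \<open>Van der Waerden's trick: letters act on reduced words by permutations, with opposite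
  letters acting inversely. Reducedness matters when the inner step cancels a leading
  \<open>x\<close>: the rest then does not start with the opposite of \<open>x\<close>, so the outer
  step restores \<open>x\<close> without a further cancellation.\<close>

lemma cancel_cons_flip:
  assumes "reduced t"
  shows "cancel_cons x (cancel_cons (flip_letter x) t) = t"
proof (cases t)
  case (Cons y u)
  show ?thesis
  proof (cases "y = x")
    case True
    then show ?thesis
      using assms Cons by (cases u) (auto simp: flip_letter_def)
  next
    case False
    then show ?thesis
      using Cons by (auto simp: flip_letter_def prod_eq_iff)
  qed
qed (simp add: flip_letter_def)

lemma cancel_cons_flip':
  assumes "reduced t"
  shows "cancel_cons (flip_letter x) (cancel_cons x t) = t"
  using cancel_cons_flip[OF assms, of "flip_letter x"] by (simp add: flip_letter_def)

lemma foldr_cancel_cons: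
  assumes "reduced t"
  shows "foldr cancel_cons (cancel_cons x v) t = cancel_cons x (foldr cancel_cons v t)"
proof (cases v)
  case (Cons y u)
  show ?thesis
  proof (cases "fst y = fst x \<and> snd y \<noteq> snd x")
    case True
    then have "y = flip_letter x" by (auto simp: flip_letter_def prod_eq_iff)
    then show ?thesis
      using cancel_cons_flip[OF reduced_foldr[OF assms], of x u] Cons True by simp
  next
    case False
    then show ?thesis using Cons by auto
  qed
qed simp

text \<open>Cancelled pairs act trivially, so a word and its reduction act alike on reduced words.
  Associativity in the free group follows from this.\<close>

lemma foldr_free_reduce:
  "reduced t \<Longrightarrow> foldr cancel_cons (free_reduce u) t = foldr cancel_cons u t"
  by (induction u) (auto simp: free_reduce_Cons foldr_cancel_cons)

lemma free_reduce_append_left [simp]: "free_reduce (free_reduce u @ v) = free_reduce (u @ v)"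
  by (simp add: free_reduce_append foldr_free_reduce reduced_free_reduce)

lemma free_reduce_append_right [simp]: "free_reduce (u @ free_reduce v) = free_reduce (u @ v)"
  by (simp add: free_reduce_append)

lemma free_reduce_inverse: "free_reduce (map flip_letter (rev w) @ w) = []"
proof (induction w)
  case (Cons x w)
  have "free_reduce (map flip_letter (rev (x # w)) @ x # w)
      = foldr cancel_cons (map flip_letter (rev w))
          (cancel_cons (flip_letter x) (cancel_cons x (free_reduce w)))"
    by (simp add: free_reduce_append free_reduce_Cons)
  also have "\<dots> = free_reduce (map flip_letter (rev w) @ w)"
    by (simp add: cancel_cons_flip' reduced_free_reduce free_reduce_append)
  finally show ?case using Cons by simp
qed simp

lemma set_cancel_cons: "set (cancel_cons x w) \<subseteq> insert x (set w)"
  by (cases w) auto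

lemma set_free_reduce: "set (free_reduce w) \<subseteq> set w"
proof (induction w)
  case (Cons x w)
  then show ?case using set_cancel_cons[of x "free_reduce w"] by (auto simp: free_reduce_Cons)
qed simp

lemma free_reduce_in_words: "w \<in> words S \<Longrightarrow> free_reduce w \<in> words S"
  using set_free_reduce unfolding words_def by fastforce

lemma free_group_simps [simp]:
  "x \<in> carrier (free_group S) \<longleftrightarrow> x \<in> words S \<and> free_reduce x = x"
  "u \<otimes>\<^bsub>free_group S\<^esub> v = free_reduce (u @ v)"
  "\<one>\<^bsub>free_group S\<^esub> = []"
  by (simp_all add: free_group_def)

lemma group_free_group: "group (free_group S)"
proof (rule groupI)
  fix x assume "x \<in> carrier (free_group S)"
  then have x: "x \<in> words S" by simp
  let ?y = "free_reduce (map flip_letter (rev x))"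
  have "map flip_letter (rev x) \<in> words S" using x by (auto simp: words_def flip_letter_def)
  then have "?y \<in> carrier (free_group S)" by (simp add: free_reduce_in_words)
  moreover have "?y \<otimes>\<^bsub>free_group S\<^esub> x = \<one>\<^bsub>free_group S\<^esub>"
    by (simp add: free_reduce_inverse)
  ultimately show "\<exists>y\<in>carrier (free_group S). y \<otimes>\<^bsub>free_group S\<^esub> x = \<one>\<^bsub>free_group S\<^esub>" by blast
next
  fix x y assume "x \<in> carrier (free_group S)" "y \<in> carrier (free_group S)"
  then have "x @ y \<in> words S" by (auto simp: words_def)
  then show "x \<otimes>\<^bsub>free_group S\<^esub> y \<in> carrier (free_group S)"
    by (simp add: free_reduce_in_words)
qed (auto simp: words_def)

text \<open>Reads a word as an edge path with one letter per step, the form in which the grid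
  filling accepts loops.\<close>

lemma free_reduce_partial_product:
  "free_reduce w = partial_product (free_group S) (\<lambda>i. [w ! i]) (length w)"
proof (induction w rule: rev_induct)
  case (snoc x w)
  have "partial_product (free_group S) (\<lambda>i. [(w @ [x]) ! i]) n
      = partial_product (free_group S) (\<lambda>i. [w ! i]) n" if "n \<le> length w" for n
    using that by (induction n) (auto simp: nth_append)
  then show ?case
    using snoc free_reduce_append_left[of w "[x]"] by (simp del: free_reduce_append_left)
qed simp

section \<open>Homomorphisms from a free group determined by the images of the generators\<close>

definition word_value :: "('g, 'm) monoid_scheme \<Rightarrow> ('s \<Rightarrow> 'g) \<Rightarrow> 's word \<Rightarrow> 'g" where
  "word_value G f w = foldr (\<lambda>x g. (if snd x then f (fst x) else inv\<^bsub>G\<^esub> f (fst x)) \<otimes>\<^bsub>G\<^esub> g) w \<one>\<^bsub>G\<^esub>"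

context group
begin

lemma word_value_closed:
  assumes "f \<in> S \<rightarrow> carrier G" "w \<in> words S"
  shows "word_value G f w \<in> carrier G"
  using assms(2)
proof (induction w)
  case (Cons x w)
  then have "f (fst x) \<in> carrier G" "w \<in> words S" using assms(1) by (auto simp: words_def)
  then show ?case using Cons by (auto simp: word_value_def)
qed (simp add: word_value_def)

lemma word_value_append:
  assumes "f \<in> S \<rightarrow> carrier G" "u \<in> words S" "v \<in> words S"
  shows "word_value G f (u @ v) = word_value G f u \<otimes> word_value G f v"
  using assms(2)
proof (induction u)
  case Nil
  then show ?case using word_value_closed[OF assms(1,3)] by (simp add: word_value_def)
next
  case (Cons x u)
  then have *: "f (fst x) \<in> carrier G" "u \<in> words S" using assms(1) by (auto simp: words_def)
  then have "word_value G f u \<in> carrier G" using word_value_closed[OF assms(1)] by blast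
  then show ?case
    using * Cons word_value_closed[OF assms(1,3)] by (auto simp: word_value_def m_assoc)
qed

lemma word_value_cancel_cons:
  assumes "f \<in> S \<rightarrow> carrier G" "x # w \<in> words S"
  shows "word_value G f (cancel_cons x w) = word_value G f (x # w)"
proof (cases w)
  case (Cons y u)
  have *: "f (fst x) \<in> carrier G" "u \<in> words S" using assms Cons by (auto simp: words_def)
  then have "word_value G f u \<in> carrier G" using word_value_closed[OF assms(1)] by blast
  then show ?thesis
    using * Cons by (auto simp: word_value_def m_assoc[symmetric])
qed simp

lemma word_value_free_reduce:
  assumes "f \<in> S \<rightarrow> carrier G" "w \<in> words S"
  shows "word_value G f (free_reduce w) = word_value G f w"
  using assms(2)
proof (induction w)
  case (Cons x w)
  then have w: "w \<in> words S" by (auto simp: words_def)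
  then have "x # free_reduce w \<in> words S"
    using Cons.prems free_reduce_in_words[OF w] by (simp add: words_def)
  then have "word_value G f (free_reduce (x # w)) = word_value G f (x # free_reduce w)"
    using word_value_cancel_cons[OF assms(1)] by (simp add: free_reduce_Cons)
  then show ?case using Cons w by (simp add: word_value_def)
qed simp

lemma word_value_hom:
  assumes "f \<in> S \<rightarrow> carrier G"
  shows "word_value G f \<in> hom (free_group S) G"
proof (rule homI)
  fix u v assume "u \<in> carrier (free_group S)" "v \<in> carrier (free_group S)"
  then have "u \<in> words S" "v \<in> words S" "u @ v \<in> words S" by (auto simp: words_def)
  then show "word_value G f (u \<otimes>\<^bsub>free_group S\<^esub> v) = word_value G f u \<otimes> word_value G f v"
    using word_value_free_reduce[OF assms] word_value_append[OF assms] by simp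
qed (use word_value_closed[OF assms] in auto)

end

text \<open>The grid filling with one-letter words as steps. The bound is in the length of the given
  word, which need not be reduced, as Dehn functions require.\<close>

lemma free_group_filling:
  fixes S :: "'s set"
  assumes "finite S" and G: "group G" and "coarse_meet G \<beta>"
    and \<phi>: "\<phi> \<in> hom (free_group S) G" "\<phi> ` carrier (free_group S) = carrier G"
  shows "\<exists>Q. finite Q \<and> Q \<subseteq> kernel (free_group S) G \<phi> \<and>
     (\<forall>w\<in>words S. free_reduce w \<in> kernel (free_group S) G \<phi> \<longrightarrow>
        (\<exists>l\<le>(length w)\<^sup>2. conjugate_product (free_group S) Q l (free_reduce w)))"
proof -
  let ?F = "free_group S" and ?L = "(\<lambda>x. [x]) ` (S \<times> (UNIV :: bool set))"
  have fin: "finite ?L" using assms(1) by simp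
  have "?L \<subseteq> carrier ?F" by (auto simp: words_def free_reduce_Cons)
  from coarse_meet_filling[OF G group_free_group \<phi>(1) assms(3) \<phi>(2) fin this]
  obtain Q where Q: "finite Q" "Q \<subseteq> kernel ?F G \<phi>" and
    fill: "\<forall>w n. (\<forall>i<n. w i \<in> ?L) \<and> \<phi> (partial_product ?F w n) = \<one>\<^bsub>G\<^esub> \<longrightarrow>
        (\<exists>l\<le>n\<^sup>2. conjugate_product ?F Q l (partial_product ?F w n))"
    by (elim exE conjE)
  have "\<exists>l\<le>(length w)\<^sup>2. conjugate_product ?F Q l (free_reduce w)"
    if w: "w \<in> words S" and null: "free_reduce w \<in> kernel ?F G \<phi>" for w
  proof -
    have "[w ! i] \<in> ?L" if "i < length w" for i
      using nth_mem[OF that] w by (auto simp: words_def image_iff)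
    then show ?thesis
      using fill[rule_format, of "length w" "\<lambda>i. [w ! i]"] null
      unfolding free_reduce_partial_product[of w S] kernel_def by blast
  qed
  then show ?thesis using Q by blast
qed

text \<open>The cell boundaries \<open>Q\<close> serve as relators. They lie in the kernel of the
  map from the free group, and since every word in the kernel has a filling, they generate it as a
  normal subgroup.\<close>

lemma coarse_meet_finitely_presented:
  assumes "finitely_generated_group G" "coarse_meet G \<beta>"
  shows "finitely_presented G"
proof -
  interpret group G using assms(1) by (simp add: finitely_generated_group_def)
  obtain A where A: "finite A" "A \<subseteq> carrier G" "generate G A = carrier G"
    using assms(1) unfolding finitely_generated_group_def by blast
  obtain f where f: "bij_betw f {0..<card A} A"
    using ex_bij_betw_nat_finite[OF A(1)] by blast
  define S where "S = {0..<card A}"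
  let ?F = "free_group S"
  have fS: "f \<in> S \<rightarrow> carrier G" using f A(2) by (auto simp: S_def bij_betw_def)
  define \<phi> where "\<phi> = word_value G f"
  interpret \<phi>: group_hom ?F G \<phi>
    using word_value_hom[OF fS] group_free_group is_group
    by (simp add: group_hom_def group_hom_axioms_def \<phi>_def)
  have "A \<subseteq> \<phi> ` carrier ?F"
  proof
    fix a assume "a \<in> A"
    then obtain s where s: "s \<in> S" "a = f s" using f unfolding S_def bij_betw_def by blast
    then have "f s \<in> carrier G" using fS by blast
    then have "\<phi> [(s, True)] = a" "[(s, True)] \<in> carrier ?F"
      using s by (auto simp: \<phi>_def word_value_def words_def free_reduce_Cons)
    then show "a \<in> \<phi> ` carrier ?F" by blast
  qed
  then have surj: "\<phi> ` carrier ?F = carrier G"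
    using generate_subgroup_incl[OF _ \<phi>.img_is_subgroup] A(3) \<phi>.hom_closed by blast
  obtain Q where Q: "finite Q" "Q \<subseteq> kernel ?F G \<phi>" and
    fill: "\<forall>w\<in>words S. free_reduce w \<in> kernel ?F G \<phi> \<longrightarrow>
        (\<exists>l\<le>(length w)\<^sup>2. conjugate_product ?F Q l (free_reduce w))"
    using free_group_filling[OF _ is_group assms(2) \<phi>.homh surj] unfolding S_def by blast
  have Qc: "Q \<subseteq> carrier ?F" using Q(2) by (auto simp: kernel_def)
  have "normal_closure ?F Q = kernel ?F G \<phi>"
  proof
    show "normal_closure ?F Q \<subseteq> kernel ?F G \<phi>"
      unfolding normal_closure_def using \<phi>.normal_kernel Q(2) by blast
    show "kernel ?F G \<phi> \<subseteq> normal_closure ?F Q"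
    proof
      fix w assume w: "w \<in> kernel ?F G \<phi>"
      then have "w \<in> words S" "free_reduce w = w" by (auto simp: kernel_def)
      then show "w \<in> normal_closure ?F Q"
        using fill[rule_format, of w] w unfolding group.normal_closure_eq[OF group_free_group Qc] by auto
    qed
  qed
  then have "finite_presentation G S Q"
    unfolding finite_presentation_def using Q(1) Qc \<phi>.FactGroup_iso[OF surj] by (simp add: S_def)
  then show ?thesis unfolding finitely_presented_def by blast
qed

section \<open>Areas with respect to an arbitrary finite presentation\<close>

lemma area_le:
  assumes "conjugate_product (free_group S) R l (free_reduce w)"
  shows "area S R w \<le> l"
  unfolding area_def Let_def
  by (rule Least_le) (use assms in \<open>simp only: conjugate_product_def\<close>)

lemma finite_words: "finite S \<Longrightarrow> finite {w \<in> words S. length w \<le> n}"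
  unfolding words_def using finite_lists_length_le[of "S \<times> (UNIV :: bool set)" n] by simp

text \<open>The filling comes with its own finite set \<open>Q\<close>, not with the relators of the
  given presentation. Each element of \<open>Q\<close> is a consequence of \<open>R\<close>, and
  finiteness of \<open>Q\<close> bounds the cost of all of them by one \<open>M\<close>, which
  becomes the factor in front of n^2.\<close>

lemma coarse_meet_quadratic_dehn_function:
  assumes "group G" "coarse_meet G \<beta>"
  shows "quadratic_dehn_function G"
  unfolding quadratic_dehn_function_def
proof (intro allI impI)
  fix S :: "nat set" and R
  assume pres: "finite_presentation G S R"
  let ?F = "free_group S"
  let ?N = "normal_closure ?F R"
  interpret group G by fact
  interpret F: group ?F by (rule group_free_group)
  from pres have S: "finite S" and Rc: "R \<subseteq> carrier ?F"
    and iso: "(?F Mod ?N) \<cong> G"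
    unfolding finite_presentation_def by blast+
  then obtain \<psi> where \<psi>: "\<psi> \<in> iso (?F Mod ?N) G" unfolding is_iso_def by blast
  have N: "?N = {g. \<exists>n. conjugate_product ?F R n g}" by (rule F.normal_closure_eq[OF Rc])
  have "?N \<lhd> ?F" using F.conjugate_products_normal[OF Rc] N by simp
  then interpret N: normal ?N ?F .
  define \<phi> where "\<phi> = \<psi> \<circ> (\<lambda>a. ?N #>\<^bsub>?F\<^esub> a)"
  have \<psi>': "\<psi> \<in> hom (?F Mod ?N) G" "bij_betw \<psi> (carrier (?F Mod ?N)) (carrier G)"
    using \<psi> by (auto simp: iso_def)
  have hom: "\<phi> \<in> hom ?F G"
    unfolding \<phi>_def using Group.hom_compose[OF N.r_coset_hom_Mod \<psi>'(1)] .
  have coset: "(\<lambda>a. ?N #>\<^bsub>?F\<^esub> a) ` carrier ?F = carrier (?F Mod ?N)"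
    by (auto simp: FactGroup_def RCOSETS_def)
  have surj: "\<phi> ` carrier ?F = carrier G"
    using \<psi>'(2) unfolding \<phi>_def image_comp[symmetric] coset bij_betw_def by blast
  have one: "\<psi> ?N = \<one>\<^bsub>G\<^esub>"
    using hom_one[OF \<psi>'(1) N.factorgroup_is_group is_group] by (simp add: FactGroup_def)
  have ker: "kernel ?F G \<phi> = ?N"
  proof -
    have "\<phi> a = \<one>\<^bsub>G\<^esub> \<longleftrightarrow> a \<in> ?N" if a: "a \<in> carrier ?F" for a
    proof
      assume "\<phi> a = \<one>\<^bsub>G\<^esub>"
      then have "\<psi> (?N #>\<^bsub>?F\<^esub> a) = \<psi> ?N" using one by (simp add: \<phi>_def)
      moreover have "?N #>\<^bsub>?F\<^esub> a \<in> carrier (?F Mod ?N)" using coset a by blast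
      moreover have "?N \<in> carrier (?F Mod ?N)"
        using group.is_monoid[OF N.factorgroup_is_group] monoid.one_closed by (fastforce simp: FactGroup_def)
      ultimately have "?N #>\<^bsub>?F\<^esub> a = ?N"
        using \<psi>'(2) unfolding bij_betw_def inj_on_def by blast
      then show "a \<in> ?N" using F.coset_join1[OF _ a N.subgroup_axioms] by simp
    next
      assume "a \<in> ?N"
      then have "?N #>\<^bsub>?F\<^esub> a = ?N" using N.rcos_const[OF group_free_group] by simp
      then show "\<phi> a = \<one>\<^bsub>G\<^esub>" using one by (simp add: \<phi>_def)
    qed
    moreover have "?N \<subseteq> carrier ?F" by (rule N.subset)
    ultimately show ?thesis unfolding kernel_def by blast
  qed
  obtain Q where Q: "finite Q" "Q \<subseteq> ?N" and
    fill: "\<forall>w\<in>words S. free_reduce w \<in> ?N \<longrightarrow>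
        (\<exists>l\<le>(length w)\<^sup>2. conjugate_product ?F Q l (free_reduce w))"
    using free_group_filling[OF S is_group assms(2) hom surj] unfolding ker by blast
  have Qc: "Q \<subseteq> carrier ?F" using Q(2) N.subset by blast
  have "\<forall>q\<in>Q. \<exists>m. conjugate_product ?F R m q" using Q(2) unfolding N by blast
  then obtain m where m: "\<And>q. q \<in> Q \<Longrightarrow> conjugate_product ?F R (m q) q" by metis
  \<comment> \<open>Inserting 0 keeps the maximum meaningful when \<open>Q\<close> is empty.\<close>
  define M where "M = Max (insert 0 (m ` Q))"
  have M: "m q \<le> M" if "q \<in> Q" for q using that Q(1) by (simp add: M_def)
  have area: "area S R w \<le> M * n\<^sup>2" if w: "w \<in> null_words S R" "length w \<le> n" for w n
  proof -
    have "w \<in> words S" "free_reduce w \<in> ?N" using w by (auto simp: null_words_def)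
    then obtain l where l: "l \<le> (length w)\<^sup>2" "conjugate_product ?F Q l (free_reduce w)"
      using fill by blast
    have "\<exists>l'\<le>M * l. conjugate_product ?F R l' (free_reduce w)"
      using m M by (intro F.conjugate_product_subst[OF Rc Qc _ l(2)]) blast
    then obtain l' where l': "l' \<le> M * l" "conjugate_product ?F R l' (free_reduce w)" by blast
    have "area S R w \<le> l'" by (rule area_le[OF l'(2)])
    also have "\<dots> \<le> M * (length w)\<^sup>2" using l l' by (meson mult_le_mono2 order_trans)
    also have "\<dots> \<le> M * n\<^sup>2" using w by (simp add: power_mono)
    finally show ?thesis .
  qed
  have "dehn_function S R n \<le> M * n\<^sup>2" for n
    unfolding dehn_function_def
  proof (rule Max.boundedI)
    have "{area S R w |w. w \<in> null_words S R \<and> length w \<le> n} \<subseteq> area S R ` {w \<in> words S. length w \<le> n}"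
      by (auto simp: null_words_def)
    then show "finite {area S R w |w. w \<in> null_words S R \<and> length w \<le> n}"
      using finite_words[OF S] by (meson finite_imageI finite_subset)
    \<comment> \<open>The maximum in the Dehn function is over a nonempty set for every length,
      since the empty word always qualifies.\<close>
    have "[] \<in> null_words S R" using N.one_closed by (simp add: null_words_def words_def)
    then show "{area S R w |w. w \<in> null_words S R \<and> length w \<le> n} \<noteq> {}" by fastforce
  qed (use area in auto)
  then have "norm (real (dehn_function S R n)) \<le> real M * norm ((real n)\<^sup>2)" for n
    by (metis (no_types, lifting) norm_of_nat of_nat_le_iff of_nat_mult of_nat_power norm_power)
  then show "(\<lambda>n. real (dehn_function S R n)) \<in> O(\<lambda>n. (real n)\<^sup>2)"
    by (intro bigoI[of _ "real M"]) simp
qed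

section \<open>Realization of consistent tuples\<close>

text \<open>A locale of its own, so that the derived relations can be used in the assumptions of the
  next locale.\<close>

locale index_relations =
  fixes nest perp :: "'i \<Rightarrow> 'i \<Rightarrow> bool"
begin

definition snest :: "'i \<Rightarrow> 'i \<Rightarrow> bool" where
  "snest V W \<longleftrightarrow> nest V W \<and> V \<noteq> W"

definition trv :: "'i \<Rightarrow> 'i \<Rightarrow> bool" where
  "trv V W \<longleftrightarrow> \<not> perp V W \<and> \<not> nest V W \<and> \<not> nest W V"

end

text \<open>A hierarchically hyperbolic space in which all coarse points have been replaced by points, and
  all constants by the single constant \<open>k\<close>.  The parameters \<open>\<rho> V W\<close> and \<open>\<sigma> W V\<close> correspond to
  \<open>\<rho>\<^sup>V\<^sub>W\<close> and, for \<open>V \<sqsubset> W\<close>, to the map \<open>\<rho>\<^sup>W\<^sub>V\<close>.\<close>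

locale point_hhs = index_relations nest perp
  for nest perp :: "'i \<Rightarrow> 'i \<Rightarrow> bool" +
  fixes X :: "'x set" and I :: "'i set" and C :: "'i \<Rightarrow> 'c set" and D :: "'i \<Rightarrow> 'c \<Rightarrow> 'c \<Rightarrow> real"
    and \<pi> :: "'i \<Rightarrow> 'x \<Rightarrow> 'c" and \<rho> :: "'i \<Rightarrow> 'i \<Rightarrow> 'c" and \<sigma> :: "'i \<Rightarrow> 'i \<Rightarrow> 'c \<Rightarrow> 'c"
    and k :: real and n :: nat
  assumes geodesic: "W \<in> I \<Longrightarrow> geodesic_space (C W) (D W)"
    and \<pi>_in: "W \<in> I \<Longrightarrow> x \<in> X \<Longrightarrow> \<pi> W x \<in> C W"
    and \<rho>_in: "V \<in> I \<Longrightarrow> W \<in> I \<Longrightarrow> trv V W \<or> snest V W \<Longrightarrow> \<rho> V W \<in> C W"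
    and \<sigma>_in: "V \<in> I \<Longrightarrow> W \<in> I \<Longrightarrow> snest V W \<Longrightarrow> p \<in> C W \<Longrightarrow> \<sigma> W V p \<in> C V"
    and nest_refl: "W \<in> I \<Longrightarrow> nest W W"
    and nest_trans: "U \<in> I \<Longrightarrow> V \<in> I \<Longrightarrow> W \<in> I \<Longrightarrow> nest U V \<Longrightarrow> nest V W \<Longrightarrow> nest U W"
    and nest_antisym: "V \<in> I \<Longrightarrow> W \<in> I \<Longrightarrow> nest V W \<Longrightarrow> nest W V \<Longrightarrow> V = W"
    and perp_sym: "V \<in> I \<Longrightarrow> W \<in> I \<Longrightarrow> perp V W \<Longrightarrow> perp W V"
    and perp_nest: "U \<in> I \<Longrightarrow> V \<in> I \<Longrightarrow> W \<in> I \<Longrightarrow> nest V W \<Longrightarrow> perp W U \<Longrightarrow> perp V U"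
    and perp_incomparable: "V \<in> I \<Longrightarrow> W \<in> I \<Longrightarrow> perp V W \<Longrightarrow> \<not> nest V W"
    and consistent_trv: "V \<in> I \<Longrightarrow> W \<in> I \<Longrightarrow> trv V W \<Longrightarrow> x \<in> X \<Longrightarrow>
      D W (\<pi> W x) (\<rho> V W) \<le> k \<or> D V (\<pi> V x) (\<rho> W V) \<le> k"
    and consistent_snest: "V \<in> I \<Longrightarrow> W \<in> I \<Longrightarrow> snest V W \<Longrightarrow> x \<in> X \<Longrightarrow>
      D W (\<pi> W x) (\<rho> V W) \<le> k \<or> D V (\<pi> V x) (\<sigma> W V (\<pi> W x)) \<le> k"
    and consistent_\<rho>: "U \<in> I \<Longrightarrow> V \<in> I \<Longrightarrow> W \<in> I \<Longrightarrow> nest U V \<Longrightarrow> trv V W \<Longrightarrow> \<not> perp W U \<Longrightarrow>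
      D W (\<rho> U W) (\<rho> V W) \<le> k"
    and bounded_geodesic_image: "V \<in> I \<Longrightarrow> W \<in> I \<Longrightarrow> snest V W \<Longrightarrow>
      geodesic_between (C W) (D W) p q P \<Longrightarrow> (\<And>z. z \<in> P \<Longrightarrow> k < D W z (\<rho> V W)) \<Longrightarrow>
      D V (\<sigma> W V p) (\<sigma> W V q) \<le> k"
    and partial_realization: "F \<subseteq> I \<Longrightarrow> pairwise perp F \<Longrightarrow> (\<And>U. U \<in> F \<Longrightarrow> f U \<in> X) \<Longrightarrow>
      \<exists>x\<in>X. \<forall>U\<in>F. D U (\<pi> U x) (\<pi> U (f U)) \<le> k \<and>
        (\<forall>V\<in>I. trv V U \<or> snest U V \<longrightarrow> D V (\<pi> V x) (\<rho> U V) \<le> k)"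
    and chain_bound: "A \<subseteq> I \<Longrightarrow> (\<And>V W. V \<in> A \<Longrightarrow> W \<in> A \<Longrightarrow> nest V W \<or> nest W V) \<Longrightarrow>
      finite A \<and> card A \<le> n"
    and maximal: "I \<noteq> {} \<Longrightarrow> \<exists>M\<in>I. \<forall>W\<in>I. (\<forall>V\<in>I. nest W V \<longrightarrow> V = W) \<longrightarrow> W = M"
    and container: "T \<in> I \<Longrightarrow> U \<in> I \<Longrightarrow> nest U T \<Longrightarrow> \<exists>V\<in>I. nest V T \<and> perp V U \<Longrightarrow>
      \<exists>W\<in>I. snest W T \<and> (\<forall>V\<in>I. nest V T \<and> perp V U \<longrightarrow> nest V W)"
begin

lemma metric: "W \<in> I \<Longrightarrow> Metric_space (C W) (D W)"
  using geodesic by (simp add: geodesic_space_def)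

lemma D_triangle:
  "W \<in> I \<Longrightarrow> p \<in> C W \<Longrightarrow> q \<in> C W \<Longrightarrow> r \<in> C W \<Longrightarrow> D W p r \<le> D W p q + D W q r"
  using metric Metric_space.triangle by fastforce

lemma D_commute: "W \<in> I \<Longrightarrow> D W p q = D W q p"
  using metric Metric_space.commute by fastforce

lemma D_nonneg: "W \<in> I \<Longrightarrow> 0 \<le> D W p q"
  using metric Metric_space.nonneg by fastforce

lemma D_self: "W \<in> I \<Longrightarrow> p \<in> C W \<Longrightarrow> D W p p = 0"
  using metric Metric_space.mdist_zero by fastforce

lemma trv_sym: "V \<in> I \<Longrightarrow> W \<in> I \<Longrightarrow> trv V W \<Longrightarrow> trv W V"
  unfolding trv_def using perp_sym by blast

text \<open>Every point of a geodesic from \<open>p\<close> to \<open>q\<close> is within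
  \<open>D W p q\<close> of \<open>p\<close>. The geodesic therefore stays more than
  \<open>k\<close> away from \<open>\<rho> V W\<close>, and the bounded geodesic image property
  applies.\<close>

lemma \<sigma>_close:
  assumes "V \<in> I" "W \<in> I" "snest V W" "p \<in> C W" "q \<in> C W"
    and "D W p (\<rho> V W) > k + D W p q"
  shows "D V (\<sigma> W V p) (\<sigma> W V q) \<le> k"
proof -
  obtain P where P: "geodesic_between (C W) (D W) p q P"
    using geodesic assms(2,4,5) unfolding geodesic_space_def by blast
  have \<rho>: "\<rho> V W \<in> C W" using \<rho>_in assms by blast
  have "k < D W z (\<rho> V W)" if z: "z \<in> P" for z
  proof -
    obtain \<gamma> L where \<gamma>: "0 \<le> L" "\<gamma> 0 = p" "\<gamma> L = q" "\<gamma> ` {0..L} = P" "P \<subseteq> C W"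
      "\<forall>s\<in>{0..L}. \<forall>t\<in>{0..L}. D W (\<gamma> s) (\<gamma> t) = \<bar>s - t\<bar>"
      using P unfolding geodesic_between_def by blast
    obtain t where t: "t \<in> {0..L}" "z = \<gamma> t" using z \<gamma>(4) by blast
    have "D W p q = L" using \<gamma>(6)[rule_format, of 0 L] \<gamma>(1-3) by simp
    moreover have "D W p z = t" using \<gamma>(6)[rule_format, of 0 t] \<gamma>(1-3) t by simp
    ultimately have "D W p z \<le> D W p q" using t by simp
    moreover have "D W p (\<rho> V W) \<le> D W p z + D W z (\<rho> V W)"
      using D_triangle[OF assms(2,4) _ \<rho>] z \<gamma>(5) by blast
    ultimately show ?thesis using assms(6) by linarith
  qed
  then show ?thesis using bounded_geodesic_image[OF assms(1-3) P] by blast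
qed

text \<open>The length of a longest chain above \<open>W\<close>, with \<open>W\<close> included. It
  is 1 at the top and grows strictly under proper nesting, unlike the usual level, which is counted
  from below.\<close>

definition depth :: "'i \<Rightarrow> nat" where
  "depth W = Max {card A | A. A \<subseteq> I \<and> (\<forall>U\<in>A. \<forall>V\<in>A. nest U V \<or> nest V U) \<and> (\<forall>V\<in>A. nest W V)}"

lemma depth_finite:
  "finite {card A | A. A \<subseteq> I \<and> (\<forall>U\<in>A. \<forall>V\<in>A. nest U V \<or> nest V U) \<and> (\<forall>V\<in>A. nest W V)}"
  (is "finite ?S")
proof (rule finite_subset)
  show "?S \<subseteq> {..n}" using chain_bound by blast
qed simp

lemma depth_le: "depth W \<le> n"
proof -
  have "{card A | A. A \<subseteq> I \<and> (\<forall>U\<in>A. \<forall>V\<in>A. nest U V \<or> nest V U) \<and> (\<forall>V\<in>A. nest W V)} \<noteq> {}"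
    by (auto intro!: exI[of _ "{}"])
  then have "depth W \<in> {card A | A. A \<subseteq> I \<and> (\<forall>U\<in>A. \<forall>V\<in>A. nest U V \<or> nest V U) \<and> (\<forall>V\<in>A. nest W V)}"
    unfolding depth_def by (rule Max_in[OF depth_finite])
  then obtain A where "A \<subseteq> I" "\<forall>U\<in>A. \<forall>V\<in>A. nest U V \<or> nest V U" "depth W = card A"
    by blast
  then show ?thesis using chain_bound[of A] by simp
qed

lemma depth_ge:
  assumes "A \<subseteq> I" "\<And>U V. U \<in> A \<Longrightarrow> V \<in> A \<Longrightarrow> nest U V \<or> nest V U" "\<And>V. V \<in> A \<Longrightarrow> nest W V"
  shows "card A \<le> depth W"
  unfolding depth_def by (rule Max_ge[OF depth_finite]) (use assms in blast)

lemma depth_pos: "W \<in> I \<Longrightarrow> 1 \<le> depth W"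
  using depth_ge[of "{W}" W] nest_refl by auto

lemma depth_snest:
  assumes "U \<in> I" "W \<in> I" "snest U W"
  shows "depth W + 1 \<le> depth U"
proof -
  have "{card A | A. A \<subseteq> I \<and> (\<forall>U\<in>A. \<forall>V\<in>A. nest U V \<or> nest V U) \<and> (\<forall>V\<in>A. nest W V)} \<noteq> {}"
    by (auto intro!: exI[of _ "{}"])
  then have "depth W \<in> {card A | A. A \<subseteq> I \<and> (\<forall>U\<in>A. \<forall>V\<in>A. nest U V \<or> nest V U) \<and> (\<forall>V\<in>A. nest W V)}"
    unfolding depth_def by (rule Max_in[OF depth_finite])
  then obtain A where A: "A \<subseteq> I" "\<forall>U\<in>A. \<forall>V\<in>A. nest U V \<or> nest V U" "\<forall>V\<in>A. nest W V"
    "depth W = card A" by blast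
  have fin: "finite A" using chain_bound A by blast
  have "U \<notin> A" using A assms nest_antisym unfolding snest_def by blast
  have UV: "nest U V" if "V \<in> A" for V
    using that A nest_trans[OF assms(1,2)] assms(3) unfolding snest_def by blast
  have "card (insert U A) \<le> depth U"
    using A assms(1) UV nest_refl by (intro depth_ge) auto
  then show ?thesis using fin \<open>U \<notin> A\<close> A(4) by simp
qed

text \<open>A unique maximal element need not lie above everything in a general partial order. Here
  it does, because depths are bounded below: an element of least depth among those containing
  \<open>V\<close> is maximal.\<close>

lemma top_element:
  assumes "I \<noteq> {}"
  shows "\<exists>T\<in>I. \<forall>V\<in>I. nest V T"
proof -
  obtain M where M: "M \<in> I" "\<forall>W\<in>I. (\<forall>V\<in>I. nest W V \<longrightarrow> V = W) \<longrightarrow> W = M"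
    using maximal[OF assms] by blast
  have "nest V M" if V: "V \<in> I" for V
  proof -
    have "V \<in> I \<and> nest V V" using V nest_refl by blast
    from ex_has_least_nat[of "\<lambda>U. U \<in> I \<and> nest V U" V depth, OF this]
    obtain U where U: "U \<in> I" "nest V U" "\<And>Y. Y \<in> I \<Longrightarrow> nest V Y \<Longrightarrow> depth U \<le> depth Y"
      by blast
    have "Y = U" if Y: "Y \<in> I" "nest U Y" for Y
    proof (rule ccontr)
      assume "Y \<noteq> U"
      then have "snest U Y" using Y(2) unfolding snest_def by simp
      then have "depth Y + 1 \<le> depth U" using depth_snest U(1) Y(1) by blast
      moreover have "depth U \<le> depth Y"
        using U(3)[OF Y(1) nest_trans[OF V U(1) Y(1) U(2) Y(2)]] .
      ultimately show False by simp
    qed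
    then have "U = M" using M(2) U(1) by blast
    then show ?thesis using U(2) by simp
  qed
  then show ?thesis using M(1) by blast
qed

text \<open>Remove one member \<open>U\<close>. The others are orthogonal to it and hence nested in
  a container \<open>W\<close> strictly below \<open>T\<close>. By induction they give a chain below
  \<open>W\<close>, which \<open>T\<close> lengthens by one.\<close>

lemma perp_chain:
  assumes "finite F" "F \<noteq> {}" "T \<in> I" "F \<subseteq> I" "pairwise perp F" "\<And>V. V \<in> F \<Longrightarrow> nest V T"
  shows "\<exists>A\<subseteq>I. T \<in> A \<and> finite A \<and> card A = card F \<and> (\<forall>V\<in>A. nest V T) \<and>
    (\<forall>U\<in>A. \<forall>V\<in>A. nest U V \<or> nest V U)"
  using assms
proof (induction F arbitrary: T rule: finite_ne_induct)
  case (singleton U)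
  then show ?case using nest_refl[OF \<open>T \<in> I\<close>] by (intro exI[of _ "{T}"]) auto
next
  case (insert U F)
  have I: "U \<in> I" "F \<subseteq> I" using insert.prems by auto
  have p: "perp V U" if "V \<in> F" for V
    using pairwiseD[OF insert.prems(3), of V U] that insert.hyps by auto
  have ex: "\<exists>V\<in>I. nest V T \<and> perp V U"
    using insert.hyps(2) p I insert.prems(4) by blast
  obtain W where W: "W \<in> I" "snest W T" "\<forall>V\<in>I. nest V T \<and> perp V U \<longrightarrow> nest V W"
    using container[OF insert.prems(1) I(1) _ ex] insert.prems(4) by blast
  have "nest V W" if "V \<in> F" for V
    using W(3) that p I(2) insert.prems(4) by blast
  moreover have "pairwise perp F" using insert.prems(3) by (simp add: pairwise_insert)
  ultimately obtain A where A: "A \<subseteq> I" "W \<in> A" "finite A" "card A = card F"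
    "\<forall>V\<in>A. nest V W" "\<forall>U\<in>A. \<forall>V\<in>A. nest U V \<or> nest V U"
    using insert.IH[OF W(1) I(2)] by blast
  have AT: "nest V T" if "V \<in> A" for V
    using that A(1,5) W insert.prems(1) nest_trans[of V W T] unfolding snest_def by blast
  have "T \<notin> A"
    using A(5) W nest_antisym[OF W(1) insert.prems(1)] unfolding snest_def by blast
  then have "card (insert T A) = card (insert U F)" using A insert.hyps by simp
  then show ?case
    using A AT insert.prems(1) nest_refl[OF insert.prems(1)]
    by (intro exI[of _ "insert T A"]) auto
qed

lemma perp_bound:
  assumes "F \<subseteq> I" "finite F" "pairwise perp F"
  shows "card F \<le> n"
proof (cases "F = {}")
  case False
  then obtain T where T: "T \<in> I" "\<forall>V\<in>I. nest V T" using top_element assms(1) by blast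
  then obtain A where A: "A \<subseteq> I" "card A = card F" "\<forall>U\<in>A. \<forall>V\<in>A. nest U V \<or> nest V U"
    using perp_chain[OF assms(2) False T(1) assms(1,3)] assms(1) by blast
  then show ?thesis using chain_bound[of A] by simp
qed simp

text \<open>\<open>R\<close> stands for being relevant to a pair of points. By large links the
  relevant indices properly below \<open>W\<close> lie under finitely many smaller indices. The
  recursion into these ends because their depth is larger and at most \<open>n\<close>.\<close>

lemma finite_below:
  assumes links: "\<And>W. W \<in> I \<Longrightarrow> \<exists>\<T>. finite \<T> \<and> (\<forall>V\<in>\<T>. V \<in> I \<and> snest V W) \<and>
      (\<forall>V\<in>I. snest V W \<and> R V \<longrightarrow> (\<exists>U\<in>\<T>. nest V U))"
    and "W \<in> I"
  shows "finite {V \<in> I. nest V W \<and> R V}"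
  using assms(2)
proof (induction "n - depth W" arbitrary: W rule: less_induct)
  case less
  obtain \<T> where \<T>: "finite \<T>" "\<forall>V\<in>\<T>. V \<in> I \<and> snest V W"
    "\<forall>V\<in>I. snest V W \<and> R V \<longrightarrow> (\<exists>U\<in>\<T>. nest V U)"
    using links[OF less.prems] by blast
  have "finite {V \<in> I. nest V U \<and> R V}" if U: "U \<in> \<T>" for U
  proof (rule less.hyps)
    show "U \<in> I" using U \<T>(2) by blast
    have "depth W + 1 \<le> depth U" using depth_snest[of U W] U \<T>(2) less.prems by blast
    then show "n - depth U < n - depth W" using depth_le[of U] by linarith
  qed
  then have "finite (insert W (\<Union>U\<in>\<T>. {V \<in> I. nest V U \<and> R V}))" using \<T>(1) by blast
  moreover have "{V \<in> I. nest V W \<and> R V} \<subseteq> insert W (\<Union>U\<in>\<T>. {V \<in> I. nest V U \<and> R V})"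
    using \<T>(3) unfolding snest_def by blast
  ultimately show ?case by (rule rev_finite_subset)
qed

lemma finite_relevant:
  assumes "\<And>W. W \<in> I \<Longrightarrow> \<exists>\<T>. finite \<T> \<and> (\<forall>V\<in>\<T>. V \<in> I \<and> snest V W) \<and>
      (\<forall>V\<in>I. snest V W \<and> R V \<longrightarrow> (\<exists>U\<in>\<T>. nest V U))"
  shows "finite {V \<in> I. R V}"
proof (cases "I = {}")
  case False
  then obtain T where "T \<in> I" "\<forall>V\<in>I. nest V T" using top_element by blast
  then have "{V \<in> I. R V} \<subseteq> {V \<in> I. nest V T \<and> R V}" by blast
  then show ?thesis using finite_below[OF assms \<open>T \<in> I\<close>] by (rule finite_subset)
qed simp

end

text \<open>The assumption \<open>b_near\<close> makes partial realization applicable to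
  \<open>b\<close>, as that property only concerns coordinates of actual points. With
  \<open>finite_far\<close> a last far index can be chosen.\<close>

locale consistent_tuple = point_hhs +
  fixes b :: "'a \<Rightarrow> 'c" and c :: real
  assumes c: "k \<le> c" "1 \<le> c"
    and b_in: "W \<in> I \<Longrightarrow> b W \<in> C W"
    and b_trv: "V \<in> I \<Longrightarrow> W \<in> I \<Longrightarrow> trv V W \<Longrightarrow> D W (b W) (\<rho> V W) \<le> c \<or> D V (b V) (\<rho> W V) \<le> c"
    and b_snest: "V \<in> I \<Longrightarrow> W \<in> I \<Longrightarrow> snest V W \<Longrightarrow>
      D W (b W) (\<rho> V W) \<le> c \<or> D V (b V) (\<sigma> W V (b W)) \<le> c"
    and b_near: "W \<in> I \<Longrightarrow> \<exists>x\<in>X. D W (\<pi> W x) (b W) \<le> c"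
    and finite_far: "x \<in> X \<Longrightarrow> finite {W \<in> I. c < D W (\<pi> W x) (b W)}"
begin

text \<open>Realizing \<open>b\<close> at a terminal \<open>U\<close> takes care of all indices
  transverse to or properly containing \<open>U\<close> at once: there the point is near
  \<open>\<rho> U V\<close>, hence near \<open>b V\<close>.\<close>

definition terminal :: "real \<Rightarrow> 'a \<Rightarrow> bool" where
  "terminal e U \<longleftrightarrow> (\<forall>V\<in>I. trv V U \<or> snest U V \<longrightarrow> D V (b V) (\<rho> U V) \<le> e)"

lemma terminal_mono: "terminal e U \<Longrightarrow> e \<le> e' \<Longrightarrow> terminal e' U"
  unfolding terminal_def by force

section \<open>The order in which transverse indices are passed between a point and the
  tuple\<close>

context
  fixes x and \<theta> :: real
  assumes x: "x \<in> X" and \<theta>: "20 * c \<le> \<theta>"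
begin

abbreviation (input) "far W \<equiv> W \<in> I \<and> \<theta> < D W (\<pi> W x) (b W)"

text \<open>The last hypothesis expresses that \<open>U\<close> is passed before \<open>V\<close>.
  The conclusions give the picture: at \<open>V\<close> the point \<open>x\<close> still sits at
  \<open>\<rho> U V\<close>, while at \<open>U\<close> the tuple has already reached
  \<open>\<rho> V U\<close>. The first is consistency of the tuple; the second is consistency of
  \<open>x\<close>, which is far from the tuple at \<open>U\<close>.\<close>

lemma far_order:
  assumes "far U" "far V" "trv U V" "5 * c < D V (b V) (\<rho> U V)"
  shows "D U (b U) (\<rho> V U) \<le> c" "D V (\<pi> V x) (\<rho> U V) \<le> c"
proof -
  have I: "U \<in> I" "V \<in> I" using assms by auto
  show 1: "D U (b U) (\<rho> V U) \<le> c"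
    using b_trv[OF I assms(3)] assms(4) c by linarith
  have "D U (\<pi> U x) (b U) \<le> D U (\<pi> U x) (\<rho> V U) + D U (\<rho> V U) (b U)"
    using D_triangle[OF I(1) \<pi>_in[OF I(1) x] \<rho>_in b_in] I assms(3) trv_sym by blast
  then have "k < D U (\<pi> U x) (\<rho> V U)"
    using 1 assms(1) c \<theta> D_commute[OF I(1), of "\<rho> V U" "b U"] by linarith
  then show "D V (\<pi> V x) (\<rho> U V) \<le> c"
    using consistent_trv[OF I assms(3) x] c by linarith
qed

text \<open>In \<open>C V\<close> the points \<open>\<rho> U V\<close> and \<open>\<rho> W V\<close>
  are far apart, being near \<open>x\<close> and near the tuple respectively. A point
  \<open>z\<close> realized at \<open>U\<close> is near \<open>\<rho> U V\<close>, so consistency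
  for \<open>V\<close> and \<open>W\<close> puts it near \<open>\<rho> V W\<close> in
  \<open>C W\<close>. Hence \<open>\<rho> U W\<close> is near \<open>\<rho> V W\<close>, which is
  near \<open>x\<close> and thus far from \<open>b W\<close>.\<close>

lemma far_order_trans:
  assumes far: "far U" "far V" "far W"
    and UV: "trv U V" "5 * c < D V (b V) (\<rho> U V)"
    and VW: "trv V W" "5 * c < D W (b W) (\<rho> V W)"
    and incomparable: "nest U W \<Longrightarrow> U = W" "nest W U \<Longrightarrow> U = W"
  shows "trv U W \<and> 5 * c < D W (b W) (\<rho> U W)"
proof -
  have I: "U \<in> I" "V \<in> I" "W \<in> I" using far by auto
  have t: "trv V U" "trv W V" using UV VW trv_sym I by auto
  note \<rho> = \<rho>_in[OF I(1,2) disjI1[OF UV(1)]] \<rho>_in[OF I(2,1) disjI1[OF t(1)]]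
    \<rho>_in[OF I(2,3) disjI1[OF VW(1)]] \<rho>_in[OF I(3,2) disjI1[OF t(2)]]
  note f1 = far_order[OF far(1,2) UV] and f2 = far_order[OF far(2,3) VW]
  have "D V (\<pi> V x) (b V) \<le> D V (\<pi> V x) (\<rho> U V) + D V (\<rho> U V) (b V)"
    by (rule D_triangle[OF I(2) \<pi>_in[OF I(2) x] \<rho>(1) b_in[OF I(2)]])
  moreover have "D V (\<rho> U V) (b V) \<le> D V (\<rho> U V) (\<rho> W V) + D V (\<rho> W V) (b V)"
    by (rule D_triangle[OF I(2) \<rho>(1,4) b_in[OF I(2)]])
  ultimately have sep: "\<theta> - 2 * c < D V (\<rho> U V) (\<rho> W V)"
    using f1 f2 far(2) D_commute[OF I(2), of "\<rho> W V" "b V"] by linarith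
  \<comment> \<open>That equality is refuted here, and not assumed away, lets transitivity yield
    asymmetry of the order later.\<close>
  then have "U \<noteq> W" using D_self[OF I(2) \<rho>(1)] c \<theta> by auto
  have "\<not> perp U W"
  proof
    assume p: "perp U W"
    \<comment> \<open>A point realized at both \<open>U\<close> and \<open>W\<close> would be near
      both \<open>\<rho> U V\<close> and \<open>\<rho> W V\<close>, which \<open>sep\<close> keeps
      apart.\<close>
    have "\<exists>z\<in>X. \<forall>A\<in>{U, W}. D A (\<pi> A z) (\<pi> A x) \<le> k \<and>
        (\<forall>B\<in>I. trv B A \<or> snest A B \<longrightarrow> D B (\<pi> B z) (\<rho> A B) \<le> k)"
    proof (rule partial_realization)
      show "pairwise perp {U, W}" using p perp_sym[OF I(1,3) p] by (simp add: pairwise_insert)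
    qed (use I x in simp_all)
    then obtain z where z: "z \<in> X" "D V (\<pi> V z) (\<rho> U V) \<le> k" "D V (\<pi> V z) (\<rho> W V) \<le> k"
      using I UV(1) VW(1) t by blast
    have "D V (\<rho> U V) (\<rho> W V) \<le> D V (\<rho> U V) (\<pi> V z) + D V (\<pi> V z) (\<rho> W V)"
      by (rule D_triangle[OF I(2) \<rho>(1) \<pi>_in[OF I(2) z(1)] \<rho>(4)])
    then show False
      using sep z c \<theta> D_commute[OF I(2), of "\<rho> U V" "\<pi> V z"] by linarith
  qed
  then have UW: "trv U W" using incomparable \<open>U \<noteq> W\<close> unfolding trv_def by blast
  note \<rho>UW = \<rho>_in[OF I(1,3) disjI1[OF UW]]
  have "\<exists>z\<in>X. \<forall>A\<in>{U}. D A (\<pi> A z) (\<pi> A x) \<le> k \<and>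
      (\<forall>B\<in>I. trv B A \<or> snest A B \<longrightarrow> D B (\<pi> B z) (\<rho> A B) \<le> k)"
    using partial_realization[of "{U}" "\<lambda>_. x"] I x by (auto simp: pairwise_def)
  then obtain z where z: "z \<in> X" "D V (\<pi> V z) (\<rho> U V) \<le> k" "D W (\<pi> W z) (\<rho> U W) \<le> k"
    using I t trv_sym[OF I(1,3) UW] by blast
  have "D V (\<rho> U V) (\<rho> W V) \<le> D V (\<rho> U V) (\<pi> V z) + D V (\<pi> V z) (\<rho> W V)"
    by (rule D_triangle[OF I(2) \<rho>(1) \<pi>_in[OF I(2) z(1)] \<rho>(4)])
  then have "k < D V (\<pi> V z) (\<rho> W V)"
    using sep z c \<theta> D_commute[OF I(2), of "\<rho> U V" "\<pi> V z"] by linarith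
  then have zW: "D W (\<pi> W z) (\<rho> V W) \<le> k"
    using consistent_trv[OF I(2,3) VW(1) z(1)] by linarith
  have "D W (\<pi> W x) (\<rho> U W) \<le> D W (\<pi> W x) (\<pi> W z) + D W (\<pi> W z) (\<rho> U W)"
    by (rule D_triangle[OF I(3) \<pi>_in[OF I(3) x] \<pi>_in[OF I(3) z(1)] \<rho>UW])
  moreover have "D W (\<pi> W x) (\<pi> W z) \<le> D W (\<pi> W x) (\<rho> V W) + D W (\<rho> V W) (\<pi> W z)"
    by (rule D_triangle[OF I(3) \<pi>_in[OF I(3) x] \<rho>(3) \<pi>_in[OF I(3) z(1)]])
  moreover have "D W (\<pi> W x) (b W) \<le> D W (\<pi> W x) (\<rho> U W) + D W (\<rho> U W) (b W)"
    by (rule D_triangle[OF I(3) \<pi>_in[OF I(3) x] \<rho>UW b_in[OF I(3)]])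
  ultimately have "5 * c < D W (b W) (\<rho> U W)"
    using f2 z zW far(3) c \<theta> D_commute[OF I(3), of "\<rho> V W" "\<pi> W z"] D_commute[OF I(3), of "\<rho> U W" "b W"]
    by linarith
  then show ?thesis using UW by blast
qed

text \<open>The last index \<open>U\<close> among the maximal far ones is terminal: if
  \<open>\<rho> U V\<close> were far from \<open>b V\<close>, consistency would bring
  \<open>x\<close> near the tuple at \<open>U\<close>. For an index \<open>V\<close> above
  \<open>U\<close>, maximality ensures that \<open>x\<close> is not far at \<open>V\<close>. For a
  far transverse \<open>V\<close>, the order is available only between maximal indices, so
  \<open>V\<close> is replaced by a maximal one above it.\<close>

lemma far_terminal:
  assumes "far W"
  shows "\<exists>U. far U \<and> terminal (\<theta> + 2 * c) U"
proof -
  define B where "B = {W. far W}"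
  have "B \<subseteq> {W \<in> I. c < D W (\<pi> W x) (b W)}" using \<theta> c by (auto simp: B_def)
  then have fin: "finite B" using finite_far[OF x] finite_subset by blast
  define M where "M = {U \<in> B. \<forall>V\<in>B. nest U V \<longrightarrow> U = V}"
  have M: "\<exists>U\<in>M. nest V U" if V: "V \<in> B" for V
  proof -
    let ?A = "{U \<in> B. nest V U}"
    have VI: "V \<in> I" using V by (simp add: B_def)
    have "asymp_on ?A snest"
      by (rule asymp_onI) (auto simp: snest_def B_def dest: nest_antisym)
    moreover have "transp_on ?A snest"
    proof (rule transp_onI)
      fix p q r assume "p \<in> ?A" "q \<in> ?A" "r \<in> ?A" and pq: "snest p q" and qr: "snest q r"
      then have "p \<in> I" "q \<in> I" "r \<in> I" by (auto simp: B_def)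
      then show "snest p r"
        using pq qr nest_trans nest_antisym unfolding snest_def by blast
    qed
    moreover have "finite ?A" "?A \<noteq> {}" using fin V nest_refl[OF VI] by auto
    ultimately obtain U where U: "U \<in> ?A" "\<forall>y\<in>?A. y \<noteq> U \<longrightarrow> \<not> snest U y"
      using Finite_Set.bex_max_element[of ?A snest] by blast
    have "U = Y" if "Y \<in> B" "nest U Y" for Y
    proof -
      have "nest V Y" using U that VI nest_trans[of V U Y] by (auto simp: B_def)
      then have "Y \<in> ?A" using that by blast
      then show ?thesis using U(2) that(2) unfolding snest_def by metis
    qed
    then show ?thesis using U(1) unfolding M_def by blast
  qed
  have Mmax: "U = V" if "U \<in> M" "V \<in> M" "nest U V" for U V
    using that by (simp add: M_def)
  define lt where "lt U V \<longleftrightarrow> trv U V \<and> 5 * c < D V (b V) (\<rho> U V)" for U V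
  have trans: "lt U W" if "U \<in> M" "V \<in> M" "W \<in> M" "lt U V" "lt V W" for U V W
  proof -
    have "far U" "far V" "far W" using that(1-3) by (auto simp: M_def B_def)
    moreover have "nest U W \<Longrightarrow> U = W" "nest W U \<Longrightarrow> U = W"
      using Mmax[OF that(1,3)] Mmax[OF that(3,1)] by auto
    ultimately show ?thesis
      using far_order_trans[of U V W] that(4,5) unfolding lt_def by blast
  qed
  have "transp_on M lt" using trans by (intro transp_onI) blast
  moreover have "asymp_on M lt"
  proof (rule asymp_onI)
    fix U V assume "U \<in> M" "V \<in> M" "lt U V"
    \<comment> \<open>A cycle would make \<open>U\<close> precede itself, and thus be transverse to
      itself, against reflexivity of nesting.\<close>
    then show "\<not> lt V U"
      using trans[of U V U] nest_refl[of U] unfolding lt_def trv_def M_def B_def by blast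
  qed
  moreover have "finite M" using fin by (simp add: M_def)
  moreover have "M \<noteq> {}" using M[of W] assms by (auto simp: B_def)
  ultimately obtain U where U: "U \<in> M" "\<forall>V\<in>M. V \<noteq> U \<longrightarrow> \<not> lt U V"
    using Finite_Set.bex_max_element[of M lt] by blast
  have far: "far U" "U \<in> I" using U(1) unfolding M_def B_def by auto
  have "D V (b V) (\<rho> U V) \<le> \<theta> + 2 * c" if V: "V \<in> I" and "trv V U \<or> snest U V" for V
    using that(2)
  proof
    assume t: "trv V U"
    have t': "trv U V" using trv_sym t V far by blast
    note \<rho> = \<rho>_in[OF V far(2) disjI1[OF t]] \<rho>_in[OF far(2) V disjI1[OF t']]
    show ?thesis
    proof (rule ccontr)
      assume not: "\<not> ?thesis"
      then have bU: "D U (b U) (\<rho> V U) \<le> c"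
        using b_trv[OF V far(2) t] c \<theta> by linarith
      have xU: "D U (\<pi> U x) (b U) \<le> D U (\<pi> U x) (\<rho> V U) + D U (\<rho> V U) (b U)"
        by (rule D_triangle[OF far(2) \<pi>_in[OF far(2) x] \<rho>(1) b_in[OF far(2)]])
      have xU': "5 * c < D U (\<pi> U x) (\<rho> V U)"
        using xU bU far(1) c \<theta> D_commute[OF far(2), of "\<rho> V U" "b U"] by linarith
      show False
      proof (cases "far V")
        \<comment> \<open>Here \<open>x\<close> is within \<theta> of the tuple at \<open>V\<close>,
          so \<open>\<rho> U V\<close> is far from \<open>x\<close> as well. Consistency puts
          \<open>x\<close> near \<open>\<rho> V U\<close>, where the tuple is too.\<close>
        case False
        have "D V (b V) (\<rho> U V) \<le> D V (b V) (\<pi> V x) + D V (\<pi> V x) (\<rho> U V)"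
          by (rule D_triangle[OF V b_in[OF V] \<pi>_in[OF V x] \<rho>(2)])
        then have "k < D V (\<pi> V x) (\<rho> U V)"
          using not False V c D_commute[OF V, of "b V" "\<pi> V x"] by auto
        then have "D U (\<pi> U x) (\<rho> V U) \<le> k"
          using consistent_trv[OF V far(2) t x] by linarith
        then show False using xU' c by linarith
      next
        case True
        \<comment> \<open>Since \<open>U\<close> is last, \<open>\<rho> U V'\<close> is near
          \<open>b V'\<close> and hence far from \<open>x\<close>, which puts \<open>x\<close> near
          \<open>\<rho> V' U\<close>. The coherence of \<open>\<rho>\<close> under nesting moves
          this to \<open>\<rho> V U\<close>, again near the tuple.\<close>
        then obtain V' where V': "V' \<in> M" "nest V V'" using M unfolding B_def by blast
        then have V'I: "V' \<in> I" "far V'" unfolding M_def B_def by auto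
        have "V' \<noteq> U" using V'(2) t unfolding trv_def by blast
        have "\<not> nest V' U" "\<not> nest U V'"
          using Mmax[OF V'(1) U(1)] Mmax[OF U(1) V'(1)] \<open>V' \<noteq> U\<close> by auto
        moreover have "\<not> perp V' U"
          using perp_nest[OF far(2) V V'I(1) V'(2)] t unfolding trv_def by blast
        ultimately have t2: "trv V' U" unfolding trv_def by blast
        then have t3: "trv U V'" using trv_sym V'I far by blast
        note \<rho>' = \<rho>_in[OF V'I(1) far(2) disjI1[OF t2]] \<rho>_in[OF far(2) V'I(1) disjI1[OF t3]]
        have "D V' (b V') (\<rho> U V') \<le> 5 * c"
          using U(2) V'(1) \<open>V' \<noteq> U\<close> t3 unfolding lt_def by force
        moreover have "D V' (\<pi> V' x) (b V') \<le> D V' (\<pi> V' x) (\<rho> U V') + D V' (\<rho> U V') (b V')"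
          by (rule D_triangle[OF V'I(1) \<pi>_in[OF V'I(1) x] \<rho>'(2) b_in[OF V'I(1)]])
        ultimately have "k < D V' (\<pi> V' x) (\<rho> U V')"
          using V'I(2) c \<theta> D_commute[OF V'I(1), of "\<rho> U V'" "b V'"] by auto
        then have "D U (\<pi> U x) (\<rho> V' U) \<le> k"
          using consistent_trv[OF V'I(1) far(2) t2 x] by linarith
        moreover have "\<not> perp U V" using t' unfolding trv_def by blast
        then have "D U (\<rho> V U) (\<rho> V' U) \<le> k"
          using consistent_\<rho>[OF V V'I(1) far(2) V'(2) t2] by blast
        moreover have "D U (\<pi> U x) (\<rho> V U) \<le> D U (\<pi> U x) (\<rho> V' U) + D U (\<rho> V' U) (\<rho> V U)"
          by (rule D_triangle[OF far(2) \<pi>_in[OF far(2) x] \<rho>'(1) \<rho>(1)])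
        ultimately show False
          using xU' c D_commute[OF far(2), of "\<rho> V' U" "\<rho> V U"] by linarith
      qed
    qed
  next
    assume s: "snest U V"
    then have notfar: "D V (\<pi> V x) (b V) \<le> \<theta>"
      using U(1) V unfolding snest_def M_def B_def by force
    note \<rho> = \<rho>_in[OF far(2) V disjI2[OF s]]
    note \<sigma> = \<sigma>_in[OF far(2) V s]
    show ?thesis
    proof (rule ccontr)
      assume not: "\<not> ?thesis"
      \<comment> \<open>A geodesic from \<open>b V\<close> to the projection of \<open>x\<close>
        then misses \<open>\<rho> U V\<close>, so its ends have close images in \<open>C U\<close>.
        By consistency one image is near \<open>b U\<close> and the other near the projection of
        \<open>x\<close>, although \<open>x\<close> is far at \<open>U\<close>.\<close>
      have "k + D V (b V) (\<pi> V x) < D V (b V) (\<rho> U V)"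
        using not notfar c D_commute[OF V, of "b V" "\<pi> V x"] by linarith
      then have 1: "D U (\<sigma> V U (b V)) (\<sigma> V U (\<pi> V x)) \<le> k"
        by (rule \<sigma>_close[OF far(2) V s b_in[OF V] \<pi>_in[OF V x]])
      have "D V (b V) (\<rho> U V) \<le> D V (b V) (\<pi> V x) + D V (\<pi> V x) (\<rho> U V)"
        by (rule D_triangle[OF V b_in[OF V] \<pi>_in[OF V x] \<rho>])
      then have "k < D V (\<pi> V x) (\<rho> U V)"
        using not notfar c D_commute[OF V, of "b V" "\<pi> V x"] by linarith
      then have 2: "D U (\<pi> U x) (\<sigma> V U (\<pi> V x)) \<le> k"
        using consistent_snest[OF far(2) V s x] by linarith
      have 3: "D U (b U) (\<sigma> V U (b V)) \<le> c"
        using b_snest[OF far(2) V s] not c \<theta> by linarith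
      have "D U (\<pi> U x) (b U) \<le> D U (\<pi> U x) (\<sigma> V U (\<pi> V x)) + D U (\<sigma> V U (\<pi> V x)) (b U)"
        by (rule D_triangle[OF far(2) \<pi>_in[OF far(2) x] \<sigma>[OF \<pi>_in[OF V x]] b_in[OF far(2)]])
      moreover have "D U (\<sigma> V U (\<pi> V x)) (b U) \<le>
          D U (\<sigma> V U (\<pi> V x)) (\<sigma> V U (b V)) + D U (\<sigma> V U (b V)) (b U)"
        by (rule D_triangle[OF far(2) \<sigma>[OF \<pi>_in[OF V x]] \<sigma>[OF b_in[OF V]] b_in[OF far(2)]])
      ultimately show False
        using 1 2 3 far(1) c \<theta> D_commute[OF far(2), of "\<sigma> V U (\<pi> V x)" "\<sigma> V U (b V)"]
          D_commute[OF far(2), of "\<sigma> V U (b V)" "b U"] by linarith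
    qed
  qed
  then show ?thesis using far unfolding terminal_def by blast
qed

end

section \<open>Refinement of pairwise orthogonal families\<close>

lemma realize_family:
  assumes "F \<subseteq> I" "pairwise perp F"
  shows "\<exists>x\<in>X. \<forall>U\<in>F. D U (\<pi> U x) (b U) \<le> 2 * c \<and>
    (\<forall>V\<in>I. trv V U \<or> snest U V \<longrightarrow> D V (\<pi> V x) (\<rho> U V) \<le> c)"
proof -
  \<comment> \<open>The coordinates of \<open>b\<close> need not be projections of points, so nearby
    projections are realized instead; this accounts for \<open>2 * c\<close>.\<close>
  obtain p where p: "\<And>U. U \<in> I \<Longrightarrow> p U \<in> X \<and> D U (\<pi> U (p U)) (b U) \<le> c"
    using b_near by metis
  have "\<And>U. U \<in> F \<Longrightarrow> p U \<in> X" using p assms(1) by blast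
  from partial_realization[OF assms, of p, OF this]
  obtain x where x: "x \<in> X" and *: "\<And>U. U \<in> F \<Longrightarrow> D U (\<pi> U x) (\<pi> U (p U)) \<le> k"
    "\<And>U V. U \<in> F \<Longrightarrow> V \<in> I \<Longrightarrow> trv V U \<or> snest U V \<Longrightarrow> D V (\<pi> V x) (\<rho> U V) \<le> k" by blast
  have "D U (\<pi> U x) (b U) \<le> 2 * c" if U: "U \<in> F" for U
  proof -
    have UI: "U \<in> I" using U assms by blast
    have "D U (\<pi> U x) (b U) \<le> D U (\<pi> U x) (\<pi> U (p U)) + D U (\<pi> U (p U)) (b U)"
      using D_triangle[OF UI \<pi>_in[OF UI x] \<pi>_in[OF UI] b_in[OF UI]] p[OF UI] by blast
    then show ?thesis using *(1)[OF U] p[OF UI] c by linarith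
  qed
  moreover have "D V (\<pi> V x) (\<rho> U V) \<le> c" if "U \<in> F" "V \<in> I" "trv V U \<or> snest U V" for U V
    using *(2)[OF that] c by linarith
  ultimately show ?thesis using x by blast
qed

text \<open>A family of terminal indices whose realization point is still far from \<open>b\<close> somewhere is
  refined: a far terminal index is added, and it replaces the index it is nested in, if any.
  The total depth of the family increases.\<close>

lemma refine_family:
  assumes F: "F \<subseteq> I" "finite F" "pairwise perp F" and e: "0 \<le> e" "\<And>U. U \<in> F \<Longrightarrow> terminal e U"
  shows "(\<exists>x\<in>X. \<forall>W\<in>I. D W (\<pi> W x) (b W) \<le> e + 20 * c) \<or>
    (\<exists>F'\<subseteq>I. finite F' \<and> pairwise perp F' \<and> (\<forall>U\<in>F'. terminal (e + 22 * c) U) \<and>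
      sum depth F < sum depth F')"
proof -
  obtain x where x: "x \<in> X"
    and x1: "\<And>U. U \<in> F \<Longrightarrow> D U (\<pi> U x) (b U) \<le> 2 * c"
    and x2: "\<And>U V. U \<in> F \<Longrightarrow> V \<in> I \<Longrightarrow> trv V U \<or> snest U V \<Longrightarrow> D V (\<pi> V x) (\<rho> U V) \<le> c"
    using realize_family[OF F(1,3)] by blast
  show ?thesis
  proof (cases "\<exists>W\<in>I. e + 20 * c < D W (\<pi> W x) (b W)")
    case False
    then show ?thesis using x by force
  next
    case True
    have "20 * c \<le> e + 20 * c" using e by simp
    then obtain U where U: "U \<in> I" "e + 20 * c < D U (\<pi> U x) (b U)" "terminal (e + 20 * c + 2 * c) U"
      using far_terminal[OF x] True by blast
    have "U \<notin> F" using x1 U(2) e c by force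
    \<comment> \<open>For \<open>W\<close> transverse to \<open>U\<close> or properly nested in
      \<open>U\<close>, realization at \<open>W\<close> puts \<open>x\<close> near
      \<open>\<rho> W U\<close>, and terminality of \<open>W\<close> puts \<open>b U\<close> there
      as well. So \<open>x\<close> could not be far at \<open>U\<close>.\<close>
    have cases: "perp W U \<or> snest U W" if W: "W \<in> F" for W
    proof (rule ccontr)
      assume "\<not> ?thesis"
      then have n: "\<not> perp W U" "\<not> snest U W" by auto
      have WI: "W \<in> I" using W F by blast
      have "U \<noteq> W" using W \<open>U \<notin> F\<close> by blast
      have "\<not> perp U W" using n(1) perp_sym U(1) WI by blast
      then have t: "trv U W \<or> snest W U"
        using n \<open>U \<noteq> W\<close> unfolding trv_def snest_def by blast
      have \<rho>: "\<rho> W U \<in> C U" using \<rho>_in[OF WI U(1)] t trv_sym[OF U(1) WI] by blast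
      have "D U (\<pi> U x) (b U) \<le> D U (\<pi> U x) (\<rho> W U) + D U (\<rho> W U) (b U)"
        by (rule D_triangle[OF U(1) \<pi>_in[OF U(1) x] \<rho> b_in[OF U(1)]])
      moreover have "D U (b U) (\<rho> W U) \<le> e" using e(2)[OF W] U(1) t unfolding terminal_def by blast
      ultimately show False
        using x2[OF W U(1) t] U(2) c D_commute[OF U(1), of "b U" "\<rho> W U"] by linarith
    qed
    define F' where "F' = insert U {W \<in> F. perp W U}"
    have "F' \<subseteq> I" "finite F'" using F U by (auto simp: F'_def)
    moreover have "pairwise perp F'"
      using F U(1) perp_sym by (auto simp: F'_def pairwise_def)
    moreover have "\<forall>W\<in>F'. terminal (e + 22 * c) W"
    proof
      fix W assume "W \<in> F'"
      then consider "W = U" | "W \<in> F" by (auto simp: F'_def)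
      then show "terminal (e + 22 * c) W"
      proof cases
        case 1
        have "e + 20 * c + 2 * c = e + 22 * c" by simp
        then show ?thesis using 1 U(3) by metis
      next
        case 2
        then show ?thesis using e(2) c terminal_mono[of e W "e + 22 * c"] by simp
      qed
    qed
    moreover have "sum depth F < sum depth F'"
    proof (cases "\<exists>W\<in>F. snest U W")
      case False
      then have "F' = insert U F" using cases by (auto simp: F'_def)
      then show ?thesis using \<open>U \<notin> F\<close> F(2) depth_pos[OF U(1)] by simp
    next
      case True
      then obtain W where W: "W \<in> F" "snest U W" by blast
      have WI: "W \<in> I" using W F by blast
      \<comment> \<open>At most one member contains \<open>U\<close>: the others are orthogonal to
        that member and hence to \<open>U\<close>. The refinement thus exchanges a single index for
        a deeper one and loses nothing else.\<close>
      have "perp V U" if V: "V \<in> F" "V \<noteq> W" for V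
      proof -
        have VI: "V \<in> I" using V F by blast
        have "perp W V" using pairwiseD[OF F(3) W(1) V(1)] V(2) by simp
        then have "perp U V" using perp_nest[OF VI U(1) WI] W(2) unfolding snest_def by simp
        then show ?thesis by (rule perp_sym[OF U(1) VI])
      qed
      moreover have "\<not> perp W U"
        using perp_incomparable[OF U(1) WI] perp_sym[OF WI U(1)] W(2) unfolding snest_def by blast
      ultimately have "F' = insert U (F - {W})" using W by (auto simp: F'_def)
      then have "sum depth F' = depth U + sum depth (F - {W})" using F(2) \<open>U \<notin> F\<close> by simp
      moreover have "sum depth F = depth W + sum depth (F - {W})"
        using F(2) W(1) by (simp add: sum.remove)
      ultimately show ?thesis using depth_snest[OF U(1) WI W(2)] by simp
    qed
    ultimately show ?thesis by blast
  qed
qed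

lemma sum_depth_le:
  assumes "F \<subseteq> I" "finite F" "pairwise perp F"
  shows "sum depth F \<le> n * n"
proof -
  have "sum depth F \<le> card F * n"
    using sum_bounded_above[of F depth n] depth_le by simp
  also have "\<dots> \<le> n * n" using perp_bound[OF assms] by simp
  finally show ?thesis .
qed

text \<open>\<open>j\<close> bounds the number of refinements still possible, since each raises the
  total depth and this never exceeds \<open>n * n\<close>. Each adds \<open>22 * c\<close> to the
  error \<open>e\<close> of terminality: 20 for the threshold of being far and 2 from the choice of
  a terminal index.\<close>

lemma realization_from_family:
  assumes "F \<subseteq> I" "finite F" "pairwise perp F" "0 \<le> e" "\<And>U. U \<in> F \<Longrightarrow> terminal e U"
    and "n * n \<le> sum depth F + j"
  shows "\<exists>x\<in>X. \<forall>W\<in>I. D W (\<pi> W x) (b W) \<le> e + 22 * c * (real j + 1)"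
  using assms
proof (induction j arbitrary: F e)
  case 0
  have "\<not> (\<exists>F'\<subseteq>I. finite F' \<and> pairwise perp F' \<and> (\<forall>U\<in>F'. terminal (e + 22 * c) U) \<and>
      sum depth F < sum depth F')"
  proof
    assume "\<exists>F'\<subseteq>I. finite F' \<and> pairwise perp F' \<and> (\<forall>U\<in>F'. terminal (e + 22 * c) U) \<and>
      sum depth F < sum depth F'"
    then obtain F' where "F' \<subseteq> I" "finite F'" "pairwise perp F'" "sum depth F < sum depth F'" by blast
    then show False using sum_depth_le[of F'] 0(6) by simp
  qed
  then obtain x where "x \<in> X" "\<forall>W\<in>I. D W (\<pi> W x) (b W) \<le> e + 20 * c"
    using refine_family[OF 0(1-5)] by blast
  moreover have "e + 20 * c \<le> e + 22 * c * (real 0 + 1)" using c by simp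
  ultimately show ?case by (meson order_trans)
next
  case (Suc j)
  show ?case
  proof (cases "\<exists>x\<in>X. \<forall>W\<in>I. D W (\<pi> W x) (b W) \<le> e + 20 * c")
    case True
    then obtain x where x: "x \<in> X" "\<forall>W\<in>I. D W (\<pi> W x) (b W) \<le> e + 20 * c" by blast
    have "20 * c * 1 \<le> 22 * c * (real (Suc j) + 1)"
      using c by (intro mult_mono) auto
    then have "e + 20 * c \<le> e + 22 * c * (real (Suc j) + 1)" by simp
    then show ?thesis using x by (meson order_trans)
  next
    case False
    then obtain F' where F': "F' \<subseteq> I" "finite F'" "pairwise perp F'"
      "\<And>U. U \<in> F' \<Longrightarrow> terminal (e + 22 * c) U" "sum depth F < sum depth F'"
      using refine_family[OF Suc.prems(1-5)] by blast
    have "n * n \<le> sum depth F' + j" using F'(5) Suc.prems(6) by simp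
    then obtain x where "x \<in> X" "\<forall>W\<in>I. D W (\<pi> W x) (b W) \<le> e + 22 * c + 22 * c * (real j + 1)"
      using Suc.IH[OF F'(1-3) _ F'(4)] Suc.prems(4) c by auto
    moreover have "e + 22 * c + 22 * c * (real j + 1) = e + 22 * c * (real (Suc j) + 1)"
      by (simp add: algebra_simps)
    ultimately show ?thesis by metis
  qed
qed

text \<open>The empty family is vacuously terminal with error 0. The extra 1 covers the threshold at
  which the refinements stop.\<close>

theorem realization: "\<exists>x\<in>X. \<forall>W\<in>I. D W (\<pi> W x) (b W) \<le> 22 * c * (real (n * n) + 1)"
  using realization_from_family[of "{}" 0 "n * n"] by simp

end

section \<open>Centers of triangles in hyperbolic spaces\<close>

lemma hyperbolic_metric: "hyperbolic_geodesic_space \<delta> M d \<Longrightarrow> Metric_space M d"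
  by (simp add: hyperbolic_geodesic_space_def geodesic_space_def)

lemma geodesic_exists:
  "geodesic_space M d \<Longrightarrow> x \<in> M \<Longrightarrow> y \<in> M \<Longrightarrow> \<exists>P. geodesic_between M d x y P"
  by (simp add: geodesic_space_def)

lemma geodesic_between_point:
  assumes "geodesic_between M d x y P" "p \<in> P"
  shows "p \<in> M" "d x p + d p y = d x y"
proof -
  obtain \<gamma> L where \<gamma>: "0 \<le> L" "\<gamma> 0 = x" "\<gamma> L = y" "\<gamma> ` {0..L} = P" "P \<subseteq> M"
    "\<forall>s\<in>{0..L}. \<forall>t\<in>{0..L}. d (\<gamma> s) (\<gamma> t) = \<bar>s - t\<bar>"
    using assms(1) unfolding geodesic_between_def by blast
  obtain t where t: "t \<in> {0..L}" "p = \<gamma> t" using assms(2) \<gamma>(4) by blast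
  show "p \<in> M" using assms(2) \<gamma>(5) by blast
  have "d x p = t" "d p y = L - t" "d x y = L"
    using \<gamma>(6)[rule_format, of 0 t] \<gamma>(6)[rule_format, of t L] \<gamma>(6)[rule_format, of 0 L] \<gamma>(1-3) t
    by simp_all
  then show "d x p + d p y = d x y" by simp
qed

lemma geodesic_between_ends:
  assumes "geodesic_between M d x y P"
  shows "x \<in> P" "y \<in> P"
proof -
  obtain \<gamma> :: "real \<Rightarrow> 'a" and L where \<gamma>: "0 \<le> L" "\<gamma> 0 = x" "\<gamma> L = y" "\<gamma> ` {0..L} = P"
    using assms unfolding geodesic_between_def by blast
  then have "\<gamma> 0 \<in> P" "\<gamma> L \<in> P" by auto
  then show "x \<in> P" "y \<in> P" using \<gamma> by auto
qed

lemma slim_point: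
  assumes "hyperbolic_geodesic_space \<delta> M d"
    and "geodesic_between M d x y P" "geodesic_between M d y z Q" "geodesic_between M d z x R" "p \<in> P"
  shows "\<exists>q\<in>Q \<union> R. d p q \<le> \<delta>"
proof -
  have "P \<subseteq> nbhd M d \<delta> (Q \<union> R)"
    using assms(1-4) unfolding hyperbolic_geodesic_space_def by blast
  then show ?thesis using assms(5) unfolding nbhd_def by blast
qed

text \<open>Moving along \<open>P\<close> from \<open>x\<close>, one leaves the neighborhood of
  \<open>R\<close> and must then be near \<open>Q\<close>. The supremum of the parameters near
  \<open>R\<close> may not be attained, so parameters within 1/2 on its two sides are compared; this
  costs the extra 1.\<close>

lemma slim_triangle_center:
  assumes hyp: "hyperbolic_geodesic_space \<delta> M d" "0 \<le> \<delta>"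
    and P: "geodesic_between M d x y P" and Q: "geodesic_between M d y z Q" and R: "geodesic_between M d z x R"
  shows "\<exists>p\<in>P. (\<exists>q\<in>Q. d p q \<le> \<delta> + 1) \<and> (\<exists>r\<in>R. d p r \<le> \<delta> + 1)"
proof -
  interpret Metric_space M d using hyperbolic_metric hyp by blast
  obtain \<gamma> L where \<gamma>: "0 \<le> L" "\<gamma> 0 = x" "\<gamma> L = y" "\<gamma> ` {0..L} = P" "P \<subseteq> M"
    "\<forall>s\<in>{0..L}. \<forall>t\<in>{0..L}. d (\<gamma> s) (\<gamma> t) = \<bar>s - t\<bar>"
    using P unfolding geodesic_between_def by blast
  define A where "A = {t \<in> {0..L}. \<exists>r\<in>R. d (\<gamma> t) r \<le> \<delta>}"
  have "x \<in> R" using geodesic_between_ends[OF R] by blast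
  moreover from this have "x \<in> M" by (rule geodesic_between_point(1)[OF R])
  then have "d (\<gamma> 0) x \<le> \<delta>" using \<gamma>(2) hyp(2) by simp
  moreover have "0 \<in> {0..L}" using \<gamma>(1) by simp
  ultimately have A0: "0 \<in> A" unfolding A_def using \<open>x \<in> R\<close> by blast
  have bdd: "bdd_above A" by (rule bdd_aboveI[of _ L]) (simp add: A_def)
  define t0 where "t0 = Sup A"
  have t0: "0 \<le> t0" "t0 \<le> L"
  proof -
    show "0 \<le> t0" unfolding t0_def by (rule cSup_upper[OF A0 bdd])
    show "t0 \<le> L" unfolding t0_def using A0 by (intro cSup_least) (auto simp: A_def)
  qed
  obtain s where s: "s \<in> A" "t0 - 1/2 < s"
    using less_cSup_iff[of A "t0 - 1/2"] A0 bdd by (auto simp: t0_def)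
  have sL: "s \<in> {0..L}" "s \<le> t0" using s(1) cSup_upper[OF s(1) bdd] by (auto simp: A_def t0_def)
  have sM: "\<gamma> s \<in> M" "\<gamma> s \<in> P" using sL(1) \<gamma>(4,5) by auto
  have r: "\<exists>r\<in>R. d (\<gamma> s) r \<le> \<delta> + 1" using s(1) by (force simp: A_def)
  have "\<exists>q\<in>Q. d (\<gamma> s) q \<le> \<delta> + 1"
  proof (cases "t0 = L")
    case True
    have "y \<in> Q" using geodesic_between_ends[OF Q] by blast
    moreover have "d (\<gamma> s) y = \<bar>s - L\<bar>" using \<gamma>(6)[rule_format, of s L] \<gamma>(1,3) sL by simp
    then have "d (\<gamma> s) y \<le> \<delta> + 1" using s(2) sL True hyp(2) by auto
    ultimately show ?thesis by blast
  next
    case False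
    \<comment> \<open>The truncation at \<open>L\<close> keeps \<open>t\<close> a parameter of the
      geodesic, still beyond the supremum.\<close>
    define t where "t = min L (t0 + 1/2)"
    have t: "t0 < t" "t \<in> {0..L}" "t \<le> t0 + 1/2" using False t0 by (auto simp: t_def)
    have "t \<notin> A" using cSup_upper[of t A] bdd t(1) by (auto simp: t0_def)
    have tP: "\<gamma> t \<in> P" "\<gamma> t \<in> M" using t(2) \<gamma>(4,5) by auto
    then obtain q where q: "q \<in> Q" "d (\<gamma> t) q \<le> \<delta>"
      using slim_point[OF hyp(1) P Q R tP(1)] \<open>t \<notin> A\<close> t(2) by (auto simp: A_def)
    have qM: "q \<in> M" using geodesic_between_point(1)[OF Q q(1)] .
    have "d (\<gamma> s) (\<gamma> t) = \<bar>s - t\<bar>" using \<gamma>(6) sL(1) t(2) by blast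
    then have "d (\<gamma> s) (\<gamma> t) \<le> 1" using t s sL by auto
    then have "d (\<gamma> s) q \<le> \<delta> + 1"
      using triangle[OF sM(1) tP(2) qM] q(2) by linarith
    then show ?thesis using q(1) by blast
  qed
  then show ?thesis using r sM(2) by blast
qed

text \<open>Up to \<open>E\<close>, \<open>m\<close> lies between each two of the three vertices.
  Expressing this by distances, without geodesics, makes the notion stable: moving the vertices only
  changes \<open>E\<close>.\<close>

definition center :: "'a set \<Rightarrow> ('a \<Rightarrow> 'a \<Rightarrow> real) \<Rightarrow> real \<Rightarrow> 'a \<Rightarrow> 'a \<Rightarrow> 'a \<Rightarrow> 'a \<Rightarrow> bool" where
  "center M d E x y z m \<longleftrightarrow> m \<in> M \<and> d x m + d m y \<le> d x y + E \<and>
     d y m + d m z \<le> d y z + E \<and> d z m + d m x \<le> d z x + E"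

text \<open>The center is found on the prescribed side \<open>P\<close>, so that quasiconvexity of
  the image of a projection will apply to it.\<close>

lemma center_exists:
  assumes hyp: "hyperbolic_geodesic_space \<delta> M d" "0 \<le> \<delta>"
    and P: "geodesic_between M d x y P" and z: "z \<in> M"
  shows "\<exists>m\<in>P. center M d (2 * \<delta> + 2) x y z m"
proof -
  interpret Metric_space M d using hyperbolic_metric hyp by blast
  have geo: "geodesic_space M d" using hyp unfolding hyperbolic_geodesic_space_def by blast
  have xy: "x \<in> M" "y \<in> M"
    using geodesic_between_ends[OF P] geodesic_between_point(1)[OF P] by auto
  obtain Q R where Q: "geodesic_between M d y z Q" and R: "geodesic_between M d z x R"
    using geodesic_exists[OF geo] xy z by meson
  obtain p q r where p: "p \<in> P" and q: "q \<in> Q" "d p q \<le> \<delta> + 1" and r: "r \<in> R" "d p r \<le> \<delta> + 1"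
    using slim_triangle_center[OF hyp P Q R] by blast
  note pP = geodesic_between_point[OF P p] and qQ = geodesic_between_point[OF Q q(1)]
    and rR = geodesic_between_point[OF R r(1)]
  have "d y p + d p z \<le> d y z + (2 * \<delta> + 2)"
    using triangle[OF xy(2) qQ(1) pP(1)] triangle[OF pP(1) qQ(1) z] qQ(2) q(2) commute[of p q] by linarith
  moreover have "d z p + d p x \<le> d z x + (2 * \<delta> + 2)"
    using triangle[OF z rR(1) pP(1)] triangle[OF pP(1) rR(1) xy(1)] rR(2) r(2) commute[of p r] by linarith
  ultimately show ?thesis using p pP hyp(2) unfolding center_def by auto
qed

text \<open>Applied to \<open>a\<close>, \<open>m\<close>, \<open>b\<close>, the slim triangle
  center shows that \<open>m\<close> is within E + 2\<delta> + 2 of a geodesic from \<open>b\<close>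
  to \<open>a\<close>. Slimness of the triangle with third vertex \<open>w\<close> then puts
  \<open>m\<close> within E + 3\<delta> + 2 of a geodesic from \<open>w\<close> to \<open>a\<close>
  or to \<open>b\<close>, and a detour costs twice that.\<close>

lemma gromov_product_dichotomy:
  assumes hyp: "hyperbolic_geodesic_space \<delta> M d" "0 \<le> \<delta>"
    and M: "a \<in> M" "b \<in> M" "m \<in> M" "w \<in> M" and m: "d a m + d m b \<le> d a b + E"
  shows "d a m + d m w \<le> d a w + 2 * (E + 3 * \<delta> + 2) \<or> d b m + d m w \<le> d b w + 2 * (E + 3 * \<delta> + 2)"
proof -
  interpret Metric_space M d using hyperbolic_metric hyp by blast
  have geo: "geodesic_space M d" using hyp unfolding hyperbolic_geodesic_space_def by blast
  obtain P Q R where P: "geodesic_between M d a m P" and Q: "geodesic_between M d m b Q"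
    and R: "geodesic_between M d b a R"
    using geodesic_exists[OF geo] M by meson
  obtain p q r where p: "p \<in> P" and q: "q \<in> Q" "d p q \<le> \<delta> + 1" and r: "r \<in> R" "d p r \<le> \<delta> + 1"
    using slim_triangle_center[OF hyp P Q R] by blast
  note pP = geodesic_between_point[OF P p] and qQ = geodesic_between_point[OF Q q(1)]
    and rR = geodesic_between_point[OF R r(1)]
  have "d a b \<le> d a p + d p q + d q b"
    using triangle[OF M(1) pP(1) M(2)] triangle[OF pP(1) qQ(1) M(2)] by linarith
  then have "d p m \<le> E + \<delta> + 1"
    using pP(2) qQ(2) m q(2) nonneg[of m q] by linarith
  then have mr: "d m r \<le> E + 2 * \<delta> + 2"
    using triangle[OF M(3) pP(1) rR(1)] r(2) commute[of m p] by linarith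
  obtain S T where S: "geodesic_between M d a w S" and T: "geodesic_between M d w b T"
    using geodesic_exists[OF geo] M by meson
  obtain s where s: "s \<in> S \<union> T" "d r s \<le> \<delta>"
    using slim_point[OF hyp(1) R S T r(1)] by blast
  have sM: "s \<in> M" using s(1) geodesic_between_point(1)[OF S] geodesic_between_point(1)[OF T] by blast
  have ms: "d m s \<le> E + 3 * \<delta> + 2" using triangle[OF M(3) rR(1) sM] mr s(2) by linarith
  show ?thesis
    using s(1)
  proof
    assume "s \<in> S"
    then have "d a s + d s w = d a w" by (rule geodesic_between_point(2)[OF S])
    then have "d a m + d m w \<le> d a w + 2 * (E + 3 * \<delta> + 2)"
      using triangle[OF M(1) sM M(3)] triangle[OF M(3) sM M(4)] ms commute[of m s] by argo
    then show ?thesis ..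
  next
    assume "s \<in> T"
    then have "d w s + d s b = d w b" by (rule geodesic_between_point(2)[OF T])
    then have "d b m + d m w \<le> d b w + 2 * (E + 3 * \<delta> + 2)"
      using triangle[OF M(2) sM M(3)] triangle[OF M(3) sM M(4)] ms commute[of m s] commute[of b s]
        commute[of w s] commute[of w b] by argo
    then show ?thesis ..
  qed
qed

text \<open>The dichotomy holds for each pair of vertices, so \<open>m\<close> is almost between
  \<open>w\<close> and at least two of them; likewise \<open>w\<close> is almost between
  \<open>m\<close> and at least two. Some vertex is common, and adding its two inequalities bounds
  the distance.\<close>

lemma center_unique:
  assumes hyp: "hyperbolic_geodesic_space \<delta> M d" "0 \<le> \<delta>"
    and M: "x \<in> M" "y \<in> M" "z \<in> M" and m: "center M d E x y z m" and w: "center M d E x y z w"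
  shows "d m w \<le> 2 * (E + 3 * \<delta> + 2)"
proof -
  interpret Metric_space M d using hyperbolic_metric hyp by blast
  have mw: "m \<in> M" "w \<in> M" using m w by (auto simp: center_def)
  let ?E = "2 * (E + 3 * \<delta> + 2)"
  have m': "d x m + d m y \<le> d x y + E" "d y m + d m z \<le> d y z + E" "d z m + d m x \<le> d z x + E"
    and w': "d x w + d w y \<le> d x y + E" "d y w + d w z \<le> d y z + E" "d z w + d w x \<le> d z x + E"
    using m w by (auto simp: center_def)
  have 1: "d x m + d m w \<le> d x w + ?E \<or> d y m + d m w \<le> d y w + ?E"
    by (rule gromov_product_dichotomy[OF hyp M(1,2) mw m'(1)])
  have 2: "d y m + d m w \<le> d y w + ?E \<or> d z m + d m w \<le> d z w + ?E"
    by (rule gromov_product_dichotomy[OF hyp M(2,3) mw m'(2)])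
  have 3: "d z m + d m w \<le> d z w + ?E \<or> d x m + d m w \<le> d x w + ?E"
    by (rule gromov_product_dichotomy[OF hyp M(3,1) mw m'(3)])
  have 4: "d x w + d w m \<le> d x m + ?E \<or> d y w + d w m \<le> d y m + ?E"
    by (rule gromov_product_dichotomy[OF hyp M(1,2) mw(2,1) w'(1)])
  have 5: "d y w + d w m \<le> d y m + ?E \<or> d z w + d w m \<le> d z m + ?E"
    by (rule gromov_product_dichotomy[OF hyp M(2,3) mw(2,1) w'(2)])
  have 6: "d z w + d w m \<le> d z m + ?E \<or> d x w + d w m \<le> d x m + ?E"
    by (rule gromov_product_dichotomy[OF hyp M(3,1) mw(2,1) w'(3)])
  show ?thesis using 1 2 3 4 5 6 commute[of w m] by argo
qed

text \<open>Each inequality involves two distances from the vertices to \<open>m\<close>, changing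
  by at most \<open>s\<close> each, and one between vertices, changing by at most
  \<open>2 * s\<close>.\<close>

lemma center_perturb:
  assumes "Metric_space M d" and m: "center M d E x y z m"
    and M: "x \<in> M" "y \<in> M" "z \<in> M" "x' \<in> M" "y' \<in> M" "z' \<in> M"
    and s: "d x x' \<le> s" "d y y' \<le> s" "d z z' \<le> s"
  shows "center M d (E + 4 * s) x' y' z' m"
proof -
  interpret Metric_space M d by fact
  have *: "d u' m + d m v' \<le> d u' v' + (E + 4 * s)"
    if "d u m + d m v \<le> d u v + E" "d u u' \<le> s" "d v v' \<le> s" "u \<in> M" "v \<in> M" "u' \<in> M" "v' \<in> M"
    for u v u' v'
  proof -
    have mM: "m \<in> M" using m by (simp add: center_def)
    show ?thesis
      using triangle[OF that(6,4) mM] triangle[OF mM that(5,7)] triangle[OF that(4,6,5)]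
        triangle[OF that(6,7,5)] that(1-3) commute[of u u'] commute[of v v'] by linarith
  qed
  have m': "m \<in> M" "d x m + d m y \<le> d x y + E" "d y m + d m z \<le> d y z + E" "d z m + d m x \<le> d z x + E"
    using m by (auto simp: center_def)
  show ?thesis
    unfolding center_def
    using m'(1) *[OF m'(2) s(1,2) M(1,2,4,5)] *[OF m'(3) s(2,3) M(2,3,5,6)] *[OF m'(4) s(3,1) M(3,1,6,4)]
    by blast
qed

text \<open>A majority principle: two vertices near \<open>r\<close> are within \<open>2 * s\<close>
  of each other, and the center is almost between them. It transfers alternatives that hold for each
  of three points to their center.\<close>

lemma center_near_two:
  assumes "Metric_space M d" "center M d E x y z m" "x \<in> M" "y \<in> M" "z \<in> M" "r \<in> M"
    and "d x r \<le> s \<and> d y r \<le> s \<or> d y r \<le> s \<and> d z r \<le> s \<or> d z r \<le> s \<and> d x r \<le> s"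
  shows "d m r \<le> 3 * s + E"
proof -
  interpret Metric_space M d by fact
  have *: "d m r \<le> 3 * s + E"
    if "d u m + d m v \<le> d u v + E" "d u r \<le> s" "d v r \<le> s" "u \<in> M" "v \<in> M" for u v
  proof -
    have mM: "m \<in> M" using assms(2) by (simp add: center_def)
    show ?thesis
      using triangle[OF that(4) assms(6) that(5)] triangle[OF mM that(4) assms(6)] that
        commute[of v r] commute[of m u] nonneg[of m v] by linarith
  qed
  show ?thesis using assms * unfolding center_def by blast
qed

section \<open>Coarse medians\<close>

locale hyperbolic_hhs = point_hhs +
  fixes \<delta> :: real
  assumes \<delta>: "0 \<le> \<delta>" and k: "1 \<le> k"
    and hyperbolic: "W \<in> I \<Longrightarrow> hyperbolic_geodesic_space \<delta> (C W) (D W)"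
    and quasiconvex: "W \<in> I \<Longrightarrow> x \<in> X \<Longrightarrow> y \<in> X \<Longrightarrow>
      geodesic_between (C W) (D W) (\<pi> W x) (\<pi> W y) P \<Longrightarrow> z \<in> P \<Longrightarrow> \<exists>w\<in>X. D W z (\<pi> W w) \<le> k"
    and large_links: "W \<in> I \<Longrightarrow> x \<in> X \<Longrightarrow> y \<in> X \<Longrightarrow>
      \<exists>\<T>. finite \<T> \<and> (\<forall>V\<in>\<T>. V \<in> I \<and> snest V W) \<and>
        (\<forall>V\<in>I. snest V W \<and> k < D V (\<pi> V x) (\<pi> V y) \<longrightarrow> (\<exists>U\<in>\<T>. nest V U))"
begin

lemma finite_distinguishing:
  assumes "x \<in> X" "y \<in> X"
  shows "finite {V \<in> I. k < D V (\<pi> V x) (\<pi> V y)}"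
  by (rule finite_relevant) (use large_links assms in blast)

text \<open>The tuple is consistent because two of the three points always satisfy the same alternative.\<close>

lemma center_tuple_consistent:
  assumes X: "e \<in> X" "x \<in> X" "y \<in> X"
    and b: "\<And>W. W \<in> I \<Longrightarrow> center (C W) (D W) (2 * \<delta> + 2) (\<pi> W e) (\<pi> W x) (\<pi> W y) (b W)"
    and near: "\<And>W. W \<in> I \<Longrightarrow> \<exists>w\<in>X. D W (b W) (\<pi> W w) \<le> k"
  shows "consistent_tuple nest perp X I C D \<pi> \<rho> \<sigma> k n b (6 * k + 2 * \<delta> + 2)"
proof (intro consistent_tuple.intro point_hhs_axioms consistent_tuple_axioms.intro)
  let ?E = "2 * \<delta> + 2" and ?c = "6 * k + 2 * \<delta> + 2"
  show "k \<le> ?c" "1 \<le> ?c" using k \<delta> by simp_all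
  have b_in: "b W \<in> C W" if "W \<in> I" for W using b[OF that] by (simp add: center_def)
  have two: "D W (b W) r \<le> 3 * s + ?E"
    if "W \<in> I" "r \<in> C W"
      "D W (\<pi> W e) r \<le> s \<and> D W (\<pi> W x) r \<le> s \<or> D W (\<pi> W x) r \<le> s \<and> D W (\<pi> W y) r \<le> s \<or>
       D W (\<pi> W y) r \<le> s \<and> D W (\<pi> W e) r \<le> s" for W r s
    using center_near_two[OF metric[OF that(1)] b[OF that(1)] \<pi>_in[OF that(1) X(1)]
        \<pi>_in[OF that(1) X(2)] \<pi>_in[OF that(1) X(3)] that(2,3)] .
  fix W assume W: "W \<in> I"
  show "b W \<in> C W" by (rule b_in[OF W])
  show "\<exists>x\<in>X. D W (\<pi> W x) (b W) \<le> ?c"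
  proof -
    obtain w where "w \<in> X" "D W (b W) (\<pi> W w) \<le> k" using near[OF W] by blast
    then have "D W (\<pi> W w) (b W) \<le> ?c" using k \<delta> D_commute[OF W, of "b W" "\<pi> W w"] by linarith
    then show ?thesis using \<open>w \<in> X\<close> by blast
  qed
  fix V assume V: "V \<in> I"
  show "D W (b W) (\<rho> V W) \<le> ?c \<or> D V (b V) (\<rho> W V) \<le> ?c" if t: "trv V W"
  proof -
    have \<rho>: "\<rho> V W \<in> C W" "\<rho> W V \<in> C V" using \<rho>_in V W t trv_sym by blast+
    have "D W (b W) (\<rho> V W) \<le> 3 * k + ?E \<or> D V (b V) (\<rho> W V) \<le> 3 * k + ?E"
      using two[OF W \<rho>(1), of k] two[OF V \<rho>(2), of k] consistent_trv[OF V W t] X by blast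
    then show ?thesis using k by linarith
  qed
  show "D W (b W) (\<rho> V W) \<le> ?c \<or> D V (b V) (\<sigma> W V (b W)) \<le> ?c" if s: "snest V W"
  proof (cases "D W (b W) (\<rho> V W) \<le> ?c")
    case False
    have \<rho>: "\<rho> V W \<in> C W" using \<rho>_in V W s by blast
    note m = b_in[OF W]
    have geo: "\<exists>P. geodesic_between (C W) (D W) (b W) (\<pi> W u) P" if "u \<in> X" for u
      using geodesic_exists[OF geodesic[OF W] m \<pi>_in[OF W that]] .
    \<comment> \<open>A geodesic from the center to the projection of \<open>u\<close> that avoids
      the neighborhood of \<open>\<rho> V W\<close> allows the two ends to be compared in
      \<open>C V\<close>.\<close>
    define far where "far u \<longleftrightarrow> (\<exists>P. geodesic_between (C W) (D W) (b W) (\<pi> W u) P \<and>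
        (\<forall>z\<in>P. k < D W z (\<rho> V W)))" for u
    have far_close: "D V (\<pi> V u) (\<sigma> W V (b W)) \<le> 2 * k" if u: "u \<in> X" "far u" for u
    proof -
      obtain P where P: "geodesic_between (C W) (D W) (b W) (\<pi> W u) P" "\<forall>z\<in>P. k < D W z (\<rho> V W)"
        using u(2) unfolding far_def by blast
      have "D V (\<sigma> W V (b W)) (\<sigma> W V (\<pi> W u)) \<le> k"
        using bounded_geodesic_image[OF V W s P(1)] P(2) by blast
      moreover have "k < D W (\<pi> W u) (\<rho> V W)" using P(2) geodesic_between_ends(2)[OF P(1)] by blast
      then have "D V (\<pi> V u) (\<sigma> W V (\<pi> W u)) \<le> k"
        using consistent_snest[OF V W s u(1)] by linarith
      moreover have "D V (\<pi> V u) (\<sigma> W V (b W)) \<le>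
          D V (\<pi> V u) (\<sigma> W V (\<pi> W u)) + D V (\<sigma> W V (\<pi> W u)) (\<sigma> W V (b W))"
        by (rule D_triangle[OF V \<pi>_in[OF V u(1)] \<sigma>_in[OF V W s \<pi>_in[OF W u(1)]] \<sigma>_in[OF V W s m]])
      ultimately show ?thesis
        using D_commute[OF V, of "\<sigma> W V (b W)" "\<sigma> W V (\<pi> W u)"] by linarith
    qed
    \<comment> \<open>If the geodesics to both \<open>u\<close> and \<open>v\<close> passed near
      \<open>\<rho> V W\<close>, the shortcut between them there, compared with the almost geodesic
      path through the center, would bring the center near \<open>\<rho> V W\<close>.\<close>
    have pair: "far u \<or> far v"
      if uv: "u \<in> X" "v \<in> X" "D W (\<pi> W u) (b W) + D W (b W) (\<pi> W v) \<le> D W (\<pi> W u) (\<pi> W v) + ?E" for u v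
    proof (rule ccontr)
      assume "\<not> ?thesis"
      then have not: "\<not> far u" "\<not> far v" by auto
      obtain P Q where P: "geodesic_between (C W) (D W) (b W) (\<pi> W u) P"
        and Q: "geodesic_between (C W) (D W) (b W) (\<pi> W v) Q"
        using geo uv by meson
      obtain p q where p: "p \<in> P" "D W p (\<rho> V W) \<le> k" and q: "q \<in> Q" "D W q (\<rho> V W) \<le> k"
        using not P Q unfolding far_def by (meson not_le)
      note pP = geodesic_between_point[OF P p(1)] and qQ = geodesic_between_point[OF Q q(1)]
      have "D W (\<pi> W u) (\<pi> W v) \<le> D W (\<pi> W u) p + D W p (\<pi> W v)"
        by (rule D_triangle[OF W \<pi>_in[OF W uv(1)] pP(1) \<pi>_in[OF W uv(2)]])
      moreover have "D W p (\<pi> W v) \<le> D W p q + D W q (\<pi> W v)"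
        by (rule D_triangle[OF W pP(1) qQ(1) \<pi>_in[OF W uv(2)]])
      moreover have "D W p q \<le> D W p (\<rho> V W) + D W (\<rho> V W) q"
        by (rule D_triangle[OF W pP(1) \<rho> qQ(1)])
      ultimately have "D W (b W) p + D W (b W) q \<le> 2 * k + ?E"
        using pP(2) qQ(2) p(2) q(2) uv(3) D_commute[OF W, of "\<rho> V W" q]
          D_commute[OF W, of "\<pi> W u" p] D_commute[OF W, of "\<pi> W u" "b W"] by linarith
      moreover have "D W (b W) (\<rho> V W) \<le> D W (b W) p + D W p (\<rho> V W)"
        by (rule D_triangle[OF W m pP(1) \<rho>])
      ultimately show False
        using False p(2) k D_nonneg[OF W, of "b W" q] by linarith
    qed
    have "far e \<or> far x" "far x \<or> far y" "far y \<or> far e"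
      using pair X b[OF W] unfolding center_def by blast+
    \<comment> \<open>This estimate fixes the constant of the tuple: the majority principle with s =
      2k and error 2\<delta> + 2.\<close>
    then have "D V (b V) (\<sigma> W V (b W)) \<le> 3 * (2 * k) + ?E"
      using far_close X by (intro two[OF V \<sigma>_in[OF V W s m]]) blast
    then show ?thesis by simp
  qed simp
next
  let ?E = "2 * \<delta> + 2" and ?c = "6 * k + 2 * \<delta> + 2"
  fix z assume z: "z \<in> X"
  \<comment> \<open>Were \<open>z\<close> within \<open>k\<close> of both \<open>e\<close> and
    \<open>x\<close> at \<open>W\<close>, it would be near the center there. So indices where
    \<open>z\<close> is far from the tuple already distinguish \<open>z\<close> from
    \<open>e\<close> or from \<open>x\<close>.\<close>
  have "k < D W (\<pi> W z) (\<pi> W e) \<or> k < D W (\<pi> W z) (\<pi> W x)"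
    if W: "W \<in> I" and far: "?c < D W (\<pi> W z) (b W)" for W
  proof (rule ccontr)
    assume "\<not> ?thesis"
    then have "D W (\<pi> W e) (\<pi> W z) \<le> k" "D W (\<pi> W x) (\<pi> W z) \<le> k"
      using D_commute[OF W, of "\<pi> W z"] by auto
    then have "D W (b W) (\<pi> W z) \<le> 3 * k + ?E"
      using center_near_two[OF metric[OF W] b[OF W] \<pi>_in[OF W X(1)] \<pi>_in[OF W X(2)]
          \<pi>_in[OF W X(3)] \<pi>_in[OF W z], of k] by blast
    then show False using far k D_commute[OF W, of "b W" "\<pi> W z"] by linarith
  qed
  then have "{W \<in> I. ?c < D W (\<pi> W z) (b W)} \<subseteq>
      {W \<in> I. k < D W (\<pi> W z) (\<pi> W e)} \<union> {W \<in> I. k < D W (\<pi> W z) (\<pi> W x)}" by blast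
  then show "finite {W \<in> I. ?c < D W (\<pi> W z) (b W)}"
    using finite_distinguishing[OF z X(1)] finite_distinguishing[OF z X(2)]
    by (meson finite_UnI finite_subset)
qed

lemma coarse_median:
  "\<exists>r\<ge>0. \<forall>e\<in>X. \<forall>x\<in>X. \<forall>y\<in>X. \<exists>w\<in>X. \<forall>W\<in>I. \<exists>m.
     center (C W) (D W) (2 * \<delta> + 2) (\<pi> W e) (\<pi> W x) (\<pi> W y) m \<and> D W (\<pi> W w) m \<le> r"
proof (intro exI conjI ballI)
  let ?c = "6 * k + 2 * \<delta> + 2"
  let ?r = "22 * ?c * (real (n * n) + 1)"
  show "0 \<le> ?r" using k \<delta> by simp
  fix e x y assume X: "e \<in> X" "x \<in> X" "y \<in> X"
  have "\<exists>m. center (C W) (D W) (2 * \<delta> + 2) (\<pi> W e) (\<pi> W x) (\<pi> W y) m \<and>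
      (\<exists>w\<in>X. D W m (\<pi> W w) \<le> k)" if W: "W \<in> I" for W
  proof -
    obtain P where P: "geodesic_between (C W) (D W) (\<pi> W e) (\<pi> W x) P"
      using geodesic_exists[OF geodesic[OF W] \<pi>_in[OF W X(1)] \<pi>_in[OF W X(2)]] by blast
    \<comment> \<open>A center on the side joining two projections is, by quasiconvexity, close to
      the projection of a point.\<close>
    obtain m where m: "m \<in> P" "center (C W) (D W) (2 * \<delta> + 2) (\<pi> W e) (\<pi> W x) (\<pi> W y) m"
      using center_exists[OF hyperbolic[OF W] \<delta> P \<pi>_in[OF W X(3)]] by blast
    then show ?thesis using quasiconvex[OF W X(1,2) P m(1)] by blast
  qed
  then obtain b where b:
    "\<And>W. W \<in> I \<Longrightarrow> center (C W) (D W) (2 * \<delta> + 2) (\<pi> W e) (\<pi> W x) (\<pi> W y) (b W)"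
    "\<And>W. W \<in> I \<Longrightarrow> \<exists>w\<in>X. D W (b W) (\<pi> W w) \<le> k" by metis
  interpret consistent_tuple nest perp X I C D \<pi> \<rho> \<sigma> k n b ?c
    by (rule center_tuple_consistent[OF X b])
  show "\<exists>w\<in>X. \<forall>W\<in>I. \<exists>m.
     center (C W) (D W) (2 * \<delta> + 2) (\<pi> W e) (\<pi> W x) (\<pi> W y) m \<and> D W (\<pi> W w) m \<le> ?r"
    using realization b(1) by blast
qed

text \<open>\<open>B x y\<close> realizes the centers of \<open>e\<close>, \<open>x\<close>,
  \<open>y\<close>. In the Lipschitz estimate the factor 8 arises because moving the vertices by
  \<open>s\<close> raises the error of a center by \<open>4 * s\<close>, and uniqueness of centers
  doubles it.\<close>

lemma coarse_meet_exists:
  assumes e: "e \<in> X"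
  shows "\<exists>B t. (\<forall>x\<in>X. \<forall>y\<in>X. B x y \<in> X) \<and>
    (\<forall>W\<in>I. \<forall>x\<in>X. D W (\<pi> W (B x x)) (\<pi> W x) \<le> t \<and> D W (\<pi> W (B e x)) (\<pi> W e) \<le> t \<and>
       D W (\<pi> W (B x e)) (\<pi> W e) \<le> t) \<and>
    (\<forall>W\<in>I. \<forall>x\<in>X. \<forall>x'\<in>X. \<forall>y\<in>X. \<forall>y'\<in>X. \<forall>s\<ge>0.
       D W (\<pi> W x) (\<pi> W x') \<le> s \<longrightarrow> D W (\<pi> W y) (\<pi> W y') \<le> s \<longrightarrow>
       D W (\<pi> W (B x y)) (\<pi> W (B x' y')) \<le> t + 8 * s)"
proof -
  let ?E = "2 * \<delta> + 2"
  obtain r where r: "0 \<le> r" and med: "\<forall>e\<in>X. \<forall>x\<in>X. \<forall>y\<in>X. \<exists>w\<in>X. \<forall>W\<in>I. \<exists>m.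
     center (C W) (D W) ?E (\<pi> W e) (\<pi> W x) (\<pi> W y) m \<and> D W (\<pi> W w) m \<le> r"
    using coarse_median by blast
  have "\<forall>x\<in>X. \<forall>y\<in>X. \<exists>w. w \<in> X \<and> (\<forall>W\<in>I. \<exists>m.
     center (C W) (D W) ?E (\<pi> W e) (\<pi> W x) (\<pi> W y) m \<and> D W (\<pi> W w) m \<le> r)"
    using med e by blast
  then obtain B where B: "\<And>x y. x \<in> X \<Longrightarrow> y \<in> X \<Longrightarrow> B x y \<in> X"
    and Bm: "\<And>x y W. x \<in> X \<Longrightarrow> y \<in> X \<Longrightarrow> W \<in> I \<Longrightarrow> \<exists>m.
     center (C W) (D W) ?E (\<pi> W e) (\<pi> W x) (\<pi> W y) m \<and> D W (\<pi> W (B x y)) m \<le> r" by metis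
  let ?t = "2 * r + 2 * (?E + 3 * \<delta> + 2)"
  \<comment> \<open>The condition \<open>eq\<close> says that two of the three vertices are
    \<open>u\<close>. The inequality for this pair confines the center to a neighborhood of
    \<open>u\<close>.\<close>
  have degenerate: "D W (\<pi> W (B x y)) (\<pi> W u) \<le> ?t"
    if W: "W \<in> I" and X: "x \<in> X" "y \<in> X" "u \<in> X" and eq: "x = u \<and> y = u \<or> e = u \<and> (x = u \<or> y = u)" for W x y u
  proof -
    obtain m where m: "center (C W) (D W) ?E (\<pi> W e) (\<pi> W x) (\<pi> W y) m" "D W (\<pi> W (B x y)) m \<le> r"
      using Bm[OF X(1,2) W] by blast
    have mW: "m \<in> C W" using m by (simp add: center_def)
    have "D W (\<pi> W u) m + D W m (\<pi> W u) \<le> D W (\<pi> W u) (\<pi> W u) + ?E"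
      using m(1) eq unfolding center_def by auto
    then have "D W m (\<pi> W u) \<le> ?E"
      using D_self[OF W \<pi>_in[OF W X(3)]] D_nonneg[OF W, of "\<pi> W u" m] by linarith
    moreover have "D W (\<pi> W (B x y)) (\<pi> W u) \<le> D W (\<pi> W (B x y)) m + D W m (\<pi> W u)"
      by (rule D_triangle[OF W \<pi>_in[OF W B[OF X(1,2)]] mW \<pi>_in[OF W X(3)]])
    ultimately show ?thesis using m(2) r \<delta> by argo
  qed
  have lipschitz: "D W (\<pi> W (B x y)) (\<pi> W (B x' y')) \<le> ?t + 8 * s"
    if W: "W \<in> I" and X: "x \<in> X" "x' \<in> X" "y \<in> X" "y' \<in> X" and s: "0 \<le> s"
      "D W (\<pi> W x) (\<pi> W x') \<le> s" "D W (\<pi> W y) (\<pi> W y') \<le> s" for W x x' y y' s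
  proof -
    obtain m where m: "center (C W) (D W) ?E (\<pi> W e) (\<pi> W x) (\<pi> W y) m" "D W (\<pi> W (B x y)) m \<le> r"
      using Bm[OF X(1,3) W] by blast
    obtain m' where m': "center (C W) (D W) ?E (\<pi> W e) (\<pi> W x') (\<pi> W y') m'" "D W (\<pi> W (B x' y')) m' \<le> r"
      using Bm[OF X(2,4) W] by blast
    have mW: "m \<in> C W" "m' \<in> C W" using m m' by (auto simp: center_def)
    note P = \<pi>_in[OF W e] \<pi>_in[OF W X(1)] \<pi>_in[OF W X(2)] \<pi>_in[OF W X(3)] \<pi>_in[OF W X(4)]
    have "D W (\<pi> W e) (\<pi> W e) \<le> s" using D_self[OF W P(1)] s(1) by simp
    from center_perturb[OF metric[OF W] m(1) P(1,2,4) P(1,3,5) this s(2,3)]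
    have "center (C W) (D W) (?E + 4 * s) (\<pi> W e) (\<pi> W x') (\<pi> W y') m" .
    moreover have "center (C W) (D W) (?E + 4 * s) (\<pi> W e) (\<pi> W x') (\<pi> W y') m'"
      using m'(1) s(1) unfolding center_def by simp
    ultimately have "D W m m' \<le> 2 * (?E + 4 * s + 3 * \<delta> + 2)"
      by (rule center_unique[OF hyperbolic[OF W] \<delta> P(1,3,5)])
    moreover have "D W (\<pi> W (B x y)) (\<pi> W (B x' y')) \<le> D W (\<pi> W (B x y)) m + D W m (\<pi> W (B x' y'))"
      by (rule D_triangle[OF W \<pi>_in[OF W B[OF X(1,3)]] mW(1) \<pi>_in[OF W B[OF X(2,4)]]])
    moreover have "D W m (\<pi> W (B x' y')) \<le> D W m m' + D W m' (\<pi> W (B x' y'))"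
      by (rule D_triangle[OF W mW \<pi>_in[OF W B[OF X(2,4)]]])
    ultimately show ?thesis
      using m(2) m'(2) D_commute[OF W, of m' "\<pi> W (B x' y')"] by argo
  qed
  show ?thesis
    by (rule exI[of _ B], rule exI[of _ ?t]) (use B degenerate lipschitz e in blast)
qed

end

section \<open>Hierarchically hyperbolic spaces and groups\<close>

lemma set_diameter_le:
  "set_diameter d A \<le> ereal e \<longleftrightarrow> (\<forall>a\<in>A. \<forall>b\<in>A. d a b \<le> e)"
  by (simp add: set_diameter_def SUP_le_iff)

lemma set_distance_le:
  assumes "\<And>a b. 0 \<le> d a b" "a \<in> A" "b \<in> B"
  shows "set_distance d A B \<le> d a b"
  unfolding set_distance_def
  by (rule cInf_lower) (use assms in \<open>auto intro!: bdd_belowI[of _ 0]\<close>)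

lemma set_distance_ge:
  assumes "Metric_space M d" "A \<subseteq> M" "B \<subseteq> M" "a \<in> A" "b \<in> B"
    and "\<And>a'. a' \<in> A \<Longrightarrow> d a a' \<le> \<xi>" "\<And>b'. b' \<in> B \<Longrightarrow> d b' b \<le> \<xi>"
  shows "d a b \<le> set_distance d A B + 2 * \<xi>"
proof -
  interpret Metric_space M d by fact
  have "d a b - 2 * \<xi> \<le> set_distance d A B"
    unfolding set_distance_def
  proof (rule cInf_greatest)
    show "{d a b |a b. a \<in> A \<and> b \<in> B} \<noteq> {}" using assms(4,5) by blast
    fix r assume "r \<in> {d a b |a b. a \<in> A \<and> b \<in> B}"
    then obtain a' b' where *: "a' \<in> A" "b' \<in> B" "r = d a' b'" by blast
    then have "a \<in> M" "b \<in> M" "a' \<in> M" "b' \<in> M" using assms(2-5) by auto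
    then have "d a b \<le> d a a' + d a' b' + d b' b"
      using triangle[of a a' b] triangle[of a' b' b] by linarith
    then show "d a b - 2 * \<xi> \<le> r" using assms(6)[OF *(1)] assms(7)[OF *(2)] *(3) by linarith
  qed
  then show ?thesis by linarith
qed

lemma coarse_point_distance:
  assumes "Metric_space (cspace H W) (cdist H W)" "coarse_point H \<xi> W A" "coarse_point H \<xi> W B"
    and "a \<in> A" "b \<in> B"
  shows "cdist H W a b \<le> set_distance (cdist H W) A B + 2 * \<xi>"
  by (rule set_distance_ge[OF assms(1)])
    (use assms in \<open>auto simp: coarse_point_def set_diameter_le\<close>)

text \<open>Distances between coarse points and between their representatives differ by at most
  2\<xi>, so larger constants absorb the choice. The last two conclusions compare the metric of
  \<open>X\<close> with the coordinates: the projections are uniformly coarsely Lipschitz, and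
  points close in all coordinates are close in \<open>X\<close>.\<close>

lemma hierarchically_hyperbolic_space_points:
  assumes "hierarchically_hyperbolic_space X d H"
  shows "\<exists>\<pi> \<rho> \<sigma> k n \<delta>.
    hyperbolic_hhs (nested H) (orth H) X (index H) (cspace H) (cdist H) \<pi> \<rho> \<sigma> k n \<delta> \<and>
    (\<forall>W\<in>index H. \<forall>x\<in>X. \<forall>y\<in>X. cdist H W (\<pi> W x) (\<pi> W y) \<le> k * d x y + k) \<and>
    (\<forall>s\<ge>0. \<exists>t. \<forall>x\<in>X. \<forall>y\<in>X. (\<forall>W\<in>index H. cdist H W (\<pi> W x) (\<pi> W y) \<le> s) \<longrightarrow> d x y \<le> t)"
proof -
  obtain q where q: "quasigeodesic_space q X d"
    using assms unfolding hierarchically_hyperbolic_space_def by blast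
  obtain \<delta> where \<delta>: "0 \<le> \<delta>" "\<forall>W\<in>index H. hyperbolic_geodesic_space \<delta> (cspace H W) (cdist H W)"
    using assms unfolding hierarchically_hyperbolic_space_def by blast
  obtain \<xi> K \<kappa>\<^sub>0 L E where pos: "0 \<le> \<xi>" "0 \<le> K" "0 \<le> \<kappa>\<^sub>0" "max \<xi> \<kappa>\<^sub>0 \<le> E"
    and proj: "hhs_projections X d H \<xi> K"
    and nesting: "hhs_nesting H \<xi>"
    and orthogonality: "hhs_orthogonality H"
    and consistency: "hhs_consistency X H \<xi> \<kappa>\<^sub>0"
    and large_links: "hhs_large_links X H L E"
    using assms unfolding hierarchically_hyperbolic_space_def by blast
  obtain n where complexity: "hhs_finite_complexity H n"
    using assms unfolding hierarchically_hyperbolic_space_def by blast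
  obtain E' where E': "0 < E'" "hhs_bounded_geodesic_image H E'"
    using assms unfolding hierarchically_hyperbolic_space_def by blast
  obtain \<alpha> where realization: "hhs_partial_realization X H \<alpha>"
    using assms unfolding hierarchically_hyperbolic_space_def by blast
  obtain \<theta> where uniqueness: "hhs_uniqueness X d H \<theta>"
    using assms unfolding hierarchically_hyperbolic_space_def by blast
  interpret X: Metric_space X d using q by (simp add: quasigeodesic_space_def)
  \<comment> \<open>A sum dominates all the bounds required at once. The absolute value is taken
    because \<alpha> carries no sign condition.\<close>
  define k where "k = 1 + 3 * \<xi> + K + \<kappa>\<^sub>0 + E + E' + \<bar>\<alpha>\<bar>"
  have k: "1 \<le> k" "\<kappa>\<^sub>0 + 2 * \<xi> \<le> k" "\<alpha> + 2 * \<xi> \<le> k" "K + \<xi> \<le> k" "E' + \<xi> \<le> k" "E + 2 * \<xi> \<le> k"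
    "K + 2 * \<xi> \<le> k" "K \<le> k"
    using pos E'(1) unfolding k_def by auto
  define \<pi> where "\<pi> = (\<lambda>W x. SOME p. p \<in> proj H W x)"
  define \<rho> where "\<rho> = (\<lambda>V W. SOME p. p \<in> rho H V W)"
  define \<sigma> where "\<sigma> = (\<lambda>W V p. SOME r. r \<in> rho_map H W V p)"
  interpret rel: index_relations "nested H" "orth H" .
  have snest: "rel.snest V W \<longleftrightarrow> strictly_nested H V W" for V W
    by (simp add: rel.snest_def strictly_nested_def)
  have trv: "rel.trv V W \<longleftrightarrow> transverse H V W" for V W
    by (simp add: rel.trv_def transverse_def)
  have hyp: "hyperbolic_geodesic_space \<delta> (cspace H W) (cdist H W)" if "W \<in> index H" for W
    using \<delta>(2) that by blast
  have met: "Metric_space (cspace H W) (cdist H W)" if "W \<in> index H" for W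
    using hyperbolic_metric[OF hyp[OF that]] .
  have nonneg: "0 \<le> cdist H W p r" if "W \<in> index H" for W p r
    using met[OF that] by (simp add: Metric_space_def)
  have comm: "cdist H W p r = cdist H W r p" if "W \<in> index H" for W p r
    using met[OF that] by (simp add: Metric_space_def)
  have cproj: "coarse_point H \<xi> W (proj H W x)" if "W \<in> index H" "x \<in> X" for W x
    using proj that unfolding hhs_projections_def by blast
  have crho: "coarse_point H \<xi> W (rho H V W)"
    if "V \<in> index H" "W \<in> index H" "transverse H V W \<or> strictly_nested H V W" for V W
    using that consistency nesting unfolding hhs_consistency_def hhs_nesting_def by blast
  have \<pi>_in: "\<pi> W x \<in> proj H W x" if "W \<in> index H" "x \<in> X" for W x
    using cproj[OF that] unfolding \<pi>_def coarse_point_def by (simp add: some_in_eq)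
  have \<rho>_in: "\<rho> V W \<in> rho H V W"
    if "V \<in> index H" "W \<in> index H" "transverse H V W \<or> strictly_nested H V W" for V W
    using crho[OF that] unfolding \<rho>_def coarse_point_def by (simp add: some_in_eq)
  have rho_map: "rho_map H W V p \<noteq> {}" "rho_map H W V p \<subseteq> cspace H V"
    if "V \<in> index H" "W \<in> index H" "strictly_nested H V W" "p \<in> cspace H W" for V W p
    using that nesting unfolding hhs_nesting_def by blast+
  have \<sigma>_in: "\<sigma> W V p \<in> rho_map H W V p"
    if "V \<in> index H" "W \<in> index H" "strictly_nested H V W" "p \<in> cspace H W" for V W p
    using rho_map(1)[OF that] unfolding \<sigma>_def by (simp add: some_in_eq)
  have carrier: "A \<subseteq> cspace H W" if "coarse_point H \<xi> W A" for A W
    using that by (simp add: coarse_point_def)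
  have to_set: "cdist H W (\<pi> W x) a \<le> pdist_set H W x A + 2 * \<xi>"
    if "W \<in> index H" "x \<in> X" "coarse_point H \<xi> W A" "a \<in> A" for W x A a
    unfolding pdist_set_def
    by (rule coarse_point_distance[OF met[OF that(1)] cproj[OF that(1,2)] that(3) \<pi>_in[OF that(1,2)] that(4)])
  have point: "coarse_point H \<xi> W {a}" if "W \<in> index H" "a \<in> cspace H W" for W a
    using that pos(1) Metric_space.mdist_zero[OF met[OF that(1)] that(2)]
    by (simp add: coarse_point_def set_diameter_le)
  have from_pdist: "cdist H W (\<pi> W x) (\<pi> W y) \<le> pdist H W x y + 2 * \<xi>"
    if "W \<in> index H" "x \<in> X" "y \<in> X" for W x y
    unfolding pdist_def using to_set[OF that(1,2) cproj \<pi>_in] that by blast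
  have to_pdist: "pdist H W x y \<le> cdist H W (\<pi> W x) (\<pi> W y)"
    if "W \<in> index H" "x \<in> X" "y \<in> X" for W x y
    unfolding pdist_def pdist_set_def
    by (rule set_distance_le) (use nonneg \<pi>_in that in auto)
  have lipschitz: "cdist H W (\<pi> W x) (\<pi> W y) \<le> k * d x y + k"
    if "W \<in> index H" "x \<in> X" "y \<in> X" for W x y
  proof -
    have "pdist H W x y \<le> K * d x y + K" using proj that unfolding hhs_projections_def by blast
    moreover have "K * d x y \<le> k * d x y" using k(8) by (simp add: mult_right_mono)
    ultimately show ?thesis using from_pdist[OF that] k(7) by linarith
  qed
  have uniq: "\<exists>t. \<forall>x\<in>X. \<forall>y\<in>X. (\<forall>W\<in>index H. cdist H W (\<pi> W x) (\<pi> W y) \<le> s) \<longrightarrow> d x y \<le> t"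
    if s: "0 \<le> s" for s
  proof (intro exI ballI impI)
    fix x y assume xy: "x \<in> X" "y \<in> X" "\<forall>W\<in>index H. cdist H W (\<pi> W x) (\<pi> W y) \<le> s"
    \<comment> \<open>Uniqueness yields a coordinate distance of at least its argument, so
      \<open>s + 1\<close> is what contradicts a bound by \<open>s\<close>.\<close>
    show "d x y \<le> \<theta> (s + 1)"
    proof (rule ccontr)
      assume "\<not> ?thesis"
      then have "\<theta> (s + 1) \<le> d x y" "0 \<le> s + 1" using s by auto
      then obtain V where V: "V \<in> index H" "s + 1 \<le> pdist H V x y"
        using uniqueness xy(1,2) unfolding hhs_uniqueness_def by blast
      then show False using to_pdist[OF V(1) xy(1,2)] xy(3) by fastforce
    qed
  qed
  have nest_refl: "nested H W W" if "W \<in> index H" for W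
    using nesting that unfolding hhs_nesting_def reflp_on_def by blast
  have nest_antisym: "V = W" if "V \<in> index H" "W \<in> index H" "nested H V W" "nested H W V" for V W
  proof -
    have "antisymp_on (index H) (nested H)" using nesting unfolding hhs_nesting_def by (elim conjE)
    then show ?thesis using that by (rule antisymp_onD)
  qed
  have nest_trans: "nested H U W"
    if "U \<in> index H" "V \<in> index H" "W \<in> index H" "nested H U V" "nested H V W" for U V W
    using nesting that unfolding hhs_nesting_def transp_on_def by blast
  have orth_sym: "orth H W V" if "V \<in> index H" "W \<in> index H" "orth H V W" for V W
    using orthogonality that unfolding hhs_orthogonality_def symp_on_def by blast
  have "hyperbolic_hhs (nested H) (orth H) X (index H) (cspace H) (cdist H) \<pi> \<rho> \<sigma> k n \<delta>"
  proof (unfold_locales, unfold snest trv)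
    fix W assume W: "W \<in> index H"
    show "geodesic_space (cspace H W) (cdist H W)"
      using hyp[OF W] by (simp add: hyperbolic_geodesic_space_def)
    show "hyperbolic_geodesic_space \<delta> (cspace H W) (cdist H W)" by (rule hyp[OF W])
    show "nested H W W" by (rule nest_refl[OF W])
    fix x assume x: "x \<in> X"
    show "\<pi> W x \<in> cspace H W" using \<pi>_in[OF W x] carrier[OF cproj[OF W x]] by blast
  next
    fix V W assume I: "V \<in> index H" "W \<in> index H"
    show "\<rho> V W \<in> cspace H W" if "transverse H V W \<or> strictly_nested H V W"
      using \<rho>_in[OF I that] carrier[OF crho[OF I that]] by blast
    show "\<sigma> W V p \<in> cspace H V" if "strictly_nested H V W" "p \<in> cspace H W" for p
      using \<sigma>_in[OF I that] rho_map(2)[OF I that] by blast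
    show "V = W" if "nested H V W" "nested H W V" by (rule nest_antisym[OF I that])
    show "orth H W V" if "orth H V W" by (rule orth_sym[OF I that])
    show "\<not> nested H V W" if "orth H V W"
      using orthogonality I that unfolding hhs_orthogonality_def by blast
    fix x assume x: "x \<in> X"
    show "cdist H W (\<pi> W x) (\<rho> V W) \<le> k \<or> cdist H V (\<pi> V x) (\<rho> W V) \<le> k" if t: "transverse H V W"
    proof -
      have t': "transverse H W V" using t orth_sym I unfolding transverse_def by blast
      have "min (pdist_set H W x (rho H V W)) (pdist_set H V x (rho H W V)) \<le> \<kappa>\<^sub>0"
        using consistency I t x unfolding hhs_consistency_def by blast
      then show ?thesis
        using to_set[OF I(2) x crho[OF I disjI1[OF t]] \<rho>_in[OF I disjI1[OF t]]]
          to_set[OF I(1) x crho[OF I(2,1) disjI1[OF t']] \<rho>_in[OF I(2,1) disjI1[OF t']]] k(2)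
        by linarith
    qed
    show "cdist H W (\<pi> W x) (\<rho> V W) \<le> k \<or> cdist H V (\<pi> V x) (\<sigma> W V (\<pi> W x)) \<le> k"
      if s: "strictly_nested H V W"
    proof -
      have "min (ereal (pdist_set H W x (rho H V W)))
          (set_diameter (cdist H V) (proj H V x \<union> (\<Union>p\<in>proj H W x. rho_map H W V p))) \<le> ereal \<kappa>\<^sub>0"
        using consistency I s x unfolding hhs_consistency_def by blast
      then consider "pdist_set H W x (rho H V W) \<le> \<kappa>\<^sub>0"
        | "set_diameter (cdist H V) (proj H V x \<union> (\<Union>p\<in>proj H W x. rho_map H W V p)) \<le> ereal \<kappa>\<^sub>0"
        by (auto simp: min_le_iff_disj)
      then show ?thesis
      proof cases
        case 1
        then show ?thesis
          using to_set[OF I(2) x crho[OF I disjI2[OF s]] \<rho>_in[OF I disjI2[OF s]]] k(2) by linarith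
      next
        case 2
        have "\<pi> W x \<in> cspace H W" using \<pi>_in[OF I(2) x] carrier[OF cproj[OF I(2) x]] by blast
        then have "\<sigma> W V (\<pi> W x) \<in> (\<Union>p\<in>proj H W x. rho_map H W V p)"
          using \<sigma>_in[OF I s] \<pi>_in[OF I(2) x] by blast
        then have "cdist H V (\<pi> V x) (\<sigma> W V (\<pi> W x)) \<le> \<kappa>\<^sub>0"
          using 2 \<pi>_in[OF I(1) x] unfolding set_diameter_le by blast
        then show ?thesis using k(2) pos(1) by linarith
      qed
    qed
  next
    fix U V W assume I: "U \<in> index H" "V \<in> index H" "W \<in> index H"
    show "nested H U W" if "nested H U V" "nested H V W" by (rule nest_trans[OF I that])
    show "orth H V U" if "nested H V W" "orth H W U"
      using orthogonality I that unfolding hhs_orthogonality_def by blast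
    assume *: "nested H U V" "transverse H V W" "\<not> orth H W U"
    \<comment> \<open>The set attached to \<open>U\<close> in \<open>C W\<close> is known to be a
      coarse point only for transverse or properly nested pairs, so one of these cases has to be
      established.\<close>
    have "\<not> orth H U W" "\<not> nested H W U"
      using * orth_sym[of U W] nest_trans[of W U V] I unfolding transverse_def by blast+
    then have UW: "transverse H U W \<or> strictly_nested H U W"
      using nest_refl[OF I(1)] unfolding transverse_def strictly_nested_def by blast
    have "set_distance (cdist H W) (rho H U W) (rho H V W) \<le> \<kappa>\<^sub>0"
      using consistency I * unfolding hhs_consistency_def by blast
    then show "cdist H W (\<rho> U W) (\<rho> V W) \<le> k"
      using coarse_point_distance[OF met[OF I(3)] crho[OF I(1,3) UW] crho[OF I(2,3) disjI1[OF *(2)]]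
          \<rho>_in[OF I(1,3) UW] \<rho>_in[OF I(2,3) disjI1[OF *(2)]]] k(2) by linarith
  next
    fix V W p r P
    assume I: "V \<in> index H" "W \<in> index H" and s: "strictly_nested H V W"
      and P: "geodesic_between (cspace H W) (cdist H W) p r P"
      and far: "\<And>z. z \<in> P \<Longrightarrow> k < cdist H W z (\<rho> V W)"
    have pr: "p \<in> P" "r \<in> P" using geodesic_between_ends[OF P] by auto
    have "P \<inter> nbhd (cspace H W) (cdist H W) E' (rho H V W) = {}"
    proof (rule ccontr)
      assume "\<not> ?thesis"
      then obtain z a where z: "z \<in> P" "z \<in> cspace H W" "a \<in> rho H V W" "cdist H W z a \<le> E'"
        unfolding nbhd_def by blast
      have c: "coarse_point H \<xi> W (rho H V W)" and \<rho>: "\<rho> V W \<in> rho H V W"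
        using crho[OF I disjI2[OF s]] \<rho>_in[OF I disjI2[OF s]] .
      have "cdist H W a (\<rho> V W) \<le> \<xi>" using c z(3) \<rho> by (simp add: coarse_point_def set_diameter_le)
      moreover have "cdist H W z (\<rho> V W) \<le> cdist H W z a + cdist H W a (\<rho> V W)"
        using Metric_space.triangle[OF met[OF I(2)] z(2)] carrier[OF c] z(3) \<rho> by blast
      ultimately show False using far[OF z(1)] z(4) k(5) by linarith
    qed
    then have "set_diameter (cdist H V) (\<Union>z\<in>P. rho_map H W V z) \<le> ereal E'"
      using E'(2) I s P unfolding hhs_bounded_geodesic_image_def by blast
    moreover have "\<sigma> W V p \<in> (\<Union>z\<in>P. rho_map H W V z)" "\<sigma> W V r \<in> (\<Union>z\<in>P. rho_map H W V z)"
      using \<sigma>_in[OF I s] geodesic_between_point(1)[OF P] pr by blast+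
    ultimately have "cdist H V (\<sigma> W V p) (\<sigma> W V r) \<le> E'" unfolding set_diameter_le by blast
    then show "cdist H V (\<sigma> W V p) (\<sigma> W V r) \<le> k" using k(5) pos(1) by linarith
  next
    fix F f
    assume F: "F \<subseteq> index H" "pairwise (orth H) F" and f: "\<And>U. U \<in> F \<Longrightarrow> f U \<in> X"
    define p where "p = (\<lambda>U. \<pi> U (f U))"
    have p: "p U \<in> proj_image H U X" if "U \<in> F" for U
      using \<pi>_in f F(1) that unfolding p_def proj_image_def by blast
    have "pairwise (orth H) F \<and> (\<forall>V\<in>F. p V \<in> proj_image H V X)" using F(2) p by blast
    from realization[unfolded hhs_partial_realization_def, rule_format, OF F(1) this]
    obtain x where x: "x \<in> X" "\<forall>U\<in>F. pdist_set H U x {p U} \<le> \<alpha> \<and>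
           (\<forall>V\<in>index H. strictly_nested H U V \<or> transverse H V U \<longrightarrow>
              pdist_set H V x (rho H U V) \<le> \<alpha>)"
      by (elim bexE)
    have "cdist H U (\<pi> U x) (\<pi> U (f U)) \<le> k" if U: "U \<in> F" for U
    proof -
      have UI: "U \<in> index H" using U F by blast
      have "p U \<in> cspace H U"
        using \<pi>_in[OF UI f[OF U]] carrier[OF cproj[OF UI f[OF U]]] unfolding p_def by blast
      then have "cdist H U (\<pi> U x) (p U) \<le> pdist_set H U x {p U} + 2 * \<xi>"
        by (intro to_set[OF UI x(1) point[OF UI]]) auto
      then show ?thesis using x(2) U k(3) unfolding p_def by fastforce
    qed
    moreover have "cdist H V (\<pi> V x) (\<rho> U V) \<le> k"
      if "U \<in> F" "V \<in> index H" "transverse H V U \<or> strictly_nested H U V" for U V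
    proof -
      have UI: "U \<in> index H" using that F by blast
      have t: "transverse H U V \<or> strictly_nested H U V"
        using that(2,3) orth_sym UI unfolding transverse_def by blast
      have "pdist_set H V x (rho H U V) \<le> \<alpha>" using x(2) that by blast
      then show ?thesis
        using to_set[OF that(2) x(1) crho[OF UI that(2) t] \<rho>_in[OF UI that(2) t]] k(3) by linarith
    qed
    ultimately show "\<exists>x\<in>X. \<forall>U\<in>F. cdist H U (\<pi> U x) (\<pi> U (f U)) \<le> k \<and>
        (\<forall>V\<in>index H. transverse H V U \<or> strictly_nested H U V \<longrightarrow> cdist H V (\<pi> V x) (\<rho> U V) \<le> k)"
      using x(1) by blast
  next
    fix A
    assume "A \<subseteq> index H" "\<And>V W. V \<in> A \<Longrightarrow> W \<in> A \<Longrightarrow> nested H V W \<or> nested H W V"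
    then show "finite A \<and> card A \<le> n" using complexity unfolding hhs_finite_complexity_def by blast
  next
    assume "index H \<noteq> {}"
    then have "\<exists>!M. M \<in> index H \<and> (\<forall>V\<in>index H. nested H M V \<longrightarrow> V = M)"
      using nesting unfolding hhs_nesting_def by blast
    then show "\<exists>M\<in>index H. \<forall>W\<in>index H. (\<forall>V\<in>index H. nested H W V \<longrightarrow> V = W) \<longrightarrow> W = M" by blast
  next
    fix T U
    assume T: "T \<in> index H" and U: "U \<in> index H" "nested H U T"
      and ex: "\<exists>V\<in>index H. nested H V T \<and> orth H V U"
    have "U \<in> below H T" "{V \<in> below H T. orth H V U} \<noteq> {}" using U ex by (auto simp: below_def)
    then obtain W where W: "W \<in> below H T - {T}" "\<forall>V\<in>below H T. orth H V U \<longrightarrow> nested H V W"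
      using orthogonality T unfolding hhs_orthogonality_def by meson
    then show "\<exists>W\<in>index H. strictly_nested H W T \<and>
        (\<forall>V\<in>index H. nested H V T \<and> orth H V U \<longrightarrow> nested H V W)"
      unfolding below_def strictly_nested_def by blast
  next
    show "0 \<le> \<delta>" "1 \<le> k" using \<delta>(1) k(1) .
  next
    fix W x y P z
    assume W: "W \<in> index H" and X: "x \<in> X" "y \<in> X"
      and P: "geodesic_between (cspace H W) (cdist H W) (\<pi> W x) (\<pi> W y) P" and z: "z \<in> P"
    have "quasiconvex K (cspace H W) (cdist H W) (proj_image H W X)"
      using proj W unfolding hhs_projections_def by blast
    moreover have "\<pi> W x \<in> proj_image H W X" "\<pi> W y \<in> proj_image H W X"
      using \<pi>_in[OF W] X unfolding proj_image_def by blast+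
    ultimately have "z \<in> nbhd (cspace H W) (cdist H W) K (proj_image H W X)"
      using P z unfolding quasiconvex_def by blast
    then obtain a w where w: "w \<in> X" "a \<in> proj H W w" "cdist H W z a \<le> K" "z \<in> cspace H W"
      unfolding nbhd_def proj_image_def by blast
    have "cdist H W a (\<pi> W w) \<le> \<xi>"
      using cproj[OF W w(1)] w(2) \<pi>_in[OF W w(1)] by (simp add: coarse_point_def set_diameter_le)
    moreover have "cdist H W z (\<pi> W w) \<le> cdist H W z a + cdist H W a (\<pi> W w)"
      using Metric_space.triangle[OF met[OF W] w(4)] carrier[OF cproj[OF W w(1)]] w(2) \<pi>_in[OF W w(1)]
      by blast
    ultimately have "cdist H W z (\<pi> W w) \<le> k" using w(3) k(4) by linarith
    then show "\<exists>w\<in>X. cdist H W z (\<pi> W w) \<le> k" using w(1) by blast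
  next
    fix W x y
    assume W: "W \<in> index H" and X: "x \<in> X" "y \<in> X"
    obtain \<T> where \<T>: "\<T> \<subseteq> below H W - {W}" "finite \<T>"
      "\<forall>T\<in>below H W - {W}. (\<exists>T'\<in>\<T>. T \<in> below H T') \<or> pdist H T x y < E"
      using large_links W X unfolding hhs_large_links_def Let_def by meson
    have "\<exists>U\<in>\<T>. nested H V U"
      if V: "V \<in> index H" "strictly_nested H V W" "k < cdist H V (\<pi> V x) (\<pi> V y)" for V
    proof -
      have "V \<in> below H W - {W}" using V by (simp add: below_def strictly_nested_def)
      moreover have "\<not> pdist H V x y < E" using from_pdist[OF V(1) X] V(3) k(6) by linarith
      ultimately show ?thesis using \<T>(3) by (auto simp: below_def)
    qed
    moreover have "\<forall>V\<in>\<T>. V \<in> index H \<and> strictly_nested H V W"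
      using \<T>(1) by (auto simp: below_def strictly_nested_def)
    ultimately show "\<exists>\<T>. finite \<T> \<and> (\<forall>V\<in>\<T>. V \<in> index H \<and> strictly_nested H V W) \<and>
        (\<forall>V\<in>index H. strictly_nested H V W \<and> k < cdist H V (\<pi> V x) (\<pi> V y) \<longrightarrow> (\<exists>U\<in>\<T>. nested H V U))"
      using \<T>(2) by blast
  qed
  then show ?thesis using lipschitz uniq by blast
qed

text \<open>Bounds in \<open>X\<close> pass to all coordinates by the Lipschitz property, the
  coordinates of \<open>B\<close> are controlled there, and uniqueness brings the result back to
  \<open>X\<close>.\<close>

lemma hierarchically_hyperbolic_space_meet:
  assumes "hierarchically_hyperbolic_space X d H" and e: "e \<in> X"
  shows "\<exists>B. (\<forall>x\<in>X. \<forall>y\<in>X. B x y \<in> X) \<and>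
    (\<exists>t. \<forall>x\<in>X. d (B x x) x \<le> t \<and> d (B e x) e \<le> t \<and> d (B x e) e \<le> t) \<and>
    (\<forall>s\<ge>0. \<exists>t. \<forall>x\<in>X. \<forall>x'\<in>X. \<forall>y\<in>X. \<forall>y'\<in>X.
       d x x' \<le> s \<longrightarrow> d y y' \<le> s \<longrightarrow> d (B x y) (B x' y') \<le> t)"
proof -
  from hierarchically_hyperbolic_space_points[OF assms(1)]
  obtain \<pi> \<rho> \<sigma> k n \<delta> where
    hhs: "hyperbolic_hhs (nested H) (orth H) X (index H) (cspace H) (cdist H) \<pi> \<rho> \<sigma> k n \<delta>"
    and lipschitz: "\<forall>W\<in>index H. \<forall>x\<in>X. \<forall>y\<in>X. cdist H W (\<pi> W x) (\<pi> W y) \<le> k * d x y + k"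
    and uniq: "\<forall>s\<ge>0. \<exists>t. \<forall>x\<in>X. \<forall>y\<in>X.
      (\<forall>W\<in>index H. cdist H W (\<pi> W x) (\<pi> W y) \<le> s) \<longrightarrow> d x y \<le> t"
    by (elim exE conjE)
  interpret hyperbolic_hhs "nested H" "orth H" X "index H" "cspace H" "cdist H" \<pi> \<rho> \<sigma> k n \<delta>
    by (rule hhs)
  from coarse_meet_exists[OF e]
  obtain B t where B: "\<forall>x\<in>X. \<forall>y\<in>X. B x y \<in> X"
    and deg: "\<forall>W\<in>index H. \<forall>x\<in>X. cdist H W (\<pi> W (B x x)) (\<pi> W x) \<le> t \<and>
      cdist H W (\<pi> W (B e x)) (\<pi> W e) \<le> t \<and> cdist H W (\<pi> W (B x e)) (\<pi> W e) \<le> t"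
    and lip: "\<forall>W\<in>index H. \<forall>x\<in>X. \<forall>x'\<in>X. \<forall>y\<in>X. \<forall>y'\<in>X. \<forall>s\<ge>0.
       cdist H W (\<pi> W x) (\<pi> W x') \<le> s \<longrightarrow> cdist H W (\<pi> W y) (\<pi> W y') \<le> s \<longrightarrow>
       cdist H W (\<pi> W (B x y)) (\<pi> W (B x' y')) \<le> t + 8 * s"
    by (elim exE conjE)
  \<comment> \<open>The maximum with 0 supplies the nonnegative argument required by
    \<open>uniq\<close>, as nothing is known about the sign of \<open>t\<close>.\<close>
  obtain t1 where t1: "\<And>x y. x \<in> X \<Longrightarrow> y \<in> X \<Longrightarrow>
      (\<forall>W\<in>index H. cdist H W (\<pi> W x) (\<pi> W y) \<le> max 0 t) \<Longrightarrow> d x y \<le> t1"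
    using uniq[rule_format, of "max 0 t"] by auto
  have 1: "d (B x x) x \<le> t1" "d (B e x) e \<le> t1" "d (B x e) e \<le> t1" if x: "x \<in> X" for x
    using deg x B e by (auto intro!: t1 simp: le_max_iff_disj)
  have 2: "\<exists>t. \<forall>x\<in>X. \<forall>x'\<in>X. \<forall>y\<in>X. \<forall>y'\<in>X.
       d x x' \<le> s \<longrightarrow> d y y' \<le> s \<longrightarrow> d (B x y) (B x' y') \<le> t" if s: "0 \<le> s" for s
  proof -
    define s' where "s' = k * s + k"
    have s': "0 \<le> s'" using s k by (simp add: s'_def)
    obtain t2 where t2: "\<And>x y. x \<in> X \<Longrightarrow> y \<in> X \<Longrightarrow>
        (\<forall>W\<in>index H. cdist H W (\<pi> W x) (\<pi> W y) \<le> max 0 (t + 8 * s')) \<Longrightarrow> d x y \<le> t2"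
      using uniq[rule_format, of "max 0 (t + 8 * s')"] by auto
    have step: "cdist H W (\<pi> W x) (\<pi> W y) \<le> s'"
      if "W \<in> index H" "x \<in> X" "y \<in> X" "d x y \<le> s" for W x y
    proof -
      have "k * d x y \<le> k * s" using that(4) k by (intro mult_left_mono) auto
      then show ?thesis using lipschitz[rule_format, OF that(1-3)] unfolding s'_def by linarith
    qed
    have "d (B x y) (B x' y') \<le> t2"
      if X: "x \<in> X" "x' \<in> X" "y \<in> X" "y' \<in> X" "d x x' \<le> s" "d y y' \<le> s" for x x' y y'
    proof (rule t2)
      show "\<forall>W\<in>index H. cdist H W (\<pi> W (B x y)) (\<pi> W (B x' y')) \<le> max 0 (t + 8 * s')"
      proof
        fix W assume W: "W \<in> index H"
        have "cdist H W (\<pi> W (B x y)) (\<pi> W (B x' y')) \<le> t + 8 * s'"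
          using lip[rule_format, OF W X(1-4) s' step[OF W X(1,2,5)] step[OF W X(3,4,6)]] .
        then show "cdist H W (\<pi> W (B x y)) (\<pi> W (B x' y')) \<le> max 0 (t + 8 * s')" by simp
      qed
    qed (use B X in auto)
    then show ?thesis by blast
  qed
  show ?thesis using B 1 2 by (intro exI[of _ B]) blast
qed

text \<open>\<open>f\<close> plays the role of an orbit map. The assumption \<open>bounded\<close>
  controls how right multiplication moves its values, and \<open>proper\<close> turns bounded
  distances in \<open>X\<close> back into finite sets of differences in the group.\<close>

lemma (in group) coarse_meet_transfer:
  fixes f :: "'a \<Rightarrow> 'x"
  assumes hhs: "hierarchically_hyperbolic_space X d H"
    and f: "f \<in> carrier G \<rightarrow> X" and coarsely_onto: "\<forall>x\<in>X. \<exists>g\<in>carrier G. d (f g) x \<le> r"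
    and bounded: "\<And>a. a \<in> carrier G \<Longrightarrow> \<exists>s. \<forall>g\<in>carrier G. d (f g) (f (g \<otimes> a)) \<le> s"
    and proper: "\<And>s. finite {inv g \<otimes> h | g h. g \<in> carrier G \<and> h \<in> carrier G \<and> d (f g) (f h) \<le> s}"
  shows "\<exists>\<beta>. coarse_meet G \<beta>"
proof -
  interpret Metric_space X d
    using hhs unfolding hierarchically_hyperbolic_space_def quasigeodesic_space_def by blast
  have fX: "f g \<in> X" if "g \<in> carrier G" for g using f that by blast
  from hierarchically_hyperbolic_space_meet[OF hhs fX[OF one_closed]]
  obtain B t where B': "\<forall>x\<in>X. \<forall>y\<in>X. B x y \<in> X"
    and deg: "\<forall>x\<in>X. d (B x x) x \<le> t \<and> d (B (f \<one>) x) (f \<one>) \<le> t \<and> d (B x (f \<one>)) (f \<one>) \<le> t"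
    and lip: "\<forall>s\<ge>0. \<exists>t. \<forall>x\<in>X. \<forall>x'\<in>X. \<forall>y\<in>X. \<forall>y'\<in>X.
       d x x' \<le> s \<longrightarrow> d y y' \<le> s \<longrightarrow> d (B x y) (B x' y') \<le> t"
    by (elim exE conjE)
  have B: "B x y \<in> X" if "x \<in> X" "y \<in> X" for x y using B' that by blast
  obtain c where c: "\<And>x. x \<in> X \<Longrightarrow> c x \<in> carrier G \<and> d (f (c x)) x \<le> r"
    using coarsely_onto by metis
  \<comment> \<open>The values on the axes and on the diagonal are overwritten to make the
    identities exact. There \<open>B\<close> is within \<open>t\<close> of the new values, so
    \<beta> still follows \<open>B\<close> with error \<open>u\<close>.\<close>
  define \<beta> where "\<beta> g h = (if g = \<one> \<or> h = \<one> then \<one> else if g = h then g else c (B (f g) (f h)))" for g h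
  define u where "u = max r t"
  have \<beta>c: "\<beta> g h \<in> carrier G" if "g \<in> carrier G" "h \<in> carrier G" for g h
    using that c B fX by (simp add: \<beta>_def)
  have near: "d (f (\<beta> g h)) (B (f g) (f h)) \<le> u" if "g \<in> carrier G" "h \<in> carrier G" for g h
  proof -
    consider "g = \<one>" | "h = \<one>" | "g = h" "g \<noteq> \<one>" | "g \<noteq> \<one>" "h \<noteq> \<one>" "g \<noteq> h" by blast
    then show ?thesis
    proof cases
      case 4
      then show ?thesis using c[OF B[OF fX[OF that(1)] fX[OF that(2)]]] by (auto simp: \<beta>_def u_def)
    qed (use deg[rule_format, OF fX[OF that(1)]] deg[rule_format, OF fX[OF that(2)]]
        commute[of _ "B (f g) (f h)"] in \<open>simp_all add: \<beta>_def u_def le_max_iff_disj\<close>)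
  qed
  have "\<exists>J. finite J \<and> J \<subseteq> carrier G \<and> (\<forall>g\<in>carrier G. \<forall>h\<in>carrier G. \<forall>a\<in>A.
      inv \<beta> g h \<otimes> \<beta> (g \<otimes> a) h \<in> J \<and> inv \<beta> g h \<otimes> \<beta> g (h \<otimes> a) \<in> J)"
    if A: "finite A" "A \<subseteq> carrier G" for A
  proof -
    obtain s where s: "\<And>a g. a \<in> A \<Longrightarrow> g \<in> carrier G \<Longrightarrow> d (f g) (f (g \<otimes> a)) \<le> s a"
      using bounded A(2) by (metis subsetD)
    define s' where "s' = Max (insert 0 (s ` A))"
    have s': "0 \<le> s'" "\<And>a. a \<in> A \<Longrightarrow> s a \<le> s'" using A(1) by (auto simp: s'_def)
    obtain t' where t': "\<And>x x' y y'. x \<in> X \<Longrightarrow> x' \<in> X \<Longrightarrow> y \<in> X \<Longrightarrow> y' \<in> X \<Longrightarrow>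
        d x x' \<le> s' \<Longrightarrow> d y y' \<le> s' \<Longrightarrow> d (B x y) (B x' y') \<le> t'"
      using lip[rule_format, OF s'(1)] by blast
    define J where "J = {inv g \<otimes> h | g h. g \<in> carrier G \<and> h \<in> carrier G \<and> d (f g) (f h) \<le> 2 * u + t'}"
    have J: "inv \<beta> g h \<otimes> \<beta> g' h' \<in> J"
      if C: "g \<in> carrier G" "h \<in> carrier G" "g' \<in> carrier G" "h' \<in> carrier G"
        and "d (f g) (f g') \<le> s'" "d (f h) (f h') \<le> s'" for g h g' h'
    proof -
      have 1: "d (B (f g) (f h)) (B (f g') (f h')) \<le> t'"
        using t' fX that by blast
      note X = fX[OF \<beta>c[OF C(1,2)]] fX[OF \<beta>c[OF C(3,4)]] B[OF fX[OF C(1)] fX[OF C(2)]] B[OF fX[OF C(3)] fX[OF C(4)]]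
      have "d (f (\<beta> g h)) (f (\<beta> g' h')) \<le> 2 * u + t'"
        using triangle[OF X(1,3,2)] triangle[OF X(3,4,2)] near[OF C(1,2)] near[OF C(3,4)] 1
          commute[of "B (f g') (f h')" "f (\<beta> g' h')"] by linarith
      then show ?thesis using \<beta>c C unfolding J_def by blast
    qed
    have "inv \<beta> g h \<otimes> \<beta> (g \<otimes> a) h \<in> J \<and> inv \<beta> g h \<otimes> \<beta> g (h \<otimes> a) \<in> J"
      if g: "g \<in> carrier G" and h: "h \<in> carrier G" and a: "a \<in> A" for g h a
    proof
      have ac: "a \<in> carrier G" using a A by blast
      have *: "d (f g) (f g) \<le> s'" "d (f h) (f h) \<le> s'" using fX g h s'(1) by simp_all
      have **: "d (f g) (f (g \<otimes> a)) \<le> s'" "d (f h) (f (h \<otimes> a)) \<le> s'"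
        using s[OF a g] s[OF a h] s'(2)[OF a] by linarith+
      show "inv \<beta> g h \<otimes> \<beta> (g \<otimes> a) h \<in> J" by (rule J[OF g h m_closed[OF g ac] h **(1) *(2)])
      show "inv \<beta> g h \<otimes> \<beta> g (h \<otimes> a) \<in> J" by (rule J[OF g h g m_closed[OF h ac] *(1) **(2)])
    qed
    moreover have "finite J" unfolding J_def by (rule proper)
    moreover have "J \<subseteq> carrier G" unfolding J_def by auto
    ultimately show ?thesis by (intro exI[of _ J]) simp
  qed
  moreover have "\<beta> g g = g \<and> \<beta> \<one> g = \<one> \<and> \<beta> g \<one> = \<one>" for g by (simp add: \<beta>_def)
  ultimately have "coarse_meet G \<beta>" unfolding coarse_meet_def using \<beta>c by simp
  then show ?thesis by blast
qed

section \<open>Coarse meets from word metrics and from quasi-actions\<close>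

lemma (in group) generate_word:
  assumes "A \<subseteq> carrier G" "g \<in> generate G A"
  shows "\<exists>ws. set ws \<subseteq> A \<union> m_inv G ` A \<and> foldr (mult G) ws \<one> = g"
  using assms(2)
proof (induction rule: generate.induct)
  case one
  show ?case by (rule exI[of _ "[]"]) simp
next
  case (incl h)
  then show ?case using assms(1) by (intro exI[of _ "[h]"]) auto
next
  case (inv h)
  then show ?case using assms(1) by (intro exI[of _ "[inv h]"]) auto
next
  case (eng g h)
  then obtain us vs where *: "set us \<subseteq> A \<union> m_inv G ` A" "foldr (mult G) us \<one> = g"
    "set vs \<subseteq> A \<union> m_inv G ` A" "foldr (mult G) vs \<one> = h" by blast
  have "h \<in> carrier G" using eng(2) assms(1) generate_in_carrier by blast
  moreover have "set us \<subseteq> carrier G" using *(1) assms(1) by auto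
  ultimately have "foldr (mult G) us h = foldr (mult G) us \<one> \<otimes> h \<and> foldr (mult G) us \<one> \<in> carrier G"
  proof (induction us)
    case (Cons u us)
    then show ?case by (simp add: m_assoc)
  qed simp
  then have "foldr (mult G) (us @ vs) \<one> = g \<otimes> h" using * by simp
  then show ?case using * by (intro exI[of _ "us @ vs"]) auto
qed

lemma (in group) finite_word_ball:
  assumes A: "finite A" "A \<subseteq> carrier G" "generate G A = carrier G"
  shows "finite {g \<in> carrier G. word_length G A g \<le> m}"
proof (rule finite_subset)
  let ?W = "{ws. set ws \<subseteq> A \<union> m_inv G ` A \<and> length ws \<le> m}"
  show "finite ((\<lambda>ws. foldr (mult G) ws \<one>) ` ?W)"
    using A(1) by (intro finite_imageI finite_lists_length_le) auto
  show "{g \<in> carrier G. word_length G A g \<le> m} \<subseteq> (\<lambda>ws. foldr (mult G) ws \<one>) ` ?W"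
  proof
    fix g assume g: "g \<in> {g \<in> carrier G. word_length G A g \<le> m}"
    have "\<exists>n ws. length ws = n \<and> set ws \<subseteq> A \<union> m_inv G ` A \<and> foldr (mult G) ws \<one> = g"
      using generate_word[OF A(2)] A(3) g by blast
    then have "\<exists>ws. length ws = word_length G A g \<and> set ws \<subseteq> A \<union> m_inv G ` A \<and> foldr (mult G) ws \<one> = g"
      unfolding word_length_def by (rule LeastI_ex)
    then show "g \<in> (\<lambda>ws. foldr (mult G) ws \<one>) ` ?W" using g by auto
  qed
qed

text \<open>Here the coarse equivalence is the identity: right multiplication by \<open>a\<close>
  moves every element by the length of \<open>a\<close>, and balls of the word metric are
  finite.\<close>

lemma (in group) word_metric_coarse_meet:
  assumes A: "finite A" "A \<subseteq> carrier G" "generate G A = carrier G"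
    and hhs: "hierarchically_hyperbolic_space (carrier G) (word_metric G A) H"
  shows "\<exists>\<beta>. coarse_meet G \<beta>"
proof (rule coarse_meet_transfer[OF hhs, where f = "\<lambda>g. g" and r = 0])
  interpret M: Metric_space "carrier G" "word_metric G A"
    using hhs unfolding hierarchically_hyperbolic_space_def quasigeodesic_space_def by blast
  show "\<forall>x\<in>carrier G. \<exists>g\<in>carrier G. word_metric G A g x \<le> 0" using M.mdist_zero by force
  show "\<exists>s. \<forall>g\<in>carrier G. word_metric G A g (g \<otimes> a) \<le> s" if "a \<in> carrier G" for a
    using that by (intro exI[of _ "real (word_length G A a)"]) (simp add: word_metric_def m_assoc[symmetric])
  fix s
  have "{inv g \<otimes> h | g h. g \<in> carrier G \<and> h \<in> carrier G \<and> word_metric G A g h \<le> s} \<subseteq>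
      {g \<in> carrier G. word_length G A g \<le> nat \<lfloor>s\<rfloor>}"
    by (auto simp: word_metric_def le_nat_floor)
  then show "finite {inv g \<otimes> h | g h. g \<in> carrier G \<and> h \<in> carrier G \<and> word_metric G A g h \<le> s}"
    by (rule finite_subset) (rule finite_word_ball[OF A])
qed simp

text \<open>The orbit map of a base point satisfies the transfer conditions: coboundedness makes it
  coarsely onto, the uniform constants of the quasi-action bound the effect of right multiplication,
  and metric properness provides the finite sets.\<close>

lemma (in group) hierarchically_hyperbolic_group_coarse_meet:
  assumes "hierarchically_hyperbolic_group G X d H"
  shows "\<exists>\<beta>. coarse_meet G \<beta>"
proof -
  have hhs: "hierarchically_hyperbolic_space X d H"
    using assms by (simp add: hierarchically_hyperbolic_group_def)
  obtain F where F: "uniform_quasi_action G X d F" "metrically_proper G X d F" "cobounded G X d F"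
    using assms unfolding hierarchically_hyperbolic_group_def by blast
  interpret Metric_space X d
    using hhs unfolding hierarchically_hyperbolic_space_def quasigeodesic_space_def by blast
  obtain l c where l: "1 \<le> l" "0 \<le> c"
    and qi: "\<And>g. g \<in> carrier G \<Longrightarrow> quasi_isometry l c X d X d (F g)"
    and F1: "\<And>x. x \<in> X \<Longrightarrow> d (F \<one> x) x \<le> c"
    and Fmult: "\<And>g h x. g \<in> carrier G \<Longrightarrow> h \<in> carrier G \<Longrightarrow> x \<in> X \<Longrightarrow> d (F g (F h x)) (F (g \<otimes> h) x) \<le> c"
    using F(1) unfolding uniform_quasi_action_def by blast
  have FX: "F g x \<in> X" if "g \<in> carrier G" "x \<in> X" for g x
    using qi[OF that(1)] that(2) unfolding quasi_isometry_def qi_embedding_def by blast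
  have Flip: "d (F g x) (F g y) \<le> l * d x y + c" if "g \<in> carrier G" "x \<in> X" "y \<in> X" for g x y
    using qi[OF that(1)] that(2,3) unfolding quasi_isometry_def qi_embedding_def by blast
  obtain x r where x: "x \<in> X" and onto: "\<forall>y\<in>X. \<exists>g\<in>carrier G. d (F g x) y \<le> r"
    using F(3) unfolding cobounded_def by blast
  show ?thesis
  proof (rule coarse_meet_transfer[OF hhs _ onto])
    show "(\<lambda>g. F g x) \<in> carrier G \<rightarrow> X" using FX x by blast
    show "\<exists>s. \<forall>g\<in>carrier G. d (F g x) (F (g \<otimes> a) x) \<le> s" if a: "a \<in> carrier G" for a
    proof (intro exI ballI)
      fix g assume g: "g \<in> carrier G"
      show "d (F g x) (F (g \<otimes> a) x) \<le> l * d x (F a x) + c + c"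
        using triangle[OF FX[OF g x] FX[OF g FX[OF a x]] FX[OF m_closed[OF g a] x]]
          Flip[OF g x FX[OF a x]] Fmult[OF g a x] by linarith
    qed
    fix s
    \<comment> \<open>Applying \<open>F (inv g)\<close> to both orbit points costs
      \<open>l * s + c\<close>. One more \<open>c\<close> each comes from combining
      \<open>inv g\<close> with \<open>h\<close>, combining \<open>inv g\<close> with
      \<open>g\<close>, and comparing \<open>F \<one> x\<close> with \<open>x\<close>. The maximum
      with 0 keeps \<open>x\<close> inside its own ball.\<close>
    define u where "u = max 0 (l * s + 4 * c)"
    have "inv g \<otimes> h \<in> {a \<in> carrier G. F a ` nbhd X d u {x} \<inter> nbhd X d u {x} \<noteq> {}}"
      if g: "g \<in> carrier G" and h: "h \<in> carrier G" and s: "d (F g x) (F h x) \<le> s" for g h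
    proof -
      have ig: "inv g \<in> carrier G" and gh: "inv g \<otimes> h \<in> carrier G" using g h by auto
      note P = FX[OF gh x] FX[OF ig FX[OF h x]] FX[OF ig FX[OF g x]] FX[OF one_closed x]
      have "d (F (inv g \<otimes> h) x) (F (inv g) (F h x)) \<le> c"
        using Fmult[OF ig h x] commute by metis
      moreover have "d (F (inv g) (F h x)) (F (inv g) (F g x)) \<le> l * s + c"
      proof -
        have "l * d (F h x) (F g x) \<le> l * s" using s l commute[of "F h x"] by (intro mult_left_mono) auto
        then show ?thesis using Flip[OF ig FX[OF h x] FX[OF g x]] by linarith
      qed
      moreover have "d (F (inv g) (F g x)) (F \<one> x) \<le> c"
        using Fmult[OF ig g x] l_inv[OF g] by simp
      ultimately have "d (F (inv g \<otimes> h) x) x \<le> l * s + 4 * c"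
        using triangle[OF P(1,2) x] triangle[OF P(2,3) x] triangle[OF P(3,4) x] F1[OF x] by linarith
      then have "F (inv g \<otimes> h) x \<in> nbhd X d u {x}" using P(1) by (simp add: nbhd_def u_def)
      moreover have "x \<in> nbhd X d u {x}" using x by (simp add: nbhd_def u_def)
      ultimately show ?thesis using gh by blast
    qed
    then have "{inv g \<otimes> h | g h. g \<in> carrier G \<and> h \<in> carrier G \<and> d (F g x) (F h x) \<le> s} \<subseteq>
        {a \<in> carrier G. F a ` nbhd X d u {x} \<inter> nbhd X d u {x} \<noteq> {}}" by blast
    then show "finite {inv g \<otimes> h | g h. g \<in> carrier G \<and> h \<in> carrier G \<and> d (F g x) (F h x) \<le> s}"
      using F(2) x unfolding metrically_proper_def by (meson finite_subset)
  qed
qed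

theorem corollary7p5:
  fixes G :: "('g, 'm) monoid_scheme"
    and H :: "('g, 'i, 'c) hh_structure"
    and X :: "'x set" and d :: "'x \<Rightarrow> 'x \<Rightarrow> real"
    and H' :: "('x, 'j, 'e) hh_structure"
  assumes "finitely_generated_group G"
  shows "((\<exists>A. finite A \<and> A \<subseteq> carrier G \<and> generate G A = carrier G \<and>
               hierarchically_hyperbolic_space (carrier G) (word_metric G A) H)
            \<longrightarrow> finitely_presented G \<and> quadratic_dehn_function G) \<and>
         (hierarchically_hyperbolic_group G X d H'
            \<longrightarrow> finitely_presented G \<and> quadratic_dehn_function G)"
proof -
  have G: "group G" using assms by (simp add: finitely_generated_group_def)
  have "finitely_presented G \<and> quadratic_dehn_function G" if "\<exists>\<beta>. coarse_meet G \<beta>"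
    using that coarse_meet_finitely_presented[OF assms] coarse_meet_quadratic_dehn_function[OF G] by blast
  then show ?thesis
    using group.word_metric_coarse_meet[OF G] group.hierarchically_hyperbolic_group_coarse_meet[OF G]
    by blast
qed

end
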